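(* Let $m,n\ge 2$ be integers, let $G$ be a connected simple graph on the vertex set $[n]$ and let $K$ be a field of any characteristic. If $G$ is not the complete graph on $[n]$, then $$\mathrm{cd}(J_m(G)) \ge mn-m-n+k(G),$$ where $k(G)$ is the vertex connectivity of $G$.
   Context: $[n]=\{1,\dots,n\}$. $R=K[x_{ij}: i\in[m], j\in[n]]$ is the polynomial ring in $mn$ variables over the field $K$. For a simple graph $G$ on $[n]$, the generalized binomial edge ideal $J_m(G)\subset R$ is the ideal generated by all $x_{ki}x_{lj}-x_{kj}x_{li}$ with $1\le k<l\le m$ and $\{i,j\}$ an edge of $G$, $i<j$. The cohomological dimension of an ideal $I\subset R$ is $\mathrm{cd}(I)=\max\{i\in\mathbb{Z}: H^i_I(R)\ne 0\}$, where $H_I^i(R)$ is the $i$-th local cohomology module of $R$ with support in $I$. A connected graph $G$ on $[n]$ is $k$-vertex-connected if $k<n$ and $G\setminus T$ (the graph obtained by deleting the vertices in $T$ and their incident edges) is connected for every $T\subset[n]$ with $|T|<k$; the vertex connectivity $k(G)$ is the maximum $k$ such that $G$ is $k$-vertex-connected. *)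

theory Defs
  imports
    "HOL-Algebra.Module"
    "HOL-Algebra.QuotRing"
    "HOL-Algebra.Ideal_Product"
    "HOL-Library.Poly_Mapping"
    "Graph_Theory.Digraph_Component"
    "Graph_Theory.Kuratowski"
begin

section \<open>Modules, injective resolutions and local cohomology\<close>

definition module_homs ::
  "('r, 'a) ring_scheme \<Rightarrow> ('r, 'm, 'b) module_scheme \<Rightarrow> ('r, 'n, 'c) module_scheme \<Rightarrow> ('m \<Rightarrow> 'n) set"
where
  "module_homs R M N = {f. f ` carrier M \<subseteq> carrier N \<and>
     (\<forall>x\<in>carrier M. \<forall>y\<in>carrier M. f (x \<oplus>\<^bsub>M\<^esub> y) = f x \<oplus>\<^bsub>N\<^esub> f y) \<and>
     (\<forall>a\<in>carrier R. \<forall>x\<in>carrier M. f (a \<odot>\<^bsub>M\<^esub> x) = a \<odot>\<^bsub>N\<^esub> f x)}"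

text \<open>
  Modules are records extending rings; the ring multiplication and the one of a module play no role,
  and are left unspecified where a module is built that is not a ring.
\<close>

definition regular_module :: "('r, 'a) ring_scheme \<Rightarrow> ('r, 'r) module" where
  "regular_module R = \<lparr>carrier = carrier R, monoid.mult = monoid.mult R, one = one R,
     zero = zero R, add = add R, smult = monoid.mult R\<rparr>"

lemma module_regular_module: "cring R \<Longrightarrow> Module.module R (regular_module R)"
proof -
  assume "cring R"
  then interpret cring R .
  have "abelian_group (regular_module R)"
    by (rule abelian_groupI)
      (auto simp: regular_module_def add.m_ac intro: bexI[OF _ a_inv_closed] l_neg)
  then show ?thesis
    by (rule moduleI[OF \<open>cring R\<close>]) (auto simp: regular_module_def l_distr r_distr m_assoc)
qed

definition quotient_module :: "('r, 'm, 'b) module_scheme \<Rightarrow> 'm set \<Rightarrow> ('r, 'm set) module" where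
  "quotient_module M N = \<lparr>carrier = a_rcosets\<^bsub>M\<^esub> N, monoid.mult = undefined, one = undefined,
     zero = N, add = set_add M, smult = (\<lambda>a X. N <+>\<^bsub>M\<^esub> (\<lambda>x. a \<odot>\<^bsub>M\<^esub> x) ` X)\<rparr>"

text \<open>
  HOL cannot quantify over the carrier types of the test modules \<open>A\<close> and \<open>B\<close>, so these are
  taken with carrier in the type of ring elements.  This loses nothing: it covers the inclusions of
  ideals into \<open>R\<close>, so by Baer's criterion the extension property then holds for test modules
  of any type.
\<close>

definition injective_module :: "('r, 'a) ring_scheme \<Rightarrow> ('r, 'e) module \<Rightarrow> bool" where
  "injective_module R E \<longleftrightarrow> Module.module R E \<and>
     (\<forall>(A :: ('r, 'r) module) (B :: ('r, 'r) module).
        Module.module R A \<longrightarrow> Module.module R B \<longrightarrow>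
        (\<forall>\<iota>\<in>module_homs R A B. \<forall>f\<in>module_homs R A E. inj_on \<iota> (carrier A) \<longrightarrow>
           (\<exists>g\<in>module_homs R B E. \<forall>x\<in>carrier A. g (\<iota> x) = f x)))"

text \<open>
  \<open>0 \<rightarrow> M \<rightarrow> E 0 \<rightarrow> E 1 \<rightarrow> \<dots>\<close> is exact, the maps being \<open>\<epsilon>\<close> and the \<open>d i\<close>.
\<close>

definition injective_resolution ::
  "('r, 'a) ring_scheme \<Rightarrow> ('r, 'm) module \<Rightarrow> ('m \<Rightarrow> 'e) \<Rightarrow> (nat \<Rightarrow> ('r, 'e) module) \<Rightarrow> (nat \<Rightarrow> 'e \<Rightarrow> 'e) \<Rightarrow> bool"
where
  "injective_resolution R M \<epsilon> E d \<longleftrightarrow>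
     (\<forall>i. injective_module R (E i)) \<and>
     \<epsilon> \<in> module_homs R M (E 0) \<and>
     (\<forall>i. d i \<in> module_homs R (E i) (E (Suc i))) \<and>
     inj_on \<epsilon> (carrier M) \<and>
     \<epsilon> ` carrier M = a_kernel (E 0) (E 1) (d 0) \<and>
     (\<forall>i. d i ` carrier (E i) = a_kernel (E (Suc i)) (E (Suc (Suc i))) (d (Suc i)))"

definition cohomology :: "(nat \<Rightarrow> ('r, 'e) module) \<Rightarrow> (nat \<Rightarrow> 'e \<Rightarrow> 'e) \<Rightarrow> nat \<Rightarrow> ('r, 'e set) module" where
  "cohomology C d i =
     quotient_module ((C i)\<lparr>carrier := a_kernel (C i) (C (Suc i)) (d i)\<rparr>)
       (case i of 0 \<Rightarrow> {\<zero>\<^bsub>C 0\<^esub>} | Suc j \<Rightarrow> d j ` carrier (C j))"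

definition torsion_submodule :: "('r, 'a) ring_scheme \<Rightarrow> 'r set \<Rightarrow> ('r, 'm) module \<Rightarrow> ('r, 'm) module" where
  "torsion_submodule R I M = M\<lparr>carrier :=
     {x \<in> carrier M. \<exists>t::nat. \<forall>a \<in> I [^]\<^bsub>ideals_set R\<^esub> t. a \<odot>\<^bsub>M\<^esub> x = \<zero>\<^bsub>M\<^esub>}\<rparr>"

text \<open>
  Local cohomology is the right derived functor of \<open>\<Gamma>\<^sub>I = torsion_submodule R I\<close>, computed from an
  injective resolution of \<open>M\<close>; up to isomorphism it does not depend on which one is chosen.
  The resolution has to live in one fixed type, and \<open>(nat \<times> 'r \<times> 'm) set\<close> is large enough for
  one to exist over every commutative ring \<open>R\<close>.  Its cardinality \<open>\<mu> = 2^\<lambda>\<close>, with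
  \<open>\<lambda>\<close> infinite and at least that of \<open>'r\<close> and \<open>'m\<close>, satisfies \<open>\<mu>^\<lambda> = \<mu>\<close>.
  A module \<open>N\<close> of cardinality at most \<open>\<mu>\<close> lies in a divisible abelian group \<open>D\<close> of
  cardinality at most \<open>\<mu>\<close>, hence in the injective module of additive maps from \<open>R\<close> to
  \<open>D\<close>, again of cardinality at most \<open>\<mu>\<close>, and so is the cokernel.
\<close>

definition some_injective_resolution ::
  "('r, 'a) ring_scheme \<Rightarrow> ('r, 'm) module \<Rightarrow>
    (nat \<Rightarrow> ('r, (nat \<times> 'r \<times> 'm) set) module) \<times>
    (nat \<Rightarrow> (nat \<times> 'r \<times> 'm) set \<Rightarrow> (nat \<times> 'r \<times> 'm) set)"
where
  "some_injective_resolution R M = (SOME (E, d). \<exists>\<epsilon>. injective_resolution R M \<epsilon> E d)"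

definition local_cohomology ::
  "('r, 'a) ring_scheme \<Rightarrow> 'r set \<Rightarrow> ('r, 'm) module \<Rightarrow> nat \<Rightarrow> ('r, (nat \<times> 'r \<times> 'm) set set) module"
where
  "local_cohomology R I M i =
     (let (E, d) = some_injective_resolution R M
      in cohomology (\<lambda>j. torsion_submodule R I (E j)) d i)"

definition cohomological_dimension :: "('r, 'a) ring_scheme \<Rightarrow> 'r set \<Rightarrow> nat" where
  "cohomological_dimension R I =
     Max {i. carrier (local_cohomology R I (regular_module R) i)
               \<noteq> {\<zero>\<^bsub>local_cohomology R I (regular_module R) i\<^esub>}}"


section \<open>Polynomial rings and generalized binomial edge ideals\<close>

text \<open>
  The type \<open>('v \<Rightarrow>\<^sub>0 nat) \<Rightarrow>\<^sub>0 'k\<close> is the polynomial ring over \<open>'k\<close> in variables indexed by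
  all of \<open>'v\<close>; the carrier restricts it to the variables with index in \<open>V\<close>.
\<close>

definition polynomial_ring :: "'v set \<Rightarrow> (('v \<Rightarrow>\<^sub>0 nat) \<Rightarrow>\<^sub>0 'k::field) ring" where
  "polynomial_ring V = \<lparr>carrier = {p. \<forall>t\<in>Poly_Mapping.keys p. Poly_Mapping.keys t \<subseteq> V},
     monoid.mult = (*), one = 1, zero = 0, add = (+)\<rparr>"

definition variable :: "'v \<Rightarrow> (('v \<Rightarrow>\<^sub>0 nat) \<Rightarrow>\<^sub>0 'k::field)" where
  "variable v = Poly_Mapping.single (Poly_Mapping.single v 1) 1"

lemma polynomial_ring_mult_closed:
  fixes p q :: "('v \<Rightarrow>\<^sub>0 nat) \<Rightarrow>\<^sub>0 'k::field"
  assumes "p \<in> carrier (polynomial_ring V)" and "q \<in> carrier (polynomial_ring V)"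
  shows "p * q \<in> carrier (polynomial_ring V)"
proof -
  have "Poly_Mapping.keys t \<subseteq> V" if t: "t \<in> Poly_Mapping.keys (p * q)" for t
  proof -
    from t obtain a b where ab: "a \<in> Poly_Mapping.keys p" "b \<in> Poly_Mapping.keys q" "t = a + b"
      using keys_mult[of p q] by blast
    then show ?thesis
      using assms Poly_Mapping.keys_add[of a b] by (force simp: polynomial_ring_def)
  qed
  then show ?thesis by (simp add: polynomial_ring_def)
qed

lemma cring_polynomial_ring:
  "cring (polynomial_ring V :: (('v \<Rightarrow>\<^sub>0 nat) \<Rightarrow>\<^sub>0 'k::field) ring)" (is "cring ?R")
proof (rule cringI)
  show "abelian_group ?R"
  proof (rule abelian_groupI)
    fix p q assume "p \<in> carrier ?R" "q \<in> carrier ?R"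
    then show "p \<oplus>\<^bsub>?R\<^esub> q \<in> carrier ?R"
      using Poly_Mapping.keys_add[of p q] by (auto simp: polynomial_ring_def)
  next
    fix p assume p: "p \<in> carrier ?R"
    show "\<exists>q\<in>carrier ?R. q \<oplus>\<^bsub>?R\<^esub> p = \<zero>\<^bsub>?R\<^esub>"
      by (rule bexI[of _ "- p"]) (use p in \<open>auto simp: polynomial_ring_def\<close>)
  qed (auto simp: polynomial_ring_def algebra_simps)
next
  show "Group.comm_monoid ?R"
  proof (rule comm_monoidI)
    fix p q assume "p \<in> carrier ?R" "q \<in> carrier ?R"
    then show "p \<otimes>\<^bsub>?R\<^esub> q \<in> carrier ?R"
      using polynomial_ring_mult_closed[of p V q] by (simp add: polynomial_ring_def)
  qed (auto simp: polynomial_ring_def algebra_simps)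
qed (auto simp: polynomial_ring_def algebra_simps)

abbreviation matrix_ring :: "nat \<Rightarrow> nat \<Rightarrow> ((nat \<times> nat \<Rightarrow>\<^sub>0 nat) \<Rightarrow>\<^sub>0 'k::field) ring" where
  "matrix_ring m n \<equiv> polynomial_ring ({1..m} \<times> {1..n})"

text \<open>
  A simple graph is a \<^locale>\<open>pair_graph\<close>: each edge \<open>{i, j}\<close> is present as the two arcs
  \<open>(i, j)\<close> and \<open>(j, i)\<close>.
\<close>

definition generalized_binomial_edge_ideal ::
  "nat \<Rightarrow> nat \<Rightarrow> nat pair_pre_digraph \<Rightarrow> ((nat \<times> nat \<Rightarrow>\<^sub>0 nat) \<Rightarrow>\<^sub>0 'k::field) set"
where
  "generalized_binomial_edge_ideal m n G =
     Idl\<^bsub>matrix_ring m n\<^esub>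
       {variable (k, i) * variable (l, j) - variable (k, j) * variable (l, i) | k l i j.
          1 \<le> k \<and> k < l \<and> l \<le> m \<and> (i, j) \<in> parcs G \<and> i < j}"


section \<open>Vertex connectivity\<close>

definition vertex_connected :: "nat \<Rightarrow> 'a pair_pre_digraph \<Rightarrow> bool" where
  "vertex_connected k G \<longleftrightarrow>
     connected (with_proj G) \<and> k < card (pverts G) \<and>
     (\<forall>T \<subseteq> pverts G. card T < k \<longrightarrow> connected (with_proj G \<restriction> (pverts G - T)))"

definition vertex_connectivity :: "'a pair_pre_digraph \<Rightarrow> nat" where
  "vertex_connectivity G = Max {k. vertex_connected k G}"

end

theory Submission
  imports Defs "HOL-Library.Function_Algebras" "HOL-Library.Countable"
begin

text \<open>
  Every module of \<open>K\<close>-linear maps \<open>Hom(R, N)\<close> over the polynomial ring \<open>R\<close> is injective, and the Koszul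
  complex of the commutators \<open>F \<mapsto> [x\<^sub>v, F]\<close> on \<open>Hom(R, R)\<close> is an injective resolution of \<open>R\<close>.
  Hence local cohomology with support in \<open>I\<close> is the cohomology of the subcomplex of those maps that
  are killed by some power of \<open>I\<close>. If it vanishes in all degrees at least \<open>N = mn - m - n + k(G)\<close>, this
  remains so after setting to 1 a variable \<open>x\<close> for which \<open>x - 1\<close> is a nonzerodivisor modulo all
  powers of the ideal; gradings provide enough such variables. Specializing along a slice at a generic
  rank-one matrix whose columns in a minimum vertex cut are zero leaves \<open>N + 1\<close> variables and an ideal
  that cuts out two pieces meeting only at the origin. Their Mayer--Vietoris class in degree \<open>N\<close> is
  nonzero: it is detected by the trace, which kills commutators.
\<close>

section \<open>Koszul complexes of commuting operators\<close>

text \<open>The zero set of the edge ideal contains the rank-one matrices and, for a vertex cut T,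
  the matrices whose columns in T vanish and whose remaining columns have rank at most one on each
  component. The matrices a_k b_j with all a_k nonzero and b_j zero exactly for j in T lie in both;
  they form an orbit of the row and column scalings, of dimension (n - |T|) + (m - 1), so a
  transversal slice has mn - (n - |T|) - (m - 1) = N + 1 dimensions. Inside the slice both pieces
  have positive dimension, so the punctured zero set is disconnected, and this is what creates
  cohomology one degree below the dimension of the slice. Minimality of T makes every component
  touch every vertex of T; this supplies the products of coordinates that separate the two pieces.
  The scalings allow the orbit to be cut down to a point by setting variables to 1, so every step is
  a polynomial substitution and no localization occurs. Cutting by one equation mixes two
  consecutive degrees, which is why vanishing is assumed in all degrees from N on. The final
  contradiction is that the projection to the constant term has trace 1, in every
  characteristic.\<close>

primrec koszul_diff ::
  "('u \<Rightarrow> 'x \<Rightarrow> 'x) \<Rightarrow> 'u list \<Rightarrow> (bool list \<Rightarrow> 'x::ab_group_add) \<Rightarrow> bool list \<Rightarrow> 'x"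
where
  "koszul_diff D [] F = (\<lambda>w. 0)"
| "koszul_diff D (u # us) F = (\<lambda>w. case w of [] \<Rightarrow> 0 | b # w' \<Rightarrow>
     if b then D u (F (False # w')) - koszul_diff D us (\<lambda>v. F (True # v)) w'
     else koszul_diff D us (\<lambda>v. F (False # v)) w')"

abbreviation weight :: "bool list \<Rightarrow> nat" where
  "weight w \<equiv> count_list w True"

text \<open>A word marks by \<open>True\<close> the factors present in a wedge monomial.
  \<open>koszul_diff\<close> is the usual Koszul differential, built as an iterated mapping cone by
  splitting on the first operator; its minus sign is that of the cone. The value 0 on all other
  words makes equality of cochains equality of functions.\<close>

definition koszul_cochains :: "'x::zero set \<Rightarrow> 'u list \<Rightarrow> nat \<Rightarrow> (bool list \<Rightarrow> 'x) set" where
  "koszul_cochains X us i =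
     {F. \<forall>w. if length w = length us \<and> weight w = i then F w \<in> X else F w = 0}"

lemma weight_le_length: "weight w \<le> length w"
  by (rule count_le_length)

locale commuting_operators =
  fixes X :: "'x::ab_group_add set" and D :: "'u \<Rightarrow> 'x \<Rightarrow> 'x" and U :: "'u set"
  assumes zero_mem: "0 \<in> X"
    and diff_mem: "x \<in> X \<Longrightarrow> y \<in> X \<Longrightarrow> x - y \<in> X"
    and op_mem: "u \<in> U \<Longrightarrow> x \<in> X \<Longrightarrow> D u x \<in> X"
    and op_diff: "u \<in> U \<Longrightarrow> x \<in> X \<Longrightarrow> y \<in> X \<Longrightarrow> D u (x - y) = D u x - D u y"
    and op_commute: "u \<in> U \<Longrightarrow> v \<in> U \<Longrightarrow> x \<in> X \<Longrightarrow> D u (D v x) = D v (D u x)"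
begin

lemma op_zero: "u \<in> U \<Longrightarrow> D u 0 = 0"
  using op_diff[of u 0 0] zero_mem by simp

lemma add_mem: "x \<in> X \<Longrightarrow> y \<in> X \<Longrightarrow> x + y \<in> X"
  using diff_mem[OF _ diff_mem[OF zero_mem], of x y] by simp

lemma op_add: "u \<in> U \<Longrightarrow> x \<in> X \<Longrightarrow> y \<in> X \<Longrightarrow> D u (x + y) = D u x + D u y"
  using op_diff[of u x "0 - y"] op_diff[of u 0 y] op_zero diff_mem[OF zero_mem] zero_mem by simp

lemma cochains_mem: "F \<in> koszul_cochains X us i \<Longrightarrow> F w \<in> X"
  unfolding koszul_cochains_def by (auto split: if_splits dest!: spec[of _ w] intro: zero_mem)

lemma koszul_diff_mem: "set us \<subseteq> U \<Longrightarrow> (\<And>w. F w \<in> X) \<Longrightarrow> koszul_diff D us F w \<in> X"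
proof (induction us arbitrary: F w)
  case (Cons u us)
  have "koszul_diff D us (\<lambda>v. F (c # v)) w' \<in> X" for c w'
    using Cons by auto
  then show ?case using Cons.prems by (auto split: list.split intro!: zero_mem diff_mem op_mem)
qed (simp add: zero_mem)

lemma koszul_diff_diff:
  assumes "set us \<subseteq> U" "\<And>w. F w \<in> X" "\<And>w. G w \<in> X"
  shows "koszul_diff D us (\<lambda>w. F w - G w) w = koszul_diff D us F w - koszul_diff D us G w"
  using assms
proof (induction us arbitrary: F G w)
  case (Cons u us)
  then show ?case by (cases w) (simp_all add: op_diff)
qed simp

lemma koszul_diff_zero: "set us \<subseteq> U \<Longrightarrow> koszul_diff D us (\<lambda>w. 0) w = 0"
  using koszul_diff_diff[of us "\<lambda>w. 0" "\<lambda>w. 0" w] zero_mem by simp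

lemma koszul_diff_add:
  assumes "set us \<subseteq> U" "\<And>w. F w \<in> X" "\<And>w. G w \<in> X"
  shows "koszul_diff D us (\<lambda>w. F w + G w) w = koszul_diff D us F w + koszul_diff D us G w"
  using assms
proof (induction us arbitrary: F G w)
  case (Cons u us)
  then show ?case by (cases w) (simp_all add: op_add)
qed simp

text \<open>A coefficient map that intertwines two families of operators is a chain map. Pullback,
  specialization, multiplication by a polynomial and conjugation are all transported through this
  fact, with different \<open>T\<close> and \<open>D'\<close>.\<close>

lemma koszul_diff_map:
  assumes "set us \<subseteq> U" "\<And>w. F w \<in> X"
    and "\<And>u x. u \<in> set us \<Longrightarrow> x \<in> X \<Longrightarrow> T (D u x) = D' u (T x)"
    and T_diff: "\<And>x y. x \<in> X \<Longrightarrow> y \<in> X \<Longrightarrow> T (x - y) = T x - T y"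
  shows "koszul_diff D' us (\<lambda>w. T (F w)) w = T (koszul_diff D us F w)"
  using assms(1-3)
proof (induction us arbitrary: F w)
  case Nil
  then show ?case using T_diff[of 0 0] zero_mem by simp
next
  case (Cons u us)
  have T0: "T 0 = 0" using T_diff[of 0 0] zero_mem by simp
  show ?case
  proof (cases w)
    case (Cons b w')
    have IH: "koszul_diff D' us (\<lambda>w. T (F (c # w))) w' = T (koszul_diff D us (\<lambda>w. F (c # w)) w')" for c
      using Cons.IH[of "\<lambda>w. F (c # w)" w'] Cons.prems by auto
    have "koszul_diff D us (\<lambda>w. F (True # w)) w' \<in> X"
      using koszul_diff_mem Cons.prems by auto
    then show ?thesis using Cons IH Cons.prems T_diff op_mem by auto
  qed (simp add: T0)
qed

text \<open>In the component at \<open>True\<close>, \<open>D u\<close> of the differential of the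
  \<open>False\<close> part occurs twice, once from each application and with opposite signs,
  because the operators commute. The rest is the induction hypothesis.\<close>

lemma koszul_diff_koszul_diff:
  assumes "set us \<subseteq> U" "\<And>w. F w \<in> X"
  shows "koszul_diff D us (koszul_diff D us F) w = 0"
  using assms
proof (induction us arbitrary: F w)
  case (Cons u us)
  have us: "set us \<subseteq> U" and u: "u \<in> U" using Cons.prems by auto
  have IH: "koszul_diff D us (koszul_diff D us (\<lambda>w. F (c # w))) w' = 0" for c w'
    using Cons.IH[of "\<lambda>w. F (c # w)" w'] Cons.prems by auto
  show ?case
  proof (cases w)
    case w: (Cons b w')
    show ?thesis
    proof (cases b)
      case True
      let ?F0 = "\<lambda>w. F (False # w)" and ?F1 = "\<lambda>w. F (True # w)"
      have "koszul_diff D us (\<lambda>v. D u (?F0 v) - koszul_diff D us ?F1 v) w'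
          = koszul_diff D us (\<lambda>v. D u (?F0 v)) w' - koszul_diff D us (koszul_diff D us ?F1) w'"
        using koszul_diff_diff[of us "\<lambda>v. D u (?F0 v)" "koszul_diff D us ?F1" w']
          us u Cons.prems op_mem koszul_diff_mem by auto
      also have "koszul_diff D us (\<lambda>v. D u (?F0 v)) w' = D u (koszul_diff D us ?F0 w')"
        by (rule koszul_diff_map[OF us]) (use us u Cons.prems(2) op_commute op_diff in auto)
      finally show ?thesis using w True IH[of True] by simp
    next
      case False
      then show ?thesis using w IH[of False] by simp
    qed
  qed simp
qed simp

lemma koszul_diff_cochains:
  assumes "set us \<subseteq> U" "F \<in> koszul_cochains X us i"
  shows "koszul_diff D us F \<in> koszul_cochains X us (Suc i)"
proof -
  have "koszul_diff D us F w = 0" if "\<not> (length w = length us \<and> weight w = Suc i)"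
    and "\<And>w. \<not> (length w = length us \<and> weight w = i) \<Longrightarrow> F w = 0" and "set us \<subseteq> U" for us F w
    using that
  proof (induction us arbitrary: F w i)
    case (Cons u us)
    show ?case
    proof (cases w)
      case w: (Cons b w')
      show ?thesis
      proof (cases b)
        case True
        have "F (False # w') = 0" using Cons.prems w True by auto
        moreover have "koszul_diff D us (\<lambda>v. F (True # v)) w' = 0"
        proof (cases i)
          case 0
          then have "(\<lambda>v. F (True # v)) = (\<lambda>v. 0)" using Cons.prems(2) by fastforce
          then show ?thesis using koszul_diff_zero Cons.prems(3) by simp
        next
          case (Suc j)
          show ?thesis
            by (rule Cons.IH[where i = j]) (use Cons.prems w True Suc in auto)
        qed
        ultimately show ?thesis using w True Cons.prems(3) op_zero by simp
      next
        case False
        have "koszul_diff D us (\<lambda>v. F (False # v)) w' = 0"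
          by (rule Cons.IH[where i = i]) (use Cons.prems w False in auto)
        then show ?thesis using w False by simp
      qed
    qed simp
  qed simp
  moreover have "F w = 0" if "\<not> (length w = length us \<and> weight w = i)" for w
    using assms(2) that by (auto simp: koszul_cochains_def)
  moreover have "koszul_diff D us F w \<in> X" for w
    using koszul_diff_mem assms cochains_mem by blast
  ultimately show ?thesis using assms(1) by (simp add: koszul_cochains_def)
qed

end

lemma cochains_False:
  "F \<in> koszul_cochains X (u # us) i \<Longrightarrow> (\<lambda>w. F (False # w)) \<in> koszul_cochains X us i"
  unfolding koszul_cochains_def mem_Collect_eq
  by (rule allI, drule spec[of _ "False # _"]) (simp split: if_splits)

lemma cochains_True:
  "F \<in> koszul_cochains X (u # us) (Suc i) \<Longrightarrow> (\<lambda>w. F (True # w)) \<in> koszul_cochains X us i"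
  unfolding koszul_cochains_def mem_Collect_eq
  by (rule allI, drule spec[of _ "True # _"]) (simp split: if_splits)

text \<open>Inverse to splitting a cochain by its first letter; \<open>F\<close> carries the full
  degree and \<open>G\<close> one less.\<close>

definition cochain_pair :: "(bool list \<Rightarrow> 'x::zero) \<Rightarrow> (bool list \<Rightarrow> 'x) \<Rightarrow> bool list \<Rightarrow> 'x" where
  "cochain_pair F G w = (case w of [] \<Rightarrow> 0 | b # w' \<Rightarrow> if b then G w' else F w')"

lemma cochain_pair_simps [simp]:
  "cochain_pair F G [] = 0" "cochain_pair F G (True # w) = G w" "cochain_pair F G (False # w) = F w"
  by (simp_all add: cochain_pair_def)

lemma cochain_pair_eq_0_iff:
  "cochain_pair F G = (\<lambda>w. 0) \<longleftrightarrow> F = (\<lambda>w. 0) \<and> (\<forall>w. G w = 0)"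
proof
  assume *: "cochain_pair F G = (\<lambda>w. 0)"
  show "F = (\<lambda>w. 0) \<and> (\<forall>w. G w = 0)"
    using fun_cong[OF *, of "False # _"] fun_cong[OF *, of "True # _"] by auto
qed (auto simp: cochain_pair_def fun_eq_iff split: list.split)

lemma cochain_pair_cochains:
  assumes "F \<in> koszul_cochains X us (Suc i)" "G \<in> koszul_cochains X us i"
  shows "cochain_pair F G \<in> koszul_cochains X (u # us) (Suc i)"
  using assms unfolding koszul_cochains_def
  by (auto simp: cochain_pair_def split: list.split if_splits)

lemma cochain_pair_cochains_0:
  assumes "F \<in> koszul_cochains X us 0"
  shows "cochain_pair F (\<lambda>w. 0) \<in> koszul_cochains X (u # us) 0"
  using assms unfolding koszul_cochains_def
  by (auto simp: cochain_pair_def split: list.split if_splits)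

text \<open>Dual of a regular sequence: surjectivity on the common kernel of the remaining operators
  replaces injectivity on a quotient.\<close>

fun regular_operators :: "'x::zero set \<Rightarrow> ('u \<Rightarrow> 'x \<Rightarrow> 'x) \<Rightarrow> 'u list \<Rightarrow> bool" where
  "regular_operators X D [] \<longleftrightarrow> True"
| "regular_operators X D (u # us) \<longleftrightarrow> regular_operators X D us \<and>
     (\<forall>x\<in>X. (\<forall>v\<in>set us. D v x = 0) \<longrightarrow> (\<exists>y\<in>X. D u y = x \<and> (\<forall>v\<in>set us. D v y = 0)))"

lemma weight_0_iff: "weight w = 0 \<longleftrightarrow> w = replicate (length w) False"
  by (induction w) auto

lemma cochains_0:
  "F \<in> koszul_cochains X us 0 \<longleftrightarrow>
     F (replicate (length us) False) \<in> X \<and> (\<forall>w. w \<noteq> replicate (length us) False \<longrightarrow> F w = 0)"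
proof -
  have "length w = length us \<and> weight w = 0 \<longleftrightarrow> w = replicate (length us) False" for w
    using weight_0_iff[of w] by (metis length_replicate)
  then show ?thesis unfolding koszul_cochains_def by auto
qed

context commuting_operators
begin

lemma koszul_cocycle_0:
  assumes "set us \<subseteq> U" "F \<in> koszul_cochains X us 0"
  shows "koszul_diff D us F = (\<lambda>w. 0) \<longleftrightarrow> (\<forall>u\<in>set us. D u (F (replicate (length us) False)) = 0)"
  using assms
proof (induction us arbitrary: F)
  case (Cons u us)
  let ?F0 = "\<lambda>w. F (False # w)"
  have F0: "?F0 \<in> koszul_cochains X us 0" using cochains_False[OF Cons.prems(2)] .
  have F1: "(\<lambda>v. F (True # v)) = (\<lambda>v. 0)" using Cons.prems by (auto simp: cochains_0)
  have IH: "koszul_diff D us ?F0 = (\<lambda>w. 0) \<longleftrightarrow>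
      (\<forall>v\<in>set us. D v (F (False # replicate (length us) False)) = 0)"
    using Cons.IH[OF _ F0] Cons.prems by auto
  have d: "koszul_diff D (u # us) F = cochain_pair (koszul_diff D us ?F0) (\<lambda>w. D u (?F0 w))"
    using Cons.prems koszul_diff_zero
    by (auto simp: fun_eq_iff cochain_pair_def F1 split: list.split)
  have "koszul_diff D (u # us) F = (\<lambda>w. 0) \<longleftrightarrow>
      koszul_diff D us ?F0 = (\<lambda>w. 0) \<and> (\<forall>w. D u (?F0 w) = 0)"
    unfolding d cochain_pair_eq_0_iff by simp
  also have "(\<forall>w. D u (?F0 w) = 0) \<longleftrightarrow> D u (F (False # replicate (length us) False)) = 0"
    using F0 op_zero[of u] Cons.prems(1) unfolding cochains_0 by (metis list.set_intros(1) subsetD)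
  finally show ?case using IH by auto
qed simp

text \<open>The long exact sequence of the mapping cone written out. The \<open>False\<close> part
  of a cocycle is a cocycle for the tail and has a primitive \<open>G0\<close>. What remains is a
  tail cocycle \<open>H\<close> of one degree less: a tail boundary if that degree is positive, and
  otherwise an element of the common kernel, where regularity applies.\<close>

theorem koszul_exact:
  assumes "set us \<subseteq> U" "regular_operators X D us" "F \<in> koszul_cochains X us (Suc i)"
    and "koszul_diff D us F = (\<lambda>w. 0)"
  shows "\<exists>G\<in>koszul_cochains X us i. koszul_diff D us G = F"
  using assms
proof (induction us arbitrary: F i)
  case Nil
  then have "F = (\<lambda>w. 0)" by (auto simp: koszul_cochains_def fun_eq_iff)
  moreover have "(\<lambda>w. 0) \<in> koszul_cochains X ([] :: 'u list) i"
    by (auto simp: koszul_cochains_def zero_mem)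
  ultimately show ?case by auto
next
  case (Cons u us)
  let ?F0 = "\<lambda>w. F (False # w)" and ?F1 = "\<lambda>w. F (True # w)"
  have us: "set us \<subseteq> U" and u: "u \<in> U" and reg: "regular_operators X D us" using Cons.prems by auto
  have F0: "?F0 \<in> koszul_cochains X us (Suc i)" and F1: "?F1 \<in> koszul_cochains X us i"
    using cochains_False[OF Cons.prems(3)] cochains_True[OF Cons.prems(3)] by auto
  have d: "koszul_diff D (u # us) F w = 0" for w using Cons.prems by simp
  have d0: "koszul_diff D us ?F0 w = 0" for w using d[of "False # w"] by simp
  have d1: "D u (?F0 w) = koszul_diff D us ?F1 w" for w using d[of "True # w"] by simp
  obtain G0 where G0: "G0 \<in> koszul_cochains X us i" "koszul_diff D us G0 = ?F0"
    using Cons.IH[OF us reg F0] d0 by blast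
  have G0_mem: "G0 w \<in> X" for w using G0 cochains_mem by blast
  have F1_mem: "?F1 w \<in> X" for w using F1 cochains_mem by blast
  define H where "H w = D u (G0 w) - ?F1 w" for w
  have H: "H \<in> koszul_cochains X us i"
    using G0(1) F1 op_mem[OF u] op_zero[OF u] diff_mem
    unfolding koszul_cochains_def H_def by auto
  have dH: "koszul_diff D us H w = 0" for w
  proof -
    have "koszul_diff D us H w = koszul_diff D us (\<lambda>w. D u (G0 w)) w - koszul_diff D us ?F1 w"
      unfolding H_def by (rule koszul_diff_diff[OF us]) (use u G0_mem F1_mem op_mem in auto)
    also have "koszul_diff D us (\<lambda>w. D u (G0 w)) w = D u (koszul_diff D us G0 w)"
      by (rule koszul_diff_map[OF us]) (use us u G0_mem op_commute op_diff in auto)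
    finally show ?thesis using d1 G0(2) by simp
  qed
  show ?case
  proof (cases i)
    case 0
    \<comment> \<open>In degree 0 there is no room for a primitive of \<open>H\<close>. Instead
      \<open>G0\<close> is corrected by an element \<open>y\<close> of the common kernel of the tail
      with \<open>D u y = H ?o\<close>, which leaves the tail differential of \<open>G0\<close>
      unchanged.\<close>
    let ?o = "replicate (length us) False"
    have "\<forall>v\<in>set us. D v (H ?o) = 0"
      using koszul_cocycle_0[OF us, of H] H dH 0 by auto
    moreover have "H ?o \<in> X" using H cochains_mem by blast
    ultimately obtain y where y: "y \<in> X" "D u y = H ?o" "\<forall>v\<in>set us. D v y = 0"
      using Cons.prems(2) by auto
    define Y where "Y w = (if w = ?o then y else 0)" for w
    have Y: "Y \<in> koszul_cochains X us 0" using y by (auto simp: cochains_0 Y_def)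
    have dY: "koszul_diff D us Y = (\<lambda>w. 0)" using koszul_cocycle_0[OF us Y] y by (simp add: Y_def)
    define G where "G = cochain_pair (\<lambda>w. G0 w - Y w) (\<lambda>w. 0)"
    have "(\<lambda>w. G0 w - Y w) \<in> koszul_cochains X us 0"
      using G0(1) Y 0 diff_mem by (auto simp: cochains_0)
    then have "G \<in> koszul_cochains X (u # us) i"
      unfolding G_def 0 by (rule cochain_pair_cochains_0)
    moreover have "koszul_diff D (u # us) G w = F w" for w
    proof (cases w)
      case Nil
      then show ?thesis using Cons.prems(3) by (auto simp: koszul_cochains_def)
    next
      case w: (Cons b w')
      have Y_mem: "Y w \<in> X" for w using Y cochains_mem by blast
      have "koszul_diff D us (\<lambda>w. G0 w - Y w) w' = ?F0 w'"
        using koszul_diff_diff[OF us, of G0 Y w'] G0_mem Y_mem G0(2) dY by simp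
      moreover have "D u (G0 w' - Y w') = ?F1 w'"
      proof -
        have "D u (Y w') = H w'" using y H 0 op_zero[OF u] by (auto simp: Y_def cochains_0)
        then show ?thesis using op_diff[OF u G0_mem Y_mem] by (simp add: H_def)
      qed
      moreover have "koszul_diff D us (\<lambda>w. 0) w' = 0" using koszul_diff_zero us by simp
      ultimately show ?thesis using w by (simp add: G_def)
    qed
    ultimately show ?thesis by blast
  next
    case (Suc j)
    obtain G1 where G1: "G1 \<in> koszul_cochains X us j" "koszul_diff D us G1 = H"
      using Cons.IH[OF us reg H[unfolded Suc]] dH by blast
    let ?G = "cochain_pair G0 G1"
    have "?G \<in> koszul_cochains X (u # us) i"
      unfolding Suc by (rule cochain_pair_cochains) (use G0 G1 Suc in auto)
    moreover have "koszul_diff D (u # us) ?G w = F w" for w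
    proof (cases w)
      case Nil
      then show ?thesis using Cons.prems(3) by (auto simp: koszul_cochains_def)
    next
      case w: (Cons b w')
      then show ?thesis using G0(2) G1(2) by (simp add: H_def)
    qed
    ultimately show ?thesis by blast
  qed
qed

end

section \<open>Injective modules and comparison of resolutions\<close>

text \<open>The hypothesis of Baer's criterion; \<open>e\<close> is the image of 1 under an
  extension of \<open>f\<close> to the whole ring.\<close>

definition ideal_extension :: "('r, 'a) ring_scheme \<Rightarrow> ('r, 'e, 'b) module_scheme \<Rightarrow> bool" where
  "ideal_extension R E \<longleftrightarrow>
     (\<forall>I f. ideal I R \<longrightarrow> f \<in> module_homs R (regular_module R\<lparr>carrier := I\<rparr>) E \<longrightarrow>
        (\<exists>e\<in>carrier E. \<forall>a\<in>I. f a = a \<odot>\<^bsub>E\<^esub> e))"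

text \<open>A map from a submodule of \<open>M\<close> is represented by its graph, so that
  extension is inclusion and unions of chains serve in Zorn's lemma. Single-valuedness is required
  at zero and spreads by linearity (\<open>partial_hom_unique\<close>).\<close>

definition partial_hom ::
  "('r, 'a) ring_scheme \<Rightarrow> ('r, 'm, 'b) module_scheme \<Rightarrow> ('r, 'n, 'c) module_scheme \<Rightarrow> ('m \<times> 'n) set \<Rightarrow> bool"
where
  "partial_hom R M N \<Gamma> \<longleftrightarrow>
     \<Gamma> \<subseteq> carrier M \<times> carrier N \<and> (\<zero>\<^bsub>M\<^esub>, \<zero>\<^bsub>N\<^esub>) \<in> \<Gamma> \<and>
     (\<forall>x y x' y'. (x, y) \<in> \<Gamma> \<longrightarrow> (x', y') \<in> \<Gamma> \<longrightarrow> (x \<oplus>\<^bsub>M\<^esub> x', y \<oplus>\<^bsub>N\<^esub> y') \<in> \<Gamma>) \<and>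
     (\<forall>a\<in>carrier R. \<forall>x y. (x, y) \<in> \<Gamma> \<longrightarrow> (a \<odot>\<^bsub>M\<^esub> x, a \<odot>\<^bsub>N\<^esub> y) \<in> \<Gamma>) \<and>
     (\<forall>y. (\<zero>\<^bsub>M\<^esub>, y) \<in> \<Gamma> \<longrightarrow> y = \<zero>\<^bsub>N\<^esub>)"

lemma module_homs_closed: "f \<in> module_homs R M N \<Longrightarrow> x \<in> carrier M \<Longrightarrow> f x \<in> carrier N"
  by (auto simp: module_homs_def)

lemma module_homs_add:
  "f \<in> module_homs R M N \<Longrightarrow> x \<in> carrier M \<Longrightarrow> y \<in> carrier M \<Longrightarrow> f (x \<oplus>\<^bsub>M\<^esub> y) = f x \<oplus>\<^bsub>N\<^esub> f y"
  by (auto simp: module_homs_def)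

lemma module_homs_smult:
  "f \<in> module_homs R M N \<Longrightarrow> a \<in> carrier R \<Longrightarrow> x \<in> carrier M \<Longrightarrow> f (a \<odot>\<^bsub>M\<^esub> x) = a \<odot>\<^bsub>N\<^esub> f x"
  by (auto simp: module_homs_def)

lemma module_homs_zero:
  assumes "Module.module R M" "Module.module R N" "f \<in> module_homs R M N"
  shows "f \<zero>\<^bsub>M\<^esub> = \<zero>\<^bsub>N\<^esub>"
proof -
  interpret M: Module.module R M by fact
  interpret N: Module.module R N by fact
  have "f (\<zero>\<^bsub>R\<^esub> \<odot>\<^bsub>M\<^esub> \<zero>\<^bsub>M\<^esub>) = \<zero>\<^bsub>R\<^esub> \<odot>\<^bsub>N\<^esub> f \<zero>\<^bsub>M\<^esub>"
    by (rule module_homs_smult[OF assms(3)]) auto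
  then show ?thesis using module_homs_closed[OF assms(3)] by simp
qed

lemma module_homs_minus:
  assumes "Module.module R M" "Module.module R N" "f \<in> module_homs R M N"
    and "x \<in> carrier M" "y \<in> carrier M"
  shows "f (x \<ominus>\<^bsub>M\<^esub> y) = f x \<ominus>\<^bsub>N\<^esub> f y"
proof -
  interpret M: Module.module R M by fact
  interpret N: Module.module R N by fact
  have m: "\<ominus>\<^bsub>M\<^esub> y = (\<ominus>\<^bsub>R\<^esub> \<one>\<^bsub>R\<^esub>) \<odot>\<^bsub>M\<^esub> y" "\<ominus>\<^bsub>N\<^esub> f y = (\<ominus>\<^bsub>R\<^esub> \<one>\<^bsub>R\<^esub>) \<odot>\<^bsub>N\<^esub> f y"
    using assms(5) module_homs_closed[OF assms(3)] by (simp_all add: M.smult_l_minus N.smult_l_minus)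
  show ?thesis
    using assms m module_homs_add[OF assms(3)] module_homs_smult[OF assms(3)]
    by (simp add: a_minus_def)
qed

lemma module_homs_comp:
  "f \<in> module_homs R M N \<Longrightarrow> g \<in> module_homs R N P \<Longrightarrow> (\<lambda>x. g (f x)) \<in> module_homs R M P"
  by (auto simp: module_homs_def image_subset_iff)

lemma module_homs_id: "(\<lambda>x. x) \<in> module_homs R M M"
  by (auto simp: module_homs_def)

lemma module_homs_diff:
  assumes "Module.module R N" "f \<in> module_homs R M N" "g \<in> module_homs R M N"
  shows "(\<lambda>x. f x \<ominus>\<^bsub>N\<^esub> g x) \<in> module_homs R M N"
proof -
  interpret N: Module.module R N by fact
  show ?thesis
    using assms(2,3)
    by (auto simp: module_homs_def image_subset_iff a_minus_def N.smult_r_distr N.smult_r_minus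
        N.minus_add N.add.m_ac)
qed

lemma partial_hom_unique:
  assumes "Module.module R M" "Module.module R N" "partial_hom R M N \<Gamma>" "(x, y) \<in> \<Gamma>" "(x, y') \<in> \<Gamma>"
  shows "y = y'"
proof -
  interpret M: Module.module R M by fact
  interpret N: Module.module R N by fact
  have c: "x \<in> carrier M" "y \<in> carrier N" "y' \<in> carrier N"
    using assms(3-5) by (auto simp: partial_hom_def)
  have "((\<ominus>\<^bsub>R\<^esub> \<one>\<^bsub>R\<^esub>) \<odot>\<^bsub>M\<^esub> x, (\<ominus>\<^bsub>R\<^esub> \<one>\<^bsub>R\<^esub>) \<odot>\<^bsub>N\<^esub> y') \<in> \<Gamma>"
    using assms(3,5) unfolding partial_hom_def by auto
  then have "(\<ominus>\<^bsub>M\<^esub> x, \<ominus>\<^bsub>N\<^esub> y') \<in> \<Gamma>"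
    using c by (simp add: M.smult_l_minus N.smult_l_minus)
  then have "(x \<oplus>\<^bsub>M\<^esub> \<ominus>\<^bsub>M\<^esub> x, y \<oplus>\<^bsub>N\<^esub> \<ominus>\<^bsub>N\<^esub> y') \<in> \<Gamma>"
    using assms(3,4) unfolding partial_hom_def by blast
  then have "y \<oplus>\<^bsub>N\<^esub> \<ominus>\<^bsub>N\<^esub> y' = \<zero>\<^bsub>N\<^esub>"
    using assms(3) c by (simp add: M.M.r_neg partial_hom_def)
  then show ?thesis
    using c N.M.minus_equality[of y "\<ominus>\<^bsub>N\<^esub> y'"] by simp
qed

text \<open>The scalars that move \<open>x\<close> into the domain form an ideal \<open>I\<close>.
  The graph induces a map on \<open>I\<close>, which is multiplication by some \<open>e\<close>, and
  this \<open>e\<close> is a consistent value at \<open>x\<close>.\<close>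

lemma partial_hom_extend:
  assumes M: "Module.module R M" and N: "Module.module R N" and ext: "ideal_extension R N"
    and \<Gamma>: "partial_hom R M N \<Gamma>" and x: "x \<in> carrier M"
  shows "\<exists>\<Gamma>'. partial_hom R M N \<Gamma>' \<and> \<Gamma> \<subseteq> \<Gamma>' \<and> x \<in> fst ` \<Gamma>'"
proof -
  interpret M: Module.module R M by fact
  interpret N: Module.module R N by fact
  have \<Gamma>_sub: "\<And>a b. (a, b) \<in> \<Gamma> \<Longrightarrow> a \<in> carrier M \<and> b \<in> carrier N"
    and \<Gamma>_zero: "(\<zero>\<^bsub>M\<^esub>, \<zero>\<^bsub>N\<^esub>) \<in> \<Gamma>"
    and \<Gamma>_add: "\<And>a b a' b'. (a, b) \<in> \<Gamma> \<Longrightarrow> (a', b') \<in> \<Gamma> \<Longrightarrow> (a \<oplus>\<^bsub>M\<^esub> a', b \<oplus>\<^bsub>N\<^esub> b') \<in> \<Gamma>"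
    and \<Gamma>_smult: "\<And>r a b. r \<in> carrier R \<Longrightarrow> (a, b) \<in> \<Gamma> \<Longrightarrow> (r \<odot>\<^bsub>M\<^esub> a, r \<odot>\<^bsub>N\<^esub> b) \<in> \<Gamma>"
    using \<Gamma> unfolding partial_hom_def by blast+
  note uniq = partial_hom_unique[OF M N \<Gamma>]
  define I where "I = {a \<in> carrier R. \<exists>e. (a \<odot>\<^bsub>M\<^esub> x, e) \<in> \<Gamma>}"
  define f where "f a = (SOME e. (a \<odot>\<^bsub>M\<^esub> x, e) \<in> \<Gamma>)" for a
  have f: "(a \<odot>\<^bsub>M\<^esub> x, f a) \<in> \<Gamma>" if "a \<in> I" for a
    using that unfolding I_def f_def by (auto intro: someI_ex)
  have mult: "r \<otimes>\<^bsub>R\<^esub> a \<in> I \<and> f (r \<otimes>\<^bsub>R\<^esub> a) = r \<odot>\<^bsub>N\<^esub> f a" if "a \<in> I" "r \<in> carrier R" for a r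
  proof -
    have "((r \<otimes>\<^bsub>R\<^esub> a) \<odot>\<^bsub>M\<^esub> x, r \<odot>\<^bsub>N\<^esub> f a) \<in> \<Gamma>"
      using \<Gamma>_smult[OF that(2) f[OF that(1)]] that x by (simp add: I_def M.smult_assoc1)
    then have "r \<otimes>\<^bsub>R\<^esub> a \<in> I" using that by (auto simp: I_def)
    then show ?thesis using uniq f \<open>(_, r \<odot>\<^bsub>N\<^esub> f a) \<in> \<Gamma>\<close> by blast
  qed
  have add: "a \<oplus>\<^bsub>R\<^esub> b \<in> I \<and> f (a \<oplus>\<^bsub>R\<^esub> b) = f a \<oplus>\<^bsub>N\<^esub> f b" if "a \<in> I" "b \<in> I" for a b
  proof -
    have "((a \<oplus>\<^bsub>R\<^esub> b) \<odot>\<^bsub>M\<^esub> x, f a \<oplus>\<^bsub>N\<^esub> f b) \<in> \<Gamma>"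
      using \<Gamma>_add[OF f[OF that(1)] f[OF that(2)]] that x by (simp add: I_def M.smult_l_distr)
    then have "a \<oplus>\<^bsub>R\<^esub> b \<in> I" using that by (auto simp: I_def)
    then show ?thesis using uniq f \<open>(_, f a \<oplus>\<^bsub>N\<^esub> f b) \<in> \<Gamma>\<close> by blast
  qed
  have "ideal I R"
  proof (rule idealI)
    show "ring R" by (rule M.R.ring_axioms)
    show "subgroup I (add_monoid R)"
    proof (rule M.R.add.subgroupI)
      show "I \<noteq> {}" using \<Gamma>_zero x by (auto simp: I_def intro!: exI[of _ "\<zero>\<^bsub>R\<^esub>"])
      show "\<ominus>\<^bsub>R\<^esub> a \<in> I" if "a \<in> I" for a
        using mult[OF that, of "\<ominus>\<^bsub>R\<^esub> \<one>\<^bsub>R\<^esub>"] that by (simp add: I_def M.R.l_minus)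
    qed (use add in \<open>auto simp: I_def\<close>)
  next
    fix a r assume "a \<in> I" "r \<in> carrier R"
    then show "r \<otimes>\<^bsub>R\<^esub> a \<in> I" "a \<otimes>\<^bsub>R\<^esub> r \<in> I"
      using mult[of a r] by (auto simp: I_def M.R.m_comm)
  qed
  moreover have "f \<in> module_homs R (regular_module R\<lparr>carrier := I\<rparr>) N"
    using mult add \<Gamma>_sub[OF f] by (auto simp: module_homs_def regular_module_def)
  ultimately obtain e where e: "e \<in> carrier N" "\<And>a. a \<in> I \<Longrightarrow> f a = a \<odot>\<^bsub>N\<^esub> e"
    using ext unfolding ideal_extension_def by blast
  define \<Gamma>' where
    "\<Gamma>' = {(y \<oplus>\<^bsub>M\<^esub> a \<odot>\<^bsub>M\<^esub> x, b \<oplus>\<^bsub>N\<^esub> a \<odot>\<^bsub>N\<^esub> e) | y a b. (y, b) \<in> \<Gamma> \<and> a \<in> carrier R}"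
  have mem: "(y \<oplus>\<^bsub>M\<^esub> a \<odot>\<^bsub>M\<^esub> x, b \<oplus>\<^bsub>N\<^esub> a \<odot>\<^bsub>N\<^esub> e) \<in> \<Gamma>'" if "(y, b) \<in> \<Gamma>" "a \<in> carrier R" for y a b
    using that unfolding \<Gamma>'_def by blast
  have sub: "\<Gamma> \<subseteq> \<Gamma>'"
  proof clarify
    fix y b assume "(y, b) \<in> \<Gamma>"
    then show "(y, b) \<in> \<Gamma>'" using mem[of y b "\<zero>\<^bsub>R\<^esub>"] \<Gamma>_sub x e by simp
  qed
  have "partial_hom R M N \<Gamma>'"
    unfolding partial_hom_def
  proof (intro conjI allI ballI impI)
    show "\<Gamma>' \<subseteq> carrier M \<times> carrier N" using \<Gamma>_sub x e by (auto simp: \<Gamma>'_def)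
    show "(\<zero>\<^bsub>M\<^esub>, \<zero>\<^bsub>N\<^esub>) \<in> \<Gamma>'" using sub \<Gamma>_zero by blast
  next
    fix y b y' b' assume "(y, b) \<in> \<Gamma>'" "(y', b') \<in> \<Gamma>'"
    then obtain z c r z' c' r' where *: "(z, c) \<in> \<Gamma>" "r \<in> carrier R" "(z', c') \<in> \<Gamma>" "r' \<in> carrier R"
      "y = z \<oplus>\<^bsub>M\<^esub> r \<odot>\<^bsub>M\<^esub> x" "b = c \<oplus>\<^bsub>N\<^esub> r \<odot>\<^bsub>N\<^esub> e" "y' = z' \<oplus>\<^bsub>M\<^esub> r' \<odot>\<^bsub>M\<^esub> x" "b' = c' \<oplus>\<^bsub>N\<^esub> r' \<odot>\<^bsub>N\<^esub> e"
      unfolding \<Gamma>'_def by blast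
    have "y \<oplus>\<^bsub>M\<^esub> y' = (z \<oplus>\<^bsub>M\<^esub> z') \<oplus>\<^bsub>M\<^esub> (r \<oplus>\<^bsub>R\<^esub> r') \<odot>\<^bsub>M\<^esub> x"
      "b \<oplus>\<^bsub>N\<^esub> b' = (c \<oplus>\<^bsub>N\<^esub> c') \<oplus>\<^bsub>N\<^esub> (r \<oplus>\<^bsub>R\<^esub> r') \<odot>\<^bsub>N\<^esub> e"
      using * x e \<Gamma>_sub[OF *(1)] \<Gamma>_sub[OF *(3)]
      by (simp_all add: M.smult_l_distr N.smult_l_distr M.M.add.m_ac N.M.add.m_ac)
    then show "(y \<oplus>\<^bsub>M\<^esub> y', b \<oplus>\<^bsub>N\<^esub> b') \<in> \<Gamma>'"
      using mem[OF \<Gamma>_add[OF *(1,3)], of "r \<oplus>\<^bsub>R\<^esub> r'"] *(2,4) by simp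
  next
    fix s y b assume s: "s \<in> carrier R" and "(y, b) \<in> \<Gamma>'"
    then obtain z c r where *: "(z, c) \<in> \<Gamma>" "r \<in> carrier R"
      "y = z \<oplus>\<^bsub>M\<^esub> r \<odot>\<^bsub>M\<^esub> x" "b = c \<oplus>\<^bsub>N\<^esub> r \<odot>\<^bsub>N\<^esub> e"
      unfolding \<Gamma>'_def by blast
    have "s \<odot>\<^bsub>M\<^esub> y = s \<odot>\<^bsub>M\<^esub> z \<oplus>\<^bsub>M\<^esub> (s \<otimes>\<^bsub>R\<^esub> r) \<odot>\<^bsub>M\<^esub> x" "s \<odot>\<^bsub>N\<^esub> b = s \<odot>\<^bsub>N\<^esub> c \<oplus>\<^bsub>N\<^esub> (s \<otimes>\<^bsub>R\<^esub> r) \<odot>\<^bsub>N\<^esub> e"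
      using * s x e \<Gamma>_sub[OF *(1)]
      by (simp_all add: M.smult_r_distr N.smult_r_distr M.smult_assoc1 N.smult_assoc1)
    then show "(s \<odot>\<^bsub>M\<^esub> y, s \<odot>\<^bsub>N\<^esub> b) \<in> \<Gamma>'"
      using mem[OF \<Gamma>_smult[OF s *(1)], of "s \<otimes>\<^bsub>R\<^esub> r"] s *(2) by simp
  next
    \<comment> \<open>If z + r x = 0, then r lies in \<open>I\<close>, and the value at r x is both
      r e and the negative of the value c at z.\<close>
    fix b assume "(\<zero>\<^bsub>M\<^esub>, b) \<in> \<Gamma>'"
    then obtain z c r where *: "(z, c) \<in> \<Gamma>" "r \<in> carrier R"
      "\<zero>\<^bsub>M\<^esub> = z \<oplus>\<^bsub>M\<^esub> r \<odot>\<^bsub>M\<^esub> x" "b = c \<oplus>\<^bsub>N\<^esub> r \<odot>\<^bsub>N\<^esub> e"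
      unfolding \<Gamma>'_def by blast
    have "((\<ominus>\<^bsub>R\<^esub> \<one>\<^bsub>R\<^esub>) \<odot>\<^bsub>M\<^esub> z, (\<ominus>\<^bsub>R\<^esub> \<one>\<^bsub>R\<^esub>) \<odot>\<^bsub>N\<^esub> c) \<in> \<Gamma>"
      using \<Gamma>_smult *(1) by simp
    then have neg: "(\<ominus>\<^bsub>M\<^esub> z, \<ominus>\<^bsub>N\<^esub> c) \<in> \<Gamma>"
      using \<Gamma>_sub[OF *(1)] by (simp add: M.smult_l_minus N.smult_l_minus)
    have "r \<odot>\<^bsub>M\<^esub> x = \<ominus>\<^bsub>M\<^esub> z"
      using * x \<Gamma>_sub[OF *(1)] M.M.minus_equality[of "r \<odot>\<^bsub>M\<^esub> x" z] by (simp add: M.M.add.m_ac)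
    then have "r \<in> I" "(r \<odot>\<^bsub>M\<^esub> x, \<ominus>\<^bsub>N\<^esub> c) \<in> \<Gamma>" using neg *(2) by (auto simp: I_def)
    then have "r \<odot>\<^bsub>N\<^esub> e = \<ominus>\<^bsub>N\<^esub> c" using e(2) uniq f by metis
    then show "b = \<zero>\<^bsub>N\<^esub>" using *(4) \<Gamma>_sub[OF *(1)] by (simp add: N.M.r_neg)
  qed
  moreover have "x \<in> fst ` \<Gamma>'"
    using mem[OF \<Gamma>_zero, of "\<one>\<^bsub>R\<^esub>"] x by (force simp: image_iff)
  ultimately show ?thesis using sub by blast
qed

text \<open>Zorn's lemma on graphs: a maximal one is total by \<open>partial_hom_extend\<close>.
  \<open>M\<close> may have any carrier type, which frees injectivity from the fixed type of test
  modules in \<open>injective_module\<close>.\<close>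

theorem baer_extension:
  assumes M: "Module.module R M" and N: "Module.module R N" and ext: "ideal_extension R N"
    and \<Gamma>: "partial_hom R M N \<Gamma>"
  shows "\<exists>g\<in>module_homs R M N. \<forall>x y. (x, y) \<in> \<Gamma> \<longrightarrow> g x = y"
proof -
  let ?A = "{\<Gamma>'. partial_hom R M N \<Gamma>' \<and> \<Gamma> \<subseteq> \<Gamma>'}"
  have "\<exists>\<Delta>\<in>?A. \<forall>X\<in>?A. \<Delta> \<subseteq> X \<longrightarrow> X = \<Delta>"
  proof (rule subset_Zorn_nonempty)
    show "?A \<noteq> {}" using \<Gamma> by blast
    fix C assume C: "C \<noteq> {}" "subset.chain ?A C"
    have ph: "partial_hom R M N X" if "X \<in> C" for X using C that by (auto simp: subset.chain_def)
    have "partial_hom R M N (\<Union>C)"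
      unfolding partial_hom_def
    proof (intro conjI allI ballI impI)
      show "\<Union>C \<subseteq> carrier M \<times> carrier N" using ph unfolding partial_hom_def by blast
      show "(\<zero>\<^bsub>M\<^esub>, \<zero>\<^bsub>N\<^esub>) \<in> \<Union>C" using ph C unfolding partial_hom_def by blast
    next
      fix x y x' y' assume "(x, y) \<in> \<Union>C" "(x', y') \<in> \<Union>C"
      then obtain X X' where X: "X \<in> C" "X' \<in> C" "(x, y) \<in> X" "(x', y') \<in> X'" by blast
      then have "X \<subseteq> X' \<or> X' \<subseteq> X" using C by (auto simp: subset_chain_def)
      then obtain Z where "Z \<in> C" "(x, y) \<in> Z" "(x', y') \<in> Z" using X by blast
      then show "(x \<oplus>\<^bsub>M\<^esub> x', y \<oplus>\<^bsub>N\<^esub> y') \<in> \<Union>C" using ph unfolding partial_hom_def by blast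
    next
      fix a x y assume "a \<in> carrier R" "(x, y) \<in> \<Union>C"
      then show "(a \<odot>\<^bsub>M\<^esub> x, a \<odot>\<^bsub>N\<^esub> y) \<in> \<Union>C" using ph unfolding partial_hom_def by blast
    next
      fix y assume "(\<zero>\<^bsub>M\<^esub>, y) \<in> \<Union>C"
      then show "y = \<zero>\<^bsub>N\<^esub>" using ph unfolding partial_hom_def by blast
    qed
    moreover have "\<Gamma> \<subseteq> \<Union>C" using C unfolding subset.chain_def by fast
    ultimately show "\<Union>C \<in> ?A" by blast
  qed
  then obtain \<Delta> where \<Delta>_mem: "\<Delta> \<in> ?A" and max_A: "\<forall>X\<in>?A. \<Delta> \<subseteq> X \<longrightarrow> X = \<Delta>" ..
  have \<Delta>: "partial_hom R M N \<Delta>" "\<Gamma> \<subseteq> \<Delta>" using \<Delta>_mem by auto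
  have max: "X = \<Delta>" if "partial_hom R M N X" "\<Delta> \<subseteq> X" for X
    using max_A that order_trans[OF \<Delta>(2) that(2)] by blast
  have dom: "\<exists>y. (x, y) \<in> \<Delta>" if "x \<in> carrier M" for x
    using partial_hom_extend[OF M N ext \<Delta>(1) that] max by force
  define g where "g x = (SOME y. (x, y) \<in> \<Delta>)" for x
  have g: "(x, g x) \<in> \<Delta>" if "x \<in> carrier M" for x
    unfolding g_def using dom[OF that] by (rule someI_ex)
  note uniq = partial_hom_unique[OF M N \<Delta>(1)]
  interpret M: Module.module R M by fact
  have "g (x \<oplus>\<^bsub>M\<^esub> y) = g x \<oplus>\<^bsub>N\<^esub> g y" if "x \<in> carrier M" "y \<in> carrier M" for x y
  proof (rule uniq)
    show "(x \<oplus>\<^bsub>M\<^esub> y, g x \<oplus>\<^bsub>N\<^esub> g y) \<in> \<Delta>" using g \<Delta>(1) that unfolding partial_hom_def by blast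
  qed (use g that in simp)
  moreover have "g (a \<odot>\<^bsub>M\<^esub> x) = a \<odot>\<^bsub>N\<^esub> g x" if "a \<in> carrier R" "x \<in> carrier M" for a x
  proof (rule uniq)
    show "(a \<odot>\<^bsub>M\<^esub> x, a \<odot>\<^bsub>N\<^esub> g x) \<in> \<Delta>" using g \<Delta>(1) that unfolding partial_hom_def by blast
  qed (use g that in simp)
  moreover have "g x \<in> carrier N" if "x \<in> carrier M" for x
    using g[OF that] \<Delta>(1) unfolding partial_hom_def by blast
  ultimately have "g \<in> module_homs R M N" by (auto simp: module_homs_def)
  moreover have "g x = y" if xy: "(x, y) \<in> \<Gamma>" for x y
  proof -
    have "(x, y) \<in> \<Delta>" using xy \<Delta>(2) by blast
    moreover have "x \<in> carrier M" using xy \<Gamma> by (auto simp: partial_hom_def)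
    ultimately show ?thesis using uniq[OF g] by blast
  qed
  ultimately show ?thesis by blast
qed

text \<open>The test maps are the inclusions of ideals into the ring, which live in the type of ring
  elements; \<open>e\<close> is the image of 1 under the extended map.\<close>

lemma injective_ideal_extension:
  assumes "injective_module R E"
  shows "ideal_extension R E"
  unfolding ideal_extension_def
proof (intro allI impI)
  fix I f assume I: "ideal I R" and f: "f \<in> module_homs R (regular_module R\<lparr>carrier := I\<rparr>) E"
  have E: "Module.module R E" using assms by (simp add: injective_module_def)
  interpret E: Module.module R E by (rule E)
  interpret I: ideal I R by (rule I)
  let ?A = "regular_module R\<lparr>carrier := I\<rparr>" and ?B = "regular_module R"
  have B: "Module.module R ?B" by (rule module_regular_module) (rule E.R.is_cring)
  have "submodule I R ?B"
  proof (rule Module.module.submoduleI[OF B])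
    fix a assume a: "a \<in> I"
    have "\<ominus>\<^bsub>?B\<^esub> a = \<ominus>\<^bsub>R\<^esub> a" by (simp add: regular_module_def a_inv_def m_inv_def)
    then show "\<ominus>\<^bsub>?B\<^esub> a \<in> I" using a by simp
  qed (auto simp: regular_module_def I.I_l_closed)
  then have A: "Module.module R ?A" by (rule submodule.submodule_is_module) (rule B)
  have "(\<lambda>x. x) \<in> module_homs R ?A ?B"
    by (auto simp: module_homs_def regular_module_def)
  moreover have "\<forall>\<iota>\<in>module_homs R ?A ?B. \<forall>f\<in>module_homs R ?A E. inj_on \<iota> (carrier ?A) \<longrightarrow>
      (\<exists>g\<in>module_homs R ?B E. \<forall>x\<in>carrier ?A. g (\<iota> x) = f x)"
    using assms A B unfolding injective_module_def by blast
  ultimately have "\<exists>g\<in>module_homs R ?B E. \<forall>x\<in>carrier ?A. g x = f x"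
    using f by fastforce
  then obtain g where g: "g \<in> module_homs R ?B E" "\<And>x. x \<in> I \<Longrightarrow> g x = f x"
    by auto
  have "f a = a \<odot>\<^bsub>E\<^esub> g \<one>\<^bsub>R\<^esub>" if "a \<in> I" for a
    using module_homs_smult[OF g(1), of a "\<one>\<^bsub>R\<^esub>"] g(2)[OF that] that
    by (simp add: regular_module_def)
  moreover have "g \<one>\<^bsub>R\<^esub> \<in> carrier E" using module_homs_closed[OF g(1)] by (simp add: regular_module_def)
  ultimately show "\<exists>e\<in>carrier E. \<forall>a\<in>I. f a = a \<odot>\<^bsub>E\<^esub> e" by blast
qed

text \<open>The pairs (d x, g x) form the graph of a map on the image of \<open>d\<close> as soon as
  \<open>g\<close> vanishes on the kernel of \<open>d\<close>, and this graph extends. In this form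
  injectivity yields both chain maps and homotopies.\<close>

lemma injective_factor:
  assumes E: "injective_module R E" and M: "Module.module R M" and N: "Module.module R N"
    and d: "d \<in> module_homs R M N" and g: "g \<in> module_homs R M E"
    and ker: "\<And>x. x \<in> carrier M \<Longrightarrow> d x = \<zero>\<^bsub>N\<^esub> \<Longrightarrow> g x = \<zero>\<^bsub>E\<^esub>"
  shows "\<exists>h\<in>module_homs R N E. \<forall>x\<in>carrier M. h (d x) = g x"
proof -
  have E': "Module.module R E" using E by (simp add: injective_module_def)
  interpret M: Module.module R M by (rule M)
  let ?\<Gamma> = "(\<lambda>x. (d x, g x)) ` carrier M"
  have "partial_hom R N E ?\<Gamma>"
    unfolding partial_hom_def
  proof (intro conjI allI ballI impI)
    show "?\<Gamma> \<subseteq> carrier N \<times> carrier E" using module_homs_closed[OF d] module_homs_closed[OF g] by blast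
    show "(\<zero>\<^bsub>N\<^esub>, \<zero>\<^bsub>E\<^esub>) \<in> ?\<Gamma>"
      using module_homs_zero[OF M N d] module_homs_zero[OF M E' g] by (auto intro!: image_eqI[of _ _ "\<zero>\<^bsub>M\<^esub>"])
  next
    fix x y x' y' assume "(x, y) \<in> ?\<Gamma>" "(x', y') \<in> ?\<Gamma>"
    then obtain z z' where "z \<in> carrier M" "z' \<in> carrier M" "x = d z" "y = g z" "x' = d z'" "y' = g z'"
      by blast
    then show "(x \<oplus>\<^bsub>N\<^esub> x', y \<oplus>\<^bsub>E\<^esub> y') \<in> ?\<Gamma>"
      using module_homs_add[OF d, of z z'] module_homs_add[OF g, of z z']
      by (auto intro!: image_eqI[of _ _ "z \<oplus>\<^bsub>M\<^esub> z'"])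
  next
    fix a x y assume a: "a \<in> carrier R" and "(x, y) \<in> ?\<Gamma>"
    then obtain z where "z \<in> carrier M" "x = d z" "y = g z" by blast
    then show "(a \<odot>\<^bsub>N\<^esub> x, a \<odot>\<^bsub>E\<^esub> y) \<in> ?\<Gamma>"
      using a module_homs_smult[OF d, of a z] module_homs_smult[OF g, of a z]
      by (auto intro!: image_eqI[of _ _ "a \<odot>\<^bsub>M\<^esub> z"])
  next
    fix y assume "(\<zero>\<^bsub>N\<^esub>, y) \<in> ?\<Gamma>"
    then show "y = \<zero>\<^bsub>E\<^esub>" using ker by auto
  qed
  from baer_extension[OF N E' injective_ideal_extension[OF E] this] show ?thesis by blast
qed


section \<open>Comparison of injective resolutions up to homotopy\<close>

lemma injective_resolutionD:
  assumes "injective_resolution R M \<epsilon> E d"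
  shows "injective_module R (E i)" "Module.module R (E i)" "\<epsilon> \<in> module_homs R M (E 0)"
    "d i \<in> module_homs R (E i) (E (Suc i))"
    "x \<in> carrier M \<Longrightarrow> d 0 (\<epsilon> x) = \<zero>\<^bsub>E 1\<^esub>"
    "y \<in> carrier (E 0) \<Longrightarrow> d 0 y = \<zero>\<^bsub>E 1\<^esub> \<Longrightarrow> \<exists>x\<in>carrier M. y = \<epsilon> x"
    "z \<in> carrier (E i) \<Longrightarrow> d (Suc i) (d i z) = \<zero>\<^bsub>E (Suc (Suc i))\<^esub>"
    "z' \<in> carrier (E (Suc i)) \<Longrightarrow> d (Suc i) z' = \<zero>\<^bsub>E (Suc (Suc i))\<^esub> \<Longrightarrow> \<exists>z\<in>carrier (E i). z' = d i z"
proof -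
  note * = assms[unfolded injective_resolution_def]
  show "injective_module R (E i)" "\<epsilon> \<in> module_homs R M (E 0)" "d i \<in> module_homs R (E i) (E (Suc i))"
    using * by auto
  then show "Module.module R (E i)" by (simp add: injective_module_def)
  have 0: "\<epsilon> ` carrier M = {y \<in> carrier (E 0). d 0 y = \<zero>\<^bsub>E 1\<^esub>}"
    using * by (simp add: a_kernel_def')
  show "x \<in> carrier M \<Longrightarrow> d 0 (\<epsilon> x) = \<zero>\<^bsub>E 1\<^esub>"
    "y \<in> carrier (E 0) \<Longrightarrow> d 0 y = \<zero>\<^bsub>E 1\<^esub> \<Longrightarrow> \<exists>x\<in>carrier M. y = \<epsilon> x"
    using 0 by blast+
  have "d i ` carrier (E i) = {y \<in> carrier (E (Suc i)). d (Suc i) y = \<zero>\<^bsub>E (Suc (Suc i))\<^esub>}"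
    using * by (simp add: a_kernel_def')
  then show "z \<in> carrier (E i) \<Longrightarrow> d (Suc i) (d i z) = \<zero>\<^bsub>E (Suc (Suc i))\<^esub>"
    "z' \<in> carrier (E (Suc i)) \<Longrightarrow> d (Suc i) z' = \<zero>\<^bsub>E (Suc (Suc i))\<^esub> \<Longrightarrow> \<exists>z\<in>carrier (E i). z' = d i z"
    by blast+
qed

text \<open>The identity of \<open>M\<close> is lifted degree by degree with
  \<open>injective_factor\<close>. \<open>P\<close> carries along that each map sends cocycles to
  cocycles, which is the kernel condition for the next lift.\<close>

lemma resolution_map_exists:
  assumes M: "Module.module R M"
    and E: "injective_resolution R M \<epsilon> E d" and E': "injective_resolution R M \<epsilon>' E' d'"
  shows "\<exists>\<phi>. (\<forall>i. \<phi> i \<in> module_homs R (E i) (E' i)) \<and> (\<forall>x\<in>carrier M. \<phi> 0 (\<epsilon> x) = \<epsilon>' x) \<and>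
    (\<forall>i. \<forall>x\<in>carrier (E i). \<phi> (Suc i) (d i x) = d' i (\<phi> i x))"
proof -
  note D = injective_resolutionD[OF E] and D' = injective_resolutionD[OF E']
  define P where "P i f \<longleftrightarrow> f \<in> module_homs R (E i) (E' i) \<and> (i = 0 \<longrightarrow> (\<forall>x\<in>carrier M. f (\<epsilon> x) = \<epsilon>' x)) \<and>
    (\<forall>x\<in>carrier (E i). d i x = \<zero>\<^bsub>E (Suc i)\<^esub> \<longrightarrow> d' i (f x) = \<zero>\<^bsub>E' (Suc i)\<^esub>)" for i f
  define Q where "Q i f f' \<longleftrightarrow> (\<forall>x\<in>carrier (E i). f' (d i x) = d' i (f x))" for i and f f' :: "_ \<Rightarrow> _"
  have "\<exists>\<phi>. \<forall>i. P i (\<phi> i) \<and> Q i (\<phi> i) (\<phi> (Suc i))"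
  proof (rule dependent_nat_choice)
    have "inj_on \<epsilon> (carrier M)" using E by (simp add: injective_resolution_def)
    moreover have "\<epsilon> \<zero>\<^bsub>M\<^esub> = \<zero>\<^bsub>E 0\<^esub>" "\<zero>\<^bsub>M\<^esub> \<in> carrier M" "\<epsilon>' \<zero>\<^bsub>M\<^esub> = \<zero>\<^bsub>E' 0\<^esub>"
      using module_homs_zero[OF M D(2,3)] module_homs_zero[OF M D'(2,3)]
      by (auto intro: abelian_monoid.zero_closed abelian_group.axioms(1) module.axioms(2) M)
    ultimately have "\<exists>h\<in>module_homs R (E 0) (E' 0). \<forall>x\<in>carrier M. h (\<epsilon> x) = \<epsilon>' x"
      by (intro injective_factor[OF D'(1) M D(2,3) D'(3)]) (metis inj_onD)
    then obtain f where f: "f \<in> module_homs R (E 0) (E' 0)" "\<And>x. x \<in> carrier M \<Longrightarrow> f (\<epsilon> x) = \<epsilon>' x" by blast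
    have "d' 0 (f x) = \<zero>\<^bsub>E' (Suc 0)\<^esub>" if x: "x \<in> carrier (E 0)" "d 0 x = \<zero>\<^bsub>E (Suc 0)\<^esub>" for x
      using D(6)[OF x(1)] x(2) f(2) D'(5) by auto
    then have "P 0 f" unfolding P_def using f by auto
    then show "\<exists>f. P 0 f" by blast
  next
    fix i f assume f: "P i f"
    have "(\<lambda>x. d' i (f x)) \<in> module_homs R (E i) (E' (Suc i))"
      using module_homs_comp[OF _ D'(4), of f "E i"] f by (simp add: P_def)
    then have "\<exists>g\<in>module_homs R (E (Suc i)) (E' (Suc i)). \<forall>x\<in>carrier (E i). g (d i x) = d' i (f x)"
      by (intro injective_factor[OF D'(1) D(2) D(2) D(4)]) (use f in \<open>auto simp: P_def\<close>)
    then obtain g where g: "g \<in> module_homs R (E (Suc i)) (E' (Suc i))" "\<And>x. x \<in> carrier (E i) \<Longrightarrow> g (d i x) = d' i (f x)"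
      by blast
    have "d' (Suc i) (g y) = \<zero>\<^bsub>E' (Suc (Suc i))\<^esub>"
      if y: "y \<in> carrier (E (Suc i))" "d (Suc i) y = \<zero>\<^bsub>E (Suc (Suc i))\<^esub>" for y
    proof -
      obtain x where x: "x \<in> carrier (E i)" "y = d i x" using D(8)[OF y] by blast
      moreover have "f x \<in> carrier (E' i)" using module_homs_closed[OF _ x(1)] f unfolding P_def by auto
      ultimately show ?thesis using g(2) D'(7) by simp
    qed
    then have "P (Suc i) g" unfolding P_def using g by auto
    then show "\<exists>g. P (Suc i) g \<and> Q i f g" using g(2) unfolding Q_def by blast
  qed
  then obtain \<phi> where "\<forall>i. P i (\<phi> i) \<and> Q i (\<phi> i) (\<phi> (Suc i))" by blast
  then show ?thesis unfolding P_def Q_def by (intro exI[of _ \<phi>]) auto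
qed

text \<open>A chain map that vanishes on \<open>M\<close> is null-homotopic. \<open>P\<close>
  records the homotopy identity on boundaries; by exactness these are all cocycles, so the map still
  to be factored kills the kernel of \<open>d (Suc i)\<close>.\<close>

lemma resolution_homotopy_exists:
  assumes M: "Module.module R M"
    and E: "injective_resolution R M \<epsilon> E d" and E': "injective_resolution R M \<epsilon>' E' d'"
    and \<chi>: "\<And>i. \<chi> i \<in> module_homs R (E i) (E' i)"
    and \<chi>\<epsilon>: "\<And>x. x \<in> carrier M \<Longrightarrow> \<chi> 0 (\<epsilon> x) = \<zero>\<^bsub>E' 0\<^esub>"
    and \<chi>d: "\<And>i x. x \<in> carrier (E i) \<Longrightarrow> \<chi> (Suc i) (d i x) = d' i (\<chi> i x)"
  shows "\<exists>h. (\<forall>i. h i \<in> module_homs R (E (Suc i)) (E' i)) \<and>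
    (\<forall>i. \<forall>y\<in>carrier (E (Suc i)). h (Suc i) (d (Suc i) y) = \<chi> (Suc i) y \<ominus>\<^bsub>E' (Suc i)\<^esub> d' i (h i y))"
proof -
  note D = injective_resolutionD[OF E] and D' = injective_resolutionD[OF E']
  define P where "P i f \<longleftrightarrow> f \<in> module_homs R (E (Suc i)) (E' i) \<and>
    (\<forall>x\<in>carrier (E i). \<chi> (Suc i) (d i x) = d' i (f (d i x)))" for i f
  define Q where "Q i f f' \<longleftrightarrow> (\<forall>y\<in>carrier (E (Suc i)).
    f' (d (Suc i) y) = \<chi> (Suc i) y \<ominus>\<^bsub>E' (Suc i)\<^esub> d' i (f y))" for i and f f' :: "_ \<Rightarrow> _"
  have "\<exists>h. \<forall>i. P i (h i) \<and> Q i (h i) (h (Suc i))"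
  proof (rule dependent_nat_choice)
    have "\<exists>h\<in>module_homs R (E (Suc 0)) (E' 0). \<forall>x\<in>carrier (E 0). h (d 0 x) = \<chi> 0 x"
      by (rule injective_factor[OF D'(1) D(2) D(2) D(4) \<chi>]) (use D(6) \<chi>\<epsilon> in auto)
    then obtain h where "h \<in> module_homs R (E (Suc 0)) (E' 0)" "\<And>x. x \<in> carrier (E 0) \<Longrightarrow> h (d 0 x) = \<chi> 0 x"
      by blast
    then have "P 0 h" unfolding P_def using \<chi>d by auto
    then show "\<exists>h. P 0 h" by blast
  next
    fix i f assume f: "P i f"
    interpret E'i: Module.module R "E' (Suc i)" by (rule D'(2))
    let ?g = "\<lambda>y. \<chi> (Suc i) y \<ominus>\<^bsub>E' (Suc i)\<^esub> d' i (f y)"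
    have df: "(\<lambda>y. d' i (f y)) \<in> module_homs R (E (Suc i)) (E' (Suc i))"
      using module_homs_comp[OF _ D'(4), of f "E (Suc i)"] f by (simp add: P_def)
    have g: "?g \<in> module_homs R (E (Suc i)) (E' (Suc i))"
      by (rule module_homs_diff[OF D'(2) \<chi> df])
    have ker: "?g y = \<zero>\<^bsub>E' (Suc i)\<^esub>"
      if y: "y \<in> carrier (E (Suc i))" "d (Suc i) y = \<zero>\<^bsub>E (Suc (Suc i))\<^esub>" for y
    proof -
      obtain x where x: "x \<in> carrier (E i)" "y = d i x" using D(8)[OF y] by blast
      then have "\<chi> (Suc i) y = d' i (f y)" using f by (simp add: P_def)
      then show ?thesis using module_homs_closed[OF df y(1)] by (simp add: a_minus_def E'i.M.r_neg)
    qed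
    obtain h where h: "h \<in> module_homs R (E (Suc (Suc i))) (E' (Suc i))"
      "\<And>y. y \<in> carrier (E (Suc i)) \<Longrightarrow> h (d (Suc i) y) = ?g y"
      using injective_factor[OF D'(1) D(2) D(2) D(4) g ker] by blast
    interpret E'': Module.module R "E' (Suc (Suc i))" by (rule D'(2))
    have "\<chi> (Suc (Suc i)) (d (Suc i) y) = d' (Suc i) (h (d (Suc i) y))" if y: "y \<in> carrier (E (Suc i))" for y
    proof -
      have "f y \<in> carrier (E' i)" using module_homs_closed[OF _ y] f unfolding P_def by auto
      then have "d' (Suc i) (d' i (f y)) = \<zero>\<^bsub>E' (Suc (Suc i))\<^esub>" by (rule D'(7))
      then have "d' (Suc i) (?g y) = d' (Suc i) (\<chi> (Suc i) y)"
        using module_homs_minus[OF D'(2,2,4) module_homs_closed[OF \<chi> y] module_homs_closed[OF df y]]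
          module_homs_closed[OF D'(4) module_homs_closed[OF \<chi> y]] by (simp add: a_minus_def)
      then show ?thesis using h(2)[OF y] \<chi>d[OF y] by simp
    qed
    then have "P (Suc i) h" unfolding P_def using h by auto
    then show "\<exists>h. P (Suc i) h \<and> Q i f h" using h(2) unfolding Q_def by blast
  qed
  then obtain h where "\<forall>i. P i (h i) \<and> Q i (h i) (h (Suc i))" by blast
  then show ?thesis unfolding P_def Q_def by (intro exI[of _ h]) auto
qed

text \<open>Vanishing of local cohomology in degree \<open>Suc i\<close>, stated on elements so that
  no quotient modules appear in the argument.\<close>

definition torsion_exact ::
  "('r, 'a) ring_scheme \<Rightarrow> 'r set \<Rightarrow> (nat \<Rightarrow> ('r, 'e) module) \<Rightarrow> (nat \<Rightarrow> 'e \<Rightarrow> 'e) \<Rightarrow> nat \<Rightarrow> bool"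
where
  "torsion_exact R I E d i \<longleftrightarrow>
     (\<forall>z\<in>carrier (torsion_submodule R I (E (Suc i))). d (Suc i) z = \<zero>\<^bsub>E (Suc (Suc i))\<^esub> \<longrightarrow>
        (\<exists>y\<in>carrier (torsion_submodule R I (E i)). z = d i y))"

definition ideal_powers :: "('r, 'a) ring_scheme \<Rightarrow> 'r set \<Rightarrow> nat \<Rightarrow> 'r set" where
  "ideal_powers R I t = I [^]\<^bsub>ideals_set R\<^esub> t"

lemma ideal_powers_0: "ideal_powers R I 0 = carrier R"
  by (simp add: ideal_powers_def ideals_set_def)

lemma ideal_powers_Suc: "ideal_powers R I (Suc t) = ideal_prod R (ideal_powers R I t) I"
  by (simp add: ideal_powers_def ideals_set_def)

lemma ideal_powers_ideal:
  assumes "cring R" "ideal I R"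
  shows "ideal (ideal_powers R I t) R"
proof (induction t)
  case 0
  then show ?case using cring.axioms(1)[OF assms(1)] by (simp add: ideal_powers_0 ring.oneideal)
next
  case (Suc t)
  then show ?case
    using ring.ideal_prod_is_ideal[OF cring.axioms(1)[OF assms(1)] _ assms(2)] by (simp add: ideal_powers_Suc)
qed

lemma ideal_powers_antimono:
  assumes "cring R" "ideal I R" "s \<le> t"
  shows "ideal_powers R I t \<subseteq> ideal_powers R I s"
proof -
  have "ideal_powers R I (Suc t) \<subseteq> ideal_powers R I t" for t
    using ring.ideal_prod_inter[OF cring.axioms(1)[OF assms(1)] ideal_powers_ideal[OF assms(1,2), of t] assms(2)]
    by (simp add: ideal_powers_Suc)
  then show ?thesis using assms(3) by (rule lift_Suc_antimono_le)
qed

lemma torsion_submodule_carrier: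
  "x \<in> carrier (torsion_submodule R I M) \<longleftrightarrow>
     x \<in> carrier M \<and> (\<exists>t. \<forall>a\<in>ideal_powers R I t. a \<odot>\<^bsub>M\<^esub> x = \<zero>\<^bsub>M\<^esub>)"
  by (simp add: torsion_submodule_def ideal_powers_def)

lemma torsion_module_homs:
  assumes "Module.module R M" "Module.module R N" "ideal I R" "f \<in> module_homs R M N"
    and x: "x \<in> carrier (torsion_submodule R I M)"
  shows "f x \<in> carrier (torsion_submodule R I N)"
proof -
  interpret M: Module.module R M by fact
  obtain t where t: "x \<in> carrier M" "\<forall>a\<in>ideal_powers R I t. a \<odot>\<^bsub>M\<^esub> x = \<zero>\<^bsub>M\<^esub>"
    using x unfolding torsion_submodule_carrier by blast
  have "a \<odot>\<^bsub>N\<^esub> f x = \<zero>\<^bsub>N\<^esub>" if a: "a \<in> ideal_powers R I t" for a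
  proof -
    have "a \<in> carrier R"
      using a ideal_powers_ideal[OF M.R.is_cring assms(3)] by (meson ideal.Icarr)
    then have "a \<odot>\<^bsub>N\<^esub> f x = f (a \<odot>\<^bsub>M\<^esub> x)" using module_homs_smult[OF assms(4)] t(1) by simp
    then show ?thesis using t a module_homs_zero[OF assms(1,2,4)] by simp
  qed
  then show ?thesis
    unfolding torsion_submodule_carrier using module_homs_closed[OF assms(4) t(1)] by blast
qed

lemma torsion_submodule_minus:
  assumes M: "Module.module R M" and I: "ideal I R"
    and x: "x \<in> carrier (torsion_submodule R I M)" and y: "y \<in> carrier (torsion_submodule R I M)"
  shows "x \<ominus>\<^bsub>M\<^esub> y \<in> carrier (torsion_submodule R I M)"
proof -
  interpret M: Module.module R M by fact
  obtain s t where s: "x \<in> carrier M" "\<forall>a\<in>ideal_powers R I s. a \<odot>\<^bsub>M\<^esub> x = \<zero>\<^bsub>M\<^esub>"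
    and t: "y \<in> carrier M" "\<forall>a\<in>ideal_powers R I t. a \<odot>\<^bsub>M\<^esub> y = \<zero>\<^bsub>M\<^esub>"
    using x y unfolding torsion_submodule_carrier by blast
  have "a \<odot>\<^bsub>M\<^esub> (x \<ominus>\<^bsub>M\<^esub> y) = \<zero>\<^bsub>M\<^esub>" if a: "a \<in> ideal_powers R I (max s t)" for a
  proof -
    have "a \<in> carrier R"
      using a ideal_powers_ideal[OF M.R.is_cring I] by (meson ideal.Icarr)
    moreover have "a \<in> ideal_powers R I s" "a \<in> ideal_powers R I t"
      using a ideal_powers_antimono[OF M.R.is_cring I] by (meson max.cobounded1 max.cobounded2 subsetD)+
    ultimately show ?thesis using s t by (simp add: a_minus_def M.smult_r_distr M.smult_r_minus)
  qed
  then show ?thesis unfolding torsion_submodule_carrier using s t by blast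
qed

text \<open>Comparison maps and homotopies are linear, hence preserve torsion. If the image of
  \<open>z\<close> in the other resolution is the boundary of a torsion element \<open>y\<close>,
  then \<open>z\<close> is the boundary of \<open>\<psi> i y\<close> minus
  \<open>h i z\<close>.\<close>

theorem torsion_exact_independent:
  assumes M: "Module.module R M" and I: "ideal I R"
    and E: "injective_resolution R M \<epsilon> E d" and E': "injective_resolution R M \<epsilon>' E' d'"
    and exact: "torsion_exact R I E' d' i"
  shows "torsion_exact R I E d i"
proof -
  note D = injective_resolutionD[OF E] and D' = injective_resolutionD[OF E']
  obtain \<phi> where \<phi>: "\<And>i. \<phi> i \<in> module_homs R (E i) (E' i)" "\<And>x. x \<in> carrier M \<Longrightarrow> \<phi> 0 (\<epsilon> x) = \<epsilon>' x"
    "\<And>i x. x \<in> carrier (E i) \<Longrightarrow> \<phi> (Suc i) (d i x) = d' i (\<phi> i x)"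
    using resolution_map_exists[OF M E E'] by blast
  obtain \<psi> where \<psi>: "\<And>i. \<psi> i \<in> module_homs R (E' i) (E i)" "\<And>x. x \<in> carrier M \<Longrightarrow> \<psi> 0 (\<epsilon>' x) = \<epsilon> x"
    "\<And>i x. x \<in> carrier (E' i) \<Longrightarrow> \<psi> (Suc i) (d' i x) = d i (\<psi> i x)"
    using resolution_map_exists[OF M E' E] by blast
  define \<chi> where "\<chi> i x = \<psi> i (\<phi> i x) \<ominus>\<^bsub>E i\<^esub> x" for i x
  have \<psi>\<phi>: "(\<lambda>x. \<psi> i (\<phi> i x)) \<in> module_homs R (E i) (E i)" for i
    by (rule module_homs_comp[OF \<phi>(1) \<psi>(1)])
  have \<chi>: "\<chi> i \<in> module_homs R (E i) (E i)" for i
    unfolding \<chi>_def by (rule module_homs_diff[OF D(2) \<psi>\<phi> module_homs_id])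
  have \<chi>\<epsilon>: "\<chi> 0 (\<epsilon> x) = \<zero>\<^bsub>E 0\<^esub>" if "x \<in> carrier M" for x
  proof -
    interpret E0: Module.module R "E 0" by (rule D(2))
    show ?thesis using \<phi>(2) \<psi>(2) that module_homs_closed[OF D(3) that]
      by (simp add: \<chi>_def a_minus_def E0.M.r_neg)
  qed
  have \<chi>d: "\<chi> (Suc i) (d i x) = d i (\<chi> i x)" if "x \<in> carrier (E i)" for i x
    using \<phi>(3) \<psi>(3) that module_homs_closed[OF \<phi>(1) that] module_homs_closed[OF \<psi>\<phi> that]
      module_homs_minus[OF D(2,2,4)] by (simp add: \<chi>_def)
  obtain h where h: "\<And>i. h i \<in> module_homs R (E (Suc i)) (E i)"
    "\<And>i y. y \<in> carrier (E (Suc i)) \<Longrightarrow> h (Suc i) (d (Suc i) y) = \<chi> (Suc i) y \<ominus>\<^bsub>E (Suc i)\<^esub> d i (h i y)"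
    using resolution_homotopy_exists[OF M E E \<chi> \<chi>\<epsilon> \<chi>d] by blast
  show ?thesis
    unfolding torsion_exact_def
  proof (intro ballI impI)
    fix z assume z: "z \<in> carrier (torsion_submodule R I (E (Suc i)))" "d (Suc i) z = \<zero>\<^bsub>E (Suc (Suc i))\<^esub>"
    interpret Ei: Module.module R "E (Suc i)" by (rule D(2))
    have zE: "z \<in> carrier (E (Suc i))" using z by (simp add: torsion_submodule_carrier)
    have "d' (Suc i) (\<phi> (Suc i) z) = \<zero>\<^bsub>E' (Suc (Suc i))\<^esub>"
      using \<phi>(3)[OF zE] z(2) module_homs_zero[OF D(2) D'(2) \<phi>(1)] by simp
    moreover have "\<phi> (Suc i) z \<in> carrier (torsion_submodule R I (E' (Suc i)))"
      by (rule torsion_module_homs[OF D(2) D'(2) I \<phi>(1) z(1)])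
    ultimately obtain y where y: "y \<in> carrier (torsion_submodule R I (E' i))" "\<phi> (Suc i) z = d' i y"
      using exact unfolding torsion_exact_def by blast
    have yE: "y \<in> carrier (E' i)" using y by (simp add: torsion_submodule_carrier)
    let ?y = "\<psi> i y \<ominus>\<^bsub>E i\<^esub> h i z"
    have "?y \<in> carrier (torsion_submodule R I (E i))"
      by (intro torsion_submodule_minus[OF D(2) I] torsion_module_homs[OF _ _ I \<psi>(1) y(1)]
          torsion_module_homs[OF _ _ I h(1) z(1)] D(2) D'(2))
    moreover have "z = d i ?y"
    proof -
      have c: "\<psi> (Suc i) (\<phi> (Suc i) z) \<in> carrier (E (Suc i))" "d i (h i z) \<in> carrier (E (Suc i))"
        using module_homs_closed[OF \<psi>\<phi> zE] module_homs_closed[OF D(4) module_homs_closed[OF h(1) zE]] by auto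
      have "h (Suc i) \<zero>\<^bsub>E (Suc (Suc i))\<^esub> = \<zero>\<^bsub>E (Suc i)\<^esub>"
        by (rule module_homs_zero[OF D(2) D(2) h(1)])
      then have "\<chi> (Suc i) z \<ominus>\<^bsub>E (Suc i)\<^esub> d i (h i z) = \<zero>\<^bsub>E (Suc i)\<^esub>"
        using h(2)[OF zE] z(2) by simp
      then have "\<psi> (Suc i) (\<phi> (Suc i) z) \<ominus>\<^bsub>E (Suc i)\<^esub> d i (h i z) \<ominus>\<^bsub>E (Suc i)\<^esub> z = \<zero>\<^bsub>E (Suc i)\<^esub>"
        using c zE by (simp add: \<chi>_def a_minus_def Ei.M.add.m_ac)
      then have "\<psi> (Suc i) (\<phi> (Suc i) z) \<ominus>\<^bsub>E (Suc i)\<^esub> d i (h i z) = z"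
        using c zE Ei.M.minus_equality[of "\<psi> (Suc i) (\<phi> (Suc i) z) \<ominus>\<^bsub>E (Suc i)\<^esub> d i (h i z)" "\<ominus>\<^bsub>E (Suc i)\<^esub> z"]
        by (simp add: a_minus_def)
      moreover have "d i ?y = d i (\<psi> i y) \<ominus>\<^bsub>E (Suc i)\<^esub> d i (h i z)"
        by (rule module_homs_minus[OF D(2,2,4) module_homs_closed[OF \<psi>(1) yE] module_homs_closed[OF h(1) zE]])
      ultimately show ?thesis using y(2) \<psi>(3)[OF yE] by simp
    qed
    ultimately show "\<exists>y\<in>carrier (torsion_submodule R I (E i)). z = d i y" by blast
  qed
qed

section \<open>Polynomials as mappings on monomials\<close>

type_synonym ('v, 'k) mpoly = "('v \<Rightarrow>\<^sub>0 nat) \<Rightarrow>\<^sub>0 'k"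

abbreviation polys :: "'v set \<Rightarrow> ('v, 'k::field) mpoly set" where
  "polys V \<equiv> carrier (polynomial_ring V)"

abbreviation single :: "'a \<Rightarrow> 'b::zero \<Rightarrow> 'a \<Rightarrow>\<^sub>0 'b" where
  "single \<equiv> Poly_Mapping.single"

abbreviation const :: "'k \<Rightarrow> ('v, 'k::field) mpoly" where
  "const c \<equiv> Poly_Mapping.single 0 c"

abbreviation monomial :: "('v \<Rightarrow>\<^sub>0 nat) \<Rightarrow> ('v, 'k::field) mpoly" where
  "monomial t \<equiv> Poly_Mapping.single t 1"

abbreviation keys :: "('a \<Rightarrow>\<^sub>0 'b::zero) \<Rightarrow> 'a set" where
  "keys \<equiv> Poly_Mapping.keys"

abbreviation lookup :: "('a \<Rightarrow>\<^sub>0 'b::zero) \<Rightarrow> 'a \<Rightarrow> 'b" where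
  "lookup \<equiv> Poly_Mapping.lookup"

lemma polys_iff: "p \<in> polys V \<longleftrightarrow> (\<forall>t\<in>keys p. keys t \<subseteq> V)"
  by (simp add: polynomial_ring_def)

lemma polys_ops [simp]:
  "monoid.mult (polynomial_ring V) = (*)" "one (polynomial_ring V) = 1"
  "add (polynomial_ring V) = (+)" "zero (polynomial_ring V) = 0"
  by (simp_all add: polynomial_ring_def)

lemma keys_add_nat: "keys (s + t) = keys s \<union> keys t" for s t :: "'v \<Rightarrow>\<^sub>0 nat"
  by (auto simp: in_keys_iff lookup_add)

lemma polys_0 [simp]: "0 \<in> polys V"
  and polys_1 [simp]: "1 \<in> polys V"
  by (simp_all add: polys_iff)

lemma polys_single: "single t c \<in> polys V \<longleftrightarrow> c = 0 \<or> keys t \<subseteq> V"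
  by (simp add: polys_iff)

lemma polys_const [simp]: "const c \<in> polys V"
  by (simp add: polys_single)

lemma polys_variable [simp]: "variable v \<in> polys V \<longleftrightarrow> v \<in> V"
  by (simp add: variable_def polys_single)

lemma polys_add [simp]: "p \<in> polys V \<Longrightarrow> q \<in> polys V \<Longrightarrow> p + q \<in> polys V"
  using Poly_Mapping.keys_add[of p q] by (auto simp: polys_iff)

lemma polys_uminus [simp]: "p \<in> polys V \<Longrightarrow> - p \<in> polys V"
  by (simp add: polys_iff in_keys_iff)

lemma polys_diff [simp]: "p \<in> polys V \<Longrightarrow> q \<in> polys V \<Longrightarrow> p - q \<in> polys V"
  using polys_add[of p V "- q"] polys_uminus[of q V] by simp

lemma polys_mult [simp]: "p \<in> polys V \<Longrightarrow> q \<in> polys V \<Longrightarrow> p * q \<in> polys V"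
  by (rule polynomial_ring_mult_closed)

lemma polys_sum: "(\<And>i. i \<in> A \<Longrightarrow> f i \<in> polys V) \<Longrightarrow> sum f A \<in> polys V"
  by (induction A rule: infinite_finite_induct) auto

lemma polys_power [simp]: "p \<in> polys V \<Longrightarrow> p ^ n \<in> polys V"
  by (induction n) auto

lemma polys_prod: "(\<And>i. i \<in> A \<Longrightarrow> f i \<in> polys V) \<Longrightarrow> prod f A \<in> polys V"
  by (induction A rule: infinite_finite_induct) auto

lemma polys_mono: "V \<subseteq> W \<Longrightarrow> p \<in> polys V \<Longrightarrow> p \<in> polys W"
  by (auto simp: polys_iff)

lemma poly_sum_singles: "p = (\<Sum>t\<in>keys p. single t (lookup p t))"
proof (rule poly_mapping_eqI)
  fix t
  have "lookup (\<Sum>t\<in>keys p. single t (lookup p t)) t = (\<Sum>s\<in>keys p. if s = t then lookup p s else 0)"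
    by (simp add: lookup_sum lookup_single when_def)
  also have "\<dots> = lookup p t" by (simp add: in_keys_iff)
  finally show "lookup p t = lookup (\<Sum>t\<in>keys p. single t (lookup p t)) t" by simp
qed

lemma polys_induct [consumes 1, case_names zero single add]:
  assumes "p \<in> polys V" "Q 0" "\<And>t c. keys t \<subseteq> V \<Longrightarrow> Q (single t c)"
    and "\<And>p q. p \<in> polys V \<Longrightarrow> q \<in> polys V \<Longrightarrow> Q p \<Longrightarrow> Q q \<Longrightarrow> Q (p + q)"
  shows "Q p"
proof -
  have "Q (\<Sum>t\<in>A. single t (lookup p t)) \<and> (\<Sum>t\<in>A. single t (lookup p t)) \<in> polys V"
    if "finite A" "A \<subseteq> keys p" for A
    using that
  proof (induction A rule: finite_induct)
    case (insert t A)
    then have t: "keys t \<subseteq> V" using assms(1) by (simp add: polys_iff)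
    then show ?case using insert assms(3,4) by (simp add: polys_single)
  qed (simp add: assms(2))
  then show ?thesis using poly_sum_singles[of p] by (metis finite_keys subset_refl)
qed

lemma poly_induct [case_names zero single add]:
  assumes "Q 0" "\<And>t c. Q (single t c)" "\<And>p q. Q p \<Longrightarrow> Q q \<Longrightarrow> Q (p + q)"
  shows "Q (p :: ('v, 'k::field) mpoly)"
proof -
  have "p \<in> polys UNIV" by (simp add: polys_iff)
  then show ?thesis by (induction rule: polys_induct) (auto intro: assms)
qed

lemma single_const_mono: "single t c = const c * monomial t"
  by (simp add: mult_single)

lemma mono_mult: "monomial s * monomial t = monomial (s + t)"
  by (simp add: mult_single)

section \<open>Weights, linear maps, substitutions and homogeneous components\<close>

definition wdeg :: "('v \<Rightarrow> nat) \<Rightarrow> ('v \<Rightarrow>\<^sub>0 nat) \<Rightarrow> nat" where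
  "wdeg w t = (\<Sum>v\<in>keys t. w v * lookup t v)"

lemma wdeg_add [simp]: "wdeg w (s + t) = wdeg w s + wdeg w t"
  unfolding wdeg_def
  by (rule setsum_keys_plus_distrib[of "\<lambda>v. (*) (w v)"]) (simp_all add: algebra_simps)

lemma wdeg_0 [simp]: "wdeg w 0 = 0"
  by (simp add: wdeg_def)

lemma wdeg_single [simp]: "wdeg w (single v n) = w v * n"
  by (simp add: wdeg_def)

lemma monomial_split:
  fixes t :: "'v \<Rightarrow>\<^sub>0 nat"
  assumes "v \<in> keys t"
  shows "\<exists>s. t = single v 1 + s"
proof
  show "t = single v 1 + (t - single v 1)"
    using assms by (intro poly_mapping_eqI) (auto simp: lookup_add lookup_minus lookup_single when_def in_keys_iff)
qed

lemma monomial_induct [case_names zero add]: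
  fixes t :: "'v \<Rightarrow>\<^sub>0 nat"
  assumes "Q 0" "\<And>v t. Q t \<Longrightarrow> Q (single v 1 + t)"
  shows "Q t"
proof (induction "wdeg (\<lambda>v. 1) t" arbitrary: t rule: less_induct)
  case less
  show ?case
  proof (cases "t = 0")
    case False
    then obtain v where v: "v \<in> keys t" by (auto simp: poly_mapping_eq_iff fun_eq_iff in_keys_iff)
    obtain s where s: "t = single v 1 + s" using monomial_split[OF v] ..
    then have "Q s" using less by simp
    then show ?thesis unfolding s by (rule assms(2))
  qed (simp add: assms(1))
qed

definition klinear :: "(('v, 'k::field) mpoly \<Rightarrow> ('v, 'k) mpoly) \<Rightarrow> bool" where
  "klinear F \<longleftrightarrow> (\<forall>p q. F (p + q) = F p + F q) \<and> (\<forall>c p. F (const c * p) = const c * F p)"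

lemma klinear_add: "klinear F \<Longrightarrow> F (p + q) = F p + F q"
  and klinear_scale: "klinear F \<Longrightarrow> F (const c * p) = const c * F p"
  by (simp_all add: klinear_def)

lemma klinear_single: "klinear F \<Longrightarrow> F (single t c) = const c * F (monomial t)"
  using klinear_scale[of F c "monomial t"] by (simp add: mult_single)

lemma klinear_zero: "klinear F \<Longrightarrow> F 0 = 0"
  using klinear_scale[of F 0 0] by simp

lemma klinear_uminus: "klinear F \<Longrightarrow> F (- p) = - F p"
  using klinear_add[of F p "- p"] klinear_zero[of F] minus_unique[of "F p" "F (- p)"] by simp

lemma klinear_diff: "klinear F \<Longrightarrow> F (p - q) = F p - F q"
  using klinear_add[of F p "- q"] klinear_uminus[of F q] by simp

lemma klinear_sum: "klinear F \<Longrightarrow> F (sum f A) = (\<Sum>i\<in>A. F (f i))"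
  by (induction A rule: infinite_finite_induct) (auto simp: klinear_zero klinear_add)

lemma klinear_eq_on:
  assumes "klinear F" "klinear G" "\<And>t. keys t \<subseteq> V \<Longrightarrow> F (monomial t) = G (monomial t)" "p \<in> polys V"
  shows "F p = G p"
  using assms(4)
proof (induction rule: polys_induct)
  case (single t c)
  then show ?case
    using klinear_single[OF assms(1), of t c] klinear_single[OF assms(2), of t c] assms(3) by simp
qed (simp_all add: klinear_zero[OF assms(1)] klinear_zero[OF assms(2)]
      klinear_add[OF assms(1)] klinear_add[OF assms(2)])

lemma klinear_eqI:
  assumes "klinear F" "klinear G" "\<And>t. F (monomial t) = G (monomial t)"
  shows "F = G"
  using klinear_eq_on[OF assms(1,2), of UNIV] assms(3) by (auto simp: polys_iff)

lemma klinear_id: "klinear (\<lambda>p. p)"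
  and klinear_0: "klinear (\<lambda>p. 0)"
  by (simp_all add: klinear_def)

lemma klinear_comp: "klinear F \<Longrightarrow> klinear G \<Longrightarrow> klinear (\<lambda>p. F (G p))"
  by (simp add: klinear_def)

lemma klinear_minus: "klinear F \<Longrightarrow> klinear G \<Longrightarrow> klinear (\<lambda>p. F p - G p)"
  by (simp add: klinear_def algebra_simps)

lemma klinear_mult: "klinear (\<lambda>p. a * p)"
  by (simp add: klinear_def algebra_simps)

lemma klinear_lmult: "klinear F \<Longrightarrow> klinear (\<lambda>p. a * F p)"
  by (rule klinear_comp[OF klinear_mult])

lemma klinear_rmult: "klinear F \<Longrightarrow> klinear (\<lambda>p. F (a * p))"
  by (rule klinear_comp[OF _ klinear_mult])

definition lext :: "(('v \<Rightarrow>\<^sub>0 nat) \<Rightarrow> ('v, 'k::field) mpoly) \<Rightarrow> ('v, 'k) mpoly \<Rightarrow> ('v, 'k) mpoly" where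
  "lext f p = (\<Sum>t\<in>keys p. const (lookup p t) * f t)"

lemma lext_single [simp]: "lext f (single t c) = const c * f t"
  by (simp add: lext_def)

lemma lext_klinear [simp]: "klinear (lext f)"
proof -
  have add: "lext f (p + q) = lext f p + lext f q" for p q
    unfolding lext_def
    by (rule setsum_keys_plus_distrib[of "\<lambda>t c. const c * f t"]) (simp_all add: single_add algebra_simps)
  have "lext f (const c * p) = const c * lext f p" for c p
  proof (induction p rule: poly_induct)
    case (single t d)
    have "const c * single t d = single t (c * d)" "const (c * d) = const c * (const d :: ('a, 'b) mpoly)"
      by (simp_all add: mult_single)
    then show ?case by (simp only: lext_single mult.assoc)
  qed (simp_all add: add algebra_simps lext_def[of f 0])
  then show ?thesis using add by (simp add: klinear_def)
qed

lemma lext_polys: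
  assumes "\<And>t. t \<in> keys p \<Longrightarrow> f t \<in> polys V"
  shows "lext f p \<in> polys V"
  unfolding lext_def by (rule polys_sum) (use assms in simp)

text \<open>This is also the substitution of 0 for all variables outside \<open>V\<close>; it
  normalizes maps that are given on \<open>polys V\<close>.\<close>

definition res :: "'v set \<Rightarrow> ('v, 'k::field) mpoly \<Rightarrow> ('v, 'k) mpoly" where
  "res V = lext (\<lambda>t. if keys t \<subseteq> V then monomial t else 0)"

lemma res_klinear [simp]: "klinear (res V)"
  by (simp add: res_def)

lemma res_single: "res V (single t c) = (if keys t \<subseteq> V then single t c else 0)"
  by (simp add: res_def mult_single)

lemma res_polys [simp]: "res V p \<in> polys V"
  unfolding res_def by (rule lext_polys) (auto simp: polys_single)

lemma res_id: "p \<in> polys V \<Longrightarrow> res V p = p"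
  by (rule klinear_eq_on[OF res_klinear klinear_id]) (simp_all add: res_single)

lemma res_mult: "a \<in> polys V \<Longrightarrow> res V (a * p) = a * res V p"
proof (induction rule: polys_induct)
  case (single t c)
  have "(\<lambda>p. res V (single t c * p)) = (\<lambda>p. single t c * res V p)"
    by (rule klinear_eqI) (use single in \<open>auto intro!: klinear_rmult klinear_lmult
        simp: mult_single res_single keys_add_nat\<close>)
  then show ?case by (rule fun_cong)
qed (simp_all add: klinear_zero klinear_add algebra_simps)

definition algebra_hom :: "(('v, 'k::field) mpoly \<Rightarrow> ('v, 'k) mpoly) \<Rightarrow> bool" where
  "algebra_hom h \<longleftrightarrow> klinear h \<and> h 1 = 1 \<and> (\<forall>p q. h (p * q) = h p * h q)"

lemma algebra_homD:
  assumes "algebra_hom h"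
  shows "klinear h" "h 1 = 1" "h (p * q) = h p * h q"
  using assms by (simp_all add: algebra_hom_def)

lemma algebra_hom_comp: "algebra_hom g \<Longrightarrow> algebra_hom h \<Longrightarrow> algebra_hom (\<lambda>p. g (h p))"
  by (simp add: algebra_hom_def klinear_comp)

lemma algebra_hom_id: "algebra_hom (\<lambda>p. p)"
  by (simp add: algebra_hom_def klinear_id)

lemma algebra_hom_eq_on:
  assumes "algebra_hom g" "algebra_hom h" "\<And>v. v \<in> V \<Longrightarrow> g (variable v) = h (variable v)" "p \<in> polys V"
  shows "g p = h p"
proof (rule klinear_eq_on[OF assms(1)[THEN algebra_homD(1)] assms(2)[THEN algebra_homD(1)] _ assms(4)])
  fix t :: "'a \<Rightarrow>\<^sub>0 nat"
  show "keys t \<subseteq> V \<Longrightarrow> g (monomial t) = h (monomial t)"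
  proof (induction t rule: monomial_induct)
    case zero
    then show ?case using assms by (simp add: algebra_homD)
  next
    case (add v t)
    have "monomial (single v 1 + t) = variable v * (monomial t :: ('a, 'b) mpoly)"
      by (simp add: variable_def mult_single)
    moreover have "v \<in> V" "keys t \<subseteq> V" using add.prems by (auto simp: keys_add_nat)
    ultimately show ?case
      using add.IH assms(3) by (simp only: algebra_homD(3)[OF assms(1)] algebra_homD(3)[OF assms(2)])
  qed
qed

definition subst :: "('v \<Rightarrow> ('v, 'k::field) mpoly) \<Rightarrow> ('v, 'k) mpoly \<Rightarrow> ('v, 'k) mpoly" where
  "subst \<eta> = lext (\<lambda>t. \<Prod>v\<in>keys t. \<eta> v ^ lookup t v)"

lemma subst_klinear [simp]: "klinear (subst \<eta>)"
  by (simp add: subst_def)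

lemma subst_variable [simp]: "subst \<eta> (variable v) = \<eta> v"
  by (simp add: subst_def variable_def)

lemma subst_algebra_hom [simp]: "algebra_hom (subst \<eta>)"
proof -
  let ?m = "\<lambda>t. \<Prod>v\<in>keys t. \<eta> v ^ lookup t v"
  have m: "?m t = (\<Prod>v\<in>A. \<eta> v ^ lookup t v)" if "finite A" "keys t \<subseteq> A" for t A
    by (rule prod.mono_neutral_left) (use that in \<open>auto simp: in_keys_iff\<close>)
  have mult: "?m (s + t) = ?m s * ?m t" for s t
    using m[of "keys s \<union> keys t" s] m[of "keys s \<union> keys t" t]
    by (simp add: keys_add_nat lookup_add power_add prod.distrib)
  have s: "subst \<eta> (monomial s * monomial t) = subst \<eta> (monomial s) * subst \<eta> (monomial t)" for s t
    by (simp add: mono_mult subst_def mult)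
  have e: "(\<lambda>q. subst \<eta> (monomial s * q)) = (\<lambda>q. subst \<eta> (monomial s) * subst \<eta> q)" for s
    by (rule klinear_eqI) (auto intro!: klinear_rmult klinear_lmult simp: s)
  have s': "subst \<eta> (q * monomial s) = subst \<eta> q * subst \<eta> (monomial s)" for s q
    using fun_cong[OF e, of s q] by (simp only: mult.commute[of q] mult.commute[of "subst \<eta> q"])
  have e': "(\<lambda>q. subst \<eta> (p * q)) = (\<lambda>q. subst \<eta> p * subst \<eta> q)" for p
    by (rule klinear_eqI) (auto intro!: klinear_rmult klinear_lmult simp: s')
  have "subst \<eta> (p * q) = subst \<eta> p * subst \<eta> q" for p q
    using fun_cong[OF e'] .
  moreover have "subst \<eta> 1 = 1" by (simp add: subst_def lext_def)
  ultimately show ?thesis by (simp add: algebra_hom_def)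
qed

lemma subst_polys:
  assumes "p \<in> polys V" "\<And>v. v \<in> V \<Longrightarrow> \<eta> v \<in> polys W"
  shows "subst \<eta> p \<in> polys W"
  unfolding subst_def
  by (intro lext_polys polys_prod polys_power assms(2)) (use assms(1) in \<open>auto simp: polys_iff\<close>)

definition hproj :: "('v \<Rightarrow> nat) \<Rightarrow> nat \<Rightarrow> ('v, 'k::field) mpoly \<Rightarrow> ('v, 'k) mpoly" where
  "hproj w d = lext (\<lambda>t. if wdeg w t = d then monomial t else 0)"

lemma hproj_klinear [simp]: "klinear (hproj w d)"
  by (simp add: hproj_def)

lemma hproj_single: "hproj w d (single t c) = (if wdeg w t = d then single t c else 0)"
  by (simp add: hproj_def mult_single)

lemma hproj_polys: "p \<in> polys V \<Longrightarrow> hproj w d p \<in> polys V"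
  unfolding hproj_def by (rule lext_polys) (auto simp: polys_iff)

lemma hproj_mono_mult:
  "hproj w d (monomial s * p) = (if wdeg w s \<le> d then monomial s * hproj w (d - wdeg w s) p else 0)"
proof -
  have "(\<lambda>p. hproj w d (monomial s * p)) = (\<lambda>p. if wdeg w s \<le> d then monomial s * hproj w (d - wdeg w s) p else 0)"
  proof (rule klinear_eqI)
    show "klinear (\<lambda>p. if wdeg w s \<le> d then monomial s * hproj w (d - wdeg w s) p else 0)"
      by (cases "wdeg w s \<le> d") (simp_all add: klinear_lmult klinear_0)
  qed (auto intro!: klinear_rmult simp: mono_mult hproj_single)
  then show ?thesis by (rule fun_cong)
qed

lemma hproj_mult: "hproj w d (p * q) = (\<Sum>i\<le>d. hproj w i p * hproj w (d - i) q)"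
proof (induction p rule: poly_induct)
  case (single t c)
  have "hproj w d (single t c * q) = const c * hproj w d (monomial t * q)"
    using klinear_scale[OF hproj_klinear, of w d c "monomial t * q"] by (simp add: mult_single flip: mult.assoc)
  also have "hproj w d (monomial t * q) = (\<Sum>i\<le>d. if i = wdeg w t then monomial t * hproj w (d - i) q else 0)"
    by (simp add: hproj_mono_mult)
  also have "const c * \<dots> = (\<Sum>i\<le>d. hproj w i (single t c) * hproj w (d - i) q)"
    unfolding sum_distrib_left
    by (rule sum.cong) (auto simp: hproj_single mult_single simp flip: mult.assoc)
  finally show ?case .
qed (simp_all add: klinear_zero klinear_add algebra_simps sum.distrib)

lemma hproj_sum: "\<exists>d. \<forall>e\<ge>d. p = (\<Sum>i<e. hproj w i p)"
proof (induction p rule: poly_induct)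
  case (single t c)
  have "single t c = (\<Sum>i<e. hproj w i (single t c))" if "e \<ge> Suc (wdeg w t)" for e
  proof -
    have "(\<Sum>i<e. hproj w i (single t c)) = (\<Sum>i<e. if i = wdeg w t then single t c else 0)"
      by (rule sum.cong) (auto simp: hproj_single mult_single)
    also have "\<dots> = single t c" using that by simp
    finally show ?thesis by simp
  qed
  then show ?case by blast
next
  case (add p q)
  then obtain d d' where "\<forall>e\<ge>d. p = (\<Sum>i<e. hproj w i p)" "\<forall>e\<ge>d'. q = (\<Sum>i<e. hproj w i q)"
    by blast
  then have "p + q = (\<Sum>i<e. hproj w i (p + q))" if "e \<ge> max d d'" for e
    using that by (simp add: klinear_add sum.distrib)
  then show ?case by blast
qed (simp add: klinear_zero)

section \<open>Linear maps of polynomial rings and commutators\<close>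

text \<open>Linear maps from \<open>polys V\<close> to \<open>polys W\<close> as total functions.
  Factoring through \<open>res V\<close> fixes the values outside \<open>polys V\<close>, so
  equality of functions is equality of maps (\<open>homs_eqI\<close>).\<close>

definition homs :: "'v set \<Rightarrow> 'v set \<Rightarrow> (('v, 'k::field) mpoly \<Rightarrow> ('v, 'k) mpoly) set" where
  "homs V W = {F. klinear F \<and> (\<forall>p. F p \<in> polys W) \<and> (\<forall>p. F (res V p) = F p)}"

definition poly_ideal :: "'v set \<Rightarrow> ('v, 'k::field) mpoly set \<Rightarrow> bool" where
  "poly_ideal V I \<longleftrightarrow> I \<subseteq> polys V \<and> 0 \<in> I \<and> (\<forall>p\<in>I. \<forall>q\<in>I. p + q \<in> I) \<and> (\<forall>a\<in>polys V. \<forall>p\<in>I. a * p \<in> I)"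

text \<open>General enough for the powers of an ideal, their images under substitutions, the zero
  sequence, which yields all of \<open>homs\<close>, and constant weight ideals.\<close>

definition filtration :: "'v set \<Rightarrow> (nat \<Rightarrow> ('v, 'k::field) mpoly set) \<Rightarrow> bool" where
  "filtration V I \<longleftrightarrow> (\<forall>t. poly_ideal V (I t)) \<and> (\<forall>s t. s \<le> t \<longrightarrow> I t \<subseteq> I s)"

text \<open>Continuous maps for the topology on \<open>polys V\<close> with neighbourhood basis \<open>I\<close>.\<close>

definition cont ::
  "'v set \<Rightarrow> 'v set \<Rightarrow> (nat \<Rightarrow> ('v, 'k::field) mpoly set) \<Rightarrow> (('v, 'k) mpoly \<Rightarrow> ('v, 'k) mpoly) set"
where
  "cont V W I = {F \<in> homs V W. \<exists>t. \<forall>p\<in>I t. F p = 0}"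

text \<open>The commutator with a variable when source and target are different rings:
  \<open>a\<close> acts on values and \<open>x\<close> on arguments. In mixed complexes
  \<open>a\<close> is the image of \<open>x\<close> under a specialization.\<close>

definition ad :: "'r::comm_ring \<Rightarrow> 'r \<Rightarrow> ('r \<Rightarrow> 'r) \<Rightarrow> 'r \<Rightarrow> 'r" where
  "ad a x F = (\<lambda>p. a * F p - F (x * p))"

lemma poly_idealD:
  assumes "poly_ideal V I"
  shows "p \<in> I \<Longrightarrow> p \<in> polys V" "0 \<in> I" "p \<in> I \<Longrightarrow> q \<in> I \<Longrightarrow> p + q \<in> I"
    "a \<in> polys V \<Longrightarrow> p \<in> I \<Longrightarrow> a * p \<in> I" "p \<in> I \<Longrightarrow> - p \<in> I" "p \<in> I \<Longrightarrow> q \<in> I \<Longrightarrow> p - q \<in> I"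
proof -
  show *: "p \<in> I \<Longrightarrow> p \<in> polys V" "0 \<in> I" "p \<in> I \<Longrightarrow> q \<in> I \<Longrightarrow> p + q \<in> I"
    "a \<in> polys V \<Longrightarrow> p \<in> I \<Longrightarrow> a * p \<in> I" for a p q
    using assms unfolding poly_ideal_def by auto
  show neg: "p \<in> I \<Longrightarrow> - p \<in> I" for p
    using *(4)[of "- 1" p] polys_uminus[OF polys_1, of V] by simp
  show "p \<in> I \<Longrightarrow> q \<in> I \<Longrightarrow> p - q \<in> I"
    using *(3)[of p "- q"] neg[of q] by simp
qed

lemma poly_ideal_sum: "poly_ideal V I \<Longrightarrow> (\<And>i. i \<in> A \<Longrightarrow> f i \<in> I) \<Longrightarrow> sum f A \<in> I"
  by (induction A rule: infinite_finite_induct) (auto intro: poly_idealD)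

lemma filtrationD:
  assumes "filtration V I"
  shows "poly_ideal V (I t)" "s \<le> t \<Longrightarrow> p \<in> I t \<Longrightarrow> p \<in> I s"
  using assms unfolding filtration_def by auto

lemma zero_filtration: "filtration V (\<lambda>t. {0})"
  by (simp add: filtration_def poly_ideal_def)

lemma homsD:
  assumes "F \<in> homs V W"
  shows "klinear F" "F p \<in> polys W" "F (res V p) = F p"
  using assms by (auto simp: homs_def)

lemma homs_outside: "F \<in> homs V W \<Longrightarrow> \<not> keys t \<subseteq> V \<Longrightarrow> F (monomial t) = 0"
  using homsD(3)[of F V W "monomial t"] by (simp add: res_single klinear_zero homsD(1))

lemma cont_zero_filtration: "cont V W (\<lambda>t. {0}) = homs V W"
  by (auto simp: cont_def klinear_zero homsD(1))

lemma homs_0: "(\<lambda>p. 0) \<in> homs V W"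
  by (simp add: homs_def klinear_0)

lemma homs_diff: "F \<in> homs V W \<Longrightarrow> G \<in> homs V W \<Longrightarrow> (\<lambda>p. F p - G p) \<in> homs V W"
  by (simp add: homs_def klinear_minus)

lemma homs_lmult: "F \<in> homs V W \<Longrightarrow> a \<in> polys W \<Longrightarrow> (\<lambda>p. a * F p) \<in> homs V W"
  by (simp add: homs_def klinear_lmult)

lemma homs_rmult: "F \<in> homs V W \<Longrightarrow> a \<in> polys V \<Longrightarrow> (\<lambda>p. F (a * p)) \<in> homs V W"
  by (simp add: homs_def klinear_rmult) (metis res_mult)

lemma ad_homs: "F \<in> homs V W \<Longrightarrow> a \<in> polys W \<Longrightarrow> x \<in> polys V \<Longrightarrow> ad a x F \<in> homs V W"
  unfolding ad_def by (intro homs_diff homs_lmult homs_rmult)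

lemma homs_eqI:
  assumes "F \<in> homs V W" "G \<in> homs V W" "\<And>t. keys t \<subseteq> V \<Longrightarrow> F (monomial t) = G (monomial t)"
  shows "F = G"
proof (rule klinear_eqI)
  show "F (monomial t) = G (monomial t)" for t
    using assms homs_outside[OF assms(1), of t] homs_outside[OF assms(2), of t] by metis
qed (use assms homsD(1) in auto)

lemma homs_lext:
  assumes "\<And>t. keys t \<subseteq> V \<Longrightarrow> f t \<in> polys W" "\<And>t. \<not> keys t \<subseteq> V \<Longrightarrow> f t = 0"
  shows "lext f \<in> homs V W"
proof -
  have "lext f p \<in> polys W" for p
    by (rule lext_polys) (metis assms polys_0)
  moreover have "(\<lambda>p. lext f (res V p)) = lext f"
    by (rule klinear_eqI[OF klinear_comp[OF lext_klinear res_klinear] lext_klinear])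
      (simp add: res_single assms(2) klinear_zero)
  ultimately show ?thesis by (simp add: homs_def fun_eq_iff)
qed

lemma cont_operators:
  assumes I: "filtration V I" and ax: "\<And>u. u \<in> U \<Longrightarrow> a u \<in> polys W" "\<And>u. u \<in> U \<Longrightarrow> x u \<in> polys V"
  shows "commuting_operators (cont V W I) (\<lambda>u. ad (a u) (x u)) U"
proof
  show "0 \<in> cont V W I" by (auto simp: cont_def zero_fun_def homs_0)
next
  fix F G assume F: "F \<in> cont V W I" and G: "G \<in> cont V W I"
  obtain s where s: "\<forall>p\<in>I s. F p = 0" using F by (auto simp: cont_def)
  obtain t where t: "\<forall>p\<in>I t. G p = 0" using G by (auto simp: cont_def)
  have "\<forall>p\<in>I (max s t). F p = 0 \<and> G p = 0"
    using s t filtrationD(2)[OF I] by (meson max.cobounded1 max.cobounded2)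
  moreover have "F - G \<in> homs V W"
    using homs_diff[of F V W G] F G by (simp add: cont_def fun_diff_def)
  ultimately show "F - G \<in> cont V W I" by (auto simp: cont_def intro!: exI[of _ "max s t"])
  show "ad (a u) (x u) (F - G) = ad (a u) (x u) F - ad (a u) (x u) G" if "u \<in> U" for u
    by (simp add: ad_def fun_eq_iff algebra_simps)
next
  fix u F assume u: "u \<in> U" and F: "F \<in> cont V W I"
  obtain s where "\<forall>p\<in>I s. F p = 0" using F by (auto simp: cont_def)
  then have "\<forall>p\<in>I s. ad (a u) (x u) F p = 0"
    using poly_idealD(4)[OF filtrationD(1)[OF I]] ax u by (simp add: ad_def)
  then show "ad (a u) (x u) F \<in> cont V W I"
    using F ad_homs[of F V W] ax u by (auto simp: cont_def)
next
  fix u v F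
  show "ad (a u) (x u) (ad (a v) (x v) F) = ad (a v) (x v) (ad (a u) (x u) F)"
    by (simp add: ad_def fun_eq_iff algebra_simps)
qed

abbreviation ad_var :: "'v \<Rightarrow> (('v, 'k::field) mpoly \<Rightarrow> ('v, 'k) mpoly) \<Rightarrow> ('v, 'k) mpoly \<Rightarrow> ('v, 'k) mpoly" where
  "ad_var v \<equiv> ad (variable v) (variable v)"

lemma cont_ad_var: "filtration V I \<Longrightarrow> commuting_operators (cont V V I) ad_var V"
  by (rule cont_operators) auto

text \<open>A right inverse of \<open>ad_var v\<close> that commutes with the other \<open>ad_var u\<close>, as a recursion on the exponent of \<open>v\<close>.\<close>

primrec ad_inverse ::
  "'v \<Rightarrow> (('v, 'k::field) mpoly \<Rightarrow> ('v, 'k) mpoly) \<Rightarrow> nat \<Rightarrow> ('v \<Rightarrow>\<^sub>0 nat) \<Rightarrow> ('v, 'k) mpoly"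
where
  "ad_inverse v G 0 s = 0"
| "ad_inverse v G (Suc k) s = variable v * ad_inverse v G k s - G (monomial (single v k + s))"

lemma variable_mult_monomial: "variable v * monomial t = monomial (single v 1 + t)"
  by (simp add: variable_def mult_single)

text \<open>The equation \<open>ad_var v Y = G\<close> determines \<open>Y\<close> at x_v times t
  from \<open>Y\<close> at t, so the values on monomials free of x_v can be prescribed. The value 0
  there preserves commutation with the other variables.\<close>

lemma ad_var_surj:
  assumes v: "v \<in> V" and G: "G \<in> homs V V"
  shows "\<exists>Y\<in>homs V V. ad_var v Y = G \<and> (\<forall>u\<in>V. u \<noteq> v \<longrightarrow> ad_var u G = 0 \<longrightarrow> ad_var u Y = 0)"
proof -
  define rest where "rest t = t - single v (lookup t v)" for t :: "'a \<Rightarrow>\<^sub>0 nat"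
  define y where "y t = (if keys t \<subseteq> V then ad_inverse v G (lookup t v) (rest t) else 0)" for t
  have rest: "t = single v (lookup t v) + rest t" for t
    by (rule poly_mapping_eqI) (simp add: rest_def lookup_add lookup_minus lookup_single when_def)
  have y_polys: "ad_inverse v G k s \<in> polys V" for k s
    using v homsD(2)[OF G] by (induction k) auto
  have Y: "lext y \<in> homs V V"
    by (rule homs_lext) (simp_all add: y_def y_polys)
  have "ad_var v (lext y) = G"
  proof (rule homs_eqI[of _ V V])
    fix t :: "'a \<Rightarrow>\<^sub>0 nat" assume t: "keys t \<subseteq> V"
    have k: "lookup (single v 1 + t) v = Suc (lookup t v)"
      by (simp add: lookup_add)
    have r: "rest (single v 1 + t) = rest t"
      by (rule poly_mapping_eqI) (auto simp: rest_def lookup_add lookup_minus lookup_single when_def)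
    have "keys (single v 1 + t) \<subseteq> V" using v t by (simp add: keys_add_nat)
    then have "y (single v 1 + t) = variable v * y t - G (monomial t)"
      using t by (simp add: y_def k[simplified] r[simplified] flip: rest)
    then show "ad_var v (lext y) (monomial t) = G (monomial t)"
      by (simp add: ad_def variable_mult_monomial)
  qed (use ad_homs[OF Y] v G in auto)
  moreover have "ad_var u (lext y) = 0" if u: "u \<in> V" "u \<noteq> v" and 0: "ad_var u G = 0" for u
  proof (rule homs_eqI[of _ V V])
    fix t :: "'a \<Rightarrow>\<^sub>0 nat" assume t: "keys t \<subseteq> V"
    have G_comm: "G (variable u * p) = variable u * G p" for p
      using fun_cong[OF 0, of p] by (simp add: ad_def)
    have inv: "ad_inverse v G k (single u 1 + s) = variable u * ad_inverse v G k s" for k s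
    proof (induction k)
      case (Suc k)
      have "monomial (single v k + (single u 1 + s)) = variable u * (monomial (single v k + s) :: ('a, 'b) mpoly)"
        by (simp add: variable_mult_monomial add_ac)
      then show ?case unfolding ad_inverse.simps Suc by (simp only: G_comm) (simp add: algebra_simps)
    qed simp
    have k: "lookup (single u 1 + t) v = lookup t v"
      using u by (simp add: lookup_add lookup_single)
    have r: "rest (single u 1 + t) = single u 1 + rest t"
      by (rule poly_mapping_eqI) (use u in \<open>auto simp: rest_def lookup_add lookup_minus lookup_single when_def\<close>)
    have "keys (single u 1 + t) \<subseteq> V" using u t by (simp add: keys_add_nat)
    then have "y (single u 1 + t) = variable u * y t"
      using t unfolding y_def k r inv by simp
    then show "ad_var u (lext y) (monomial t) = 0 (monomial t)"
      by (simp add: ad_def variable_mult_monomial)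
  qed (use ad_homs[OF Y] u homs_0 in \<open>auto simp: zero_fun_def\<close>)
  ultimately show ?thesis using Y by blast
qed

lemma regular_ad_var: "distinct vs \<Longrightarrow> set vs \<subseteq> V \<Longrightarrow> regular_operators (homs V V) ad_var vs"
proof (induction vs)
  case (Cons v vs)
  have "\<exists>y\<in>homs V V. ad_var v y = x \<and> (\<forall>u\<in>set vs. ad_var u y = 0)"
    if "x \<in> homs V V" "\<forall>u\<in>set vs. ad_var u x = 0" for x
    using ad_var_surj[of v V x] that Cons.prems by (metis distinct.simps(2) insert_subset list.simps(15) subsetD)
  then show ?case using Cons by auto
qed simp

text \<open>\<open>polynomial_ring {}\<close> is the field of constants, so extension of linear maps is an instance of Baer's criterion.\<close>

lemma constant_poly: "p \<in> polys {} \<Longrightarrow> p = const (lookup p 0)"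
proof -
  assume p: "p \<in> polys {}"
  have "lookup p t = 0" if "t \<noteq> 0" for t
  proof (rule ccontr)
    assume "lookup p t \<noteq> 0"
    then have "keys t = {}" using p by (auto simp: polys_iff in_keys_iff)
    with that show False by simp
  qed
  then show ?thesis by (intro poly_mapping_eqI) (auto simp: lookup_single when_def)
qed

lemma restrict_scalars:
  assumes "Module.module (polynomial_ring V) M"
  shows "Module.module (polynomial_ring {}) M"
proof -
  interpret M: Module.module "polynomial_ring V" M by fact
  have sub: "p \<in> polys {} \<Longrightarrow> p \<in> polys V" for p :: "('a, 'b) mpoly"
    by (rule polys_mono[of "{}"]) auto
  show ?thesis
    using M.smult_closed M.smult_l_distr M.smult_r_distr M.smult_assoc1 M.smult_one
    by (intro moduleI cring_polynomial_ring M.abelian_group_axioms) (auto simp: sub)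
qed

text \<open>A nonzero ideal of a field contains an invertible \<open>a\<close>, and the extension
  must send 1 to \<open>f a\<close> divided by \<open>a\<close>.\<close>

lemma ideal_extension_constants:
  assumes N: "Module.module (polynomial_ring {} :: ('v, 'k::field) mpoly ring) N"
  shows "ideal_extension (polynomial_ring {}) N"
  unfolding ideal_extension_def
proof (intro allI impI)
  fix I f
  let ?K = "polynomial_ring {} :: ('v, 'k) mpoly ring"
  assume I: "ideal I ?K" and f: "f \<in> module_homs ?K (regular_module ?K\<lparr>carrier := I\<rparr>) N"
  interpret N: Module.module ?K N by (rule N)
  interpret I: ideal I ?K by (rule I)
  have f_smult: "f (b * a) = b \<odot>\<^bsub>N\<^esub> f a" if "b \<in> polys {}" "a \<in> I" for a b
    using module_homs_smult[OF f, of b a] that by (simp add: regular_module_def)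
  have f_closed: "f a \<in> carrier N" if "a \<in> I" for a
    using module_homs_closed[OF f, of a] that by simp
  have I_sub: "a \<in> polys {}" if "a \<in> I" for a using I.Icarr that by simp
  show "\<exists>e\<in>carrier N. \<forall>a\<in>I. f a = a \<odot>\<^bsub>N\<^esub> e"
  proof (cases "\<exists>a\<in>I. a \<noteq> 0")
    case True
    then obtain a where a: "a \<in> I" "a \<noteq> 0" by blast
    define c where "c = lookup a 0"
    have ac: "a = const c" using constant_poly I_sub a unfolding c_def by blast
    with a have c: "c \<noteq> 0" by auto
    have "f b = b \<odot>\<^bsub>N\<^esub> (const (1 / c) \<odot>\<^bsub>N\<^esub> f a)" if b: "b \<in> I" for b
    proof -
      have "const (1 / c) * a = 1" using c by (simp add: ac mult_single)
      then have "f b = f ((b * const (1 / c)) * a)" by (simp add: mult.assoc)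
      also have "\<dots> = (b * const (1 / c)) \<odot>\<^bsub>N\<^esub> f a" by (rule f_smult) (use I_sub b a in auto)
      also have "\<dots> = b \<odot>\<^bsub>N\<^esub> (const (1 / c) \<odot>\<^bsub>N\<^esub> f a)"
        using N.smult_assoc1[of b "const (1 / c)" "f a"] I_sub[OF b] f_closed[OF a(1)] by simp
      finally show ?thesis .
    qed
    then show ?thesis using f_closed[OF a(1)] N.smult_closed[of "const (1 / c)" "f a"] by auto
  next
    case False
    have "f 0 = \<zero>\<^bsub>N\<^esub>"
      using f_smult[of 0 0] f_closed[of 0] N.smult_l_null[of "f 0"] I.zero_closed by simp
    then have "\<forall>a\<in>I. f a = a \<odot>\<^bsub>N\<^esub> \<zero>\<^bsub>N\<^esub>" using False N.smult_l_null[of "\<zero>\<^bsub>N\<^esub>"] by auto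
    then show ?thesis by blast
  qed
qed

lemma regular_module_polys:
  "Module.module (polynomial_ring {}) (regular_module (polynomial_ring W))"
  by (rule restrict_scalars[OF module_regular_module[OF cring_polynomial_ring]])

lemma linear_extension:
  fixes M :: "(('v, 'k::field) mpoly, 'm, 'b) module_scheme"
  assumes "Module.module (polynomial_ring V) M"
    and "partial_hom (polynomial_ring {}) M (regular_module (polynomial_ring W)) \<Gamma>"
  shows "\<exists>g. (\<forall>x\<in>carrier M. g x \<in> polys W) \<and>
    (\<forall>x\<in>carrier M. \<forall>y\<in>carrier M. g (x \<oplus>\<^bsub>M\<^esub> y) = g x + g y) \<and>
    (\<forall>c. \<forall>x\<in>carrier M. g (const c \<odot>\<^bsub>M\<^esub> x) = const c * g x) \<and> (\<forall>x y. (x, y) \<in> \<Gamma> \<longrightarrow> g x = y)"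
proof -
  obtain g where g: "g \<in> module_homs (polynomial_ring {}) M (regular_module (polynomial_ring W))"
    "\<forall>x y. (x, y) \<in> \<Gamma> \<longrightarrow> g x = y"
    using baer_extension[OF restrict_scalars[OF assms(1)] regular_module_polys
        ideal_extension_constants[OF regular_module_polys] assms(2)] by blast
  then show ?thesis
    by (intro exI[of _ g]) (auto simp: module_homs_def regular_module_def)
qed

text \<open>Since \<open>ad 1 x Y\<close> is \<open>\<lambda>p. Y ((1 - x) * p)\<close>, the map
  \<open>Y\<close> is prescribed on multiples of 1 - x and has to vanish on \<open>I t\<close>. The
  colon hypothesis makes the two prescriptions agree, and over a field the resulting partial map
  extends.\<close>

lemma ad_one_surj:
  assumes I: "filtration V I" and x: "x \<in> polys V"
    and colon: "\<And>t p. p \<in> polys V \<Longrightarrow> (x - 1) * p \<in> I t \<Longrightarrow> p \<in> I t"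
    and G: "G \<in> cont V W I"
  shows "\<exists>Y\<in>cont V W I. ad 1 x Y = G"
proof -
  obtain t where t: "\<forall>p\<in>I t. G p = 0" using G by (auto simp: cont_def)
  have G': "G \<in> homs V W" using G by (simp add: cont_def)
  have It: "poly_ideal V (I t)" by (rule filtrationD(1)[OF I])
  define \<Gamma> where "\<Gamma> = {((1 - x) * p + r, G p) | p r. p \<in> polys V \<and> r \<in> I t}"
  have mem: "((1 - x) * p + r, G p) \<in> \<Gamma>" if "p \<in> polys V" "r \<in> I t" for p r
    using that unfolding \<Gamma>_def by blast
  let ?M = "regular_module (polynomial_ring V) :: (('a, 'b) mpoly, ('a, 'b) mpoly) module"
  let ?N = "regular_module (polynomial_ring W) :: (('a, 'b) mpoly, ('a, 'b) mpoly) module"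
  have "partial_hom (polynomial_ring {}) ?M ?N \<Gamma>"
    unfolding partial_hom_def
  proof (intro conjI allI ballI impI)
    show "\<Gamma> \<subseteq> carrier ?M \<times> carrier ?N"
      using x homsD(2)[OF G'] poly_idealD(1)[OF It] by (auto simp: \<Gamma>_def regular_module_def)
    have "((1 - x) * 0 + 0, G 0) \<in> \<Gamma>" by (rule mem[OF polys_0 poly_idealD(2)[OF It]])
    then show "(\<zero>\<^bsub>?M\<^esub>, \<zero>\<^bsub>?N\<^esub>) \<in> \<Gamma>" using klinear_zero[OF homsD(1)[OF G']] by (simp add: regular_module_def)
  next
    fix a b a' b' assume "(a, b) \<in> \<Gamma>" "(a', b') \<in> \<Gamma>"
    then obtain p r p' r' where *: "p \<in> polys V" "r \<in> I t" "p' \<in> polys V" "r' \<in> I t"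
      "a = (1 - x) * p + r" "b = G p" "a' = (1 - x) * p' + r'" "b' = G p'" unfolding \<Gamma>_def by blast
    have "((1 - x) * (p + p') + (r + r'), G (p + p')) \<in> \<Gamma>"
      by (intro mem poly_idealD(3)[OF It] polys_add *)
    moreover have "(1 - x) * (p + p') + (r + r') = a + a'" "G (p + p') = b + b'"
      unfolding *(5-8) by (simp_all add: klinear_add[OF homsD(1)[OF G']] algebra_simps)
    ultimately show "(a \<oplus>\<^bsub>?M\<^esub> a', b \<oplus>\<^bsub>?N\<^esub> b') \<in> \<Gamma>" by (simp add: regular_module_def)
  next
    fix s a b :: "('a, 'b) mpoly" assume s: "s \<in> carrier (polynomial_ring {})" and "(a, b) \<in> \<Gamma>"
    then obtain p r where *: "p \<in> polys V" "r \<in> I t" "a = (1 - x) * p + r" "b = G p"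
      unfolding \<Gamma>_def by blast
    obtain c where c: "s = const c" using constant_poly[OF s] by blast
    have "((1 - x) * (s * p) + s * r, G (s * p)) \<in> \<Gamma>"
      unfolding c by (intro mem poly_idealD(4)[OF It] polys_mult polys_const *)
    moreover have "(1 - x) * (s * p) + s * r = s * a" "G (s * p) = s * b"
      unfolding *(3,4) by (simp add: algebra_simps) (simp add: c klinear_scale[OF homsD(1)[OF G']])
    ultimately show "(s \<odot>\<^bsub>?M\<^esub> a, s \<odot>\<^bsub>?N\<^esub> b) \<in> \<Gamma>" by (simp add: regular_module_def)
  next
    fix b assume "(\<zero>\<^bsub>?M\<^esub>, b) \<in> \<Gamma>"
    then obtain p r where *: "p \<in> polys V" "r \<in> I t" "0 = (1 - x) * p + r" "b = G p"
      unfolding \<Gamma>_def by (auto simp: regular_module_def)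
    then have "(x - 1) * p = r" by (simp add: algebra_simps)
    then have "p \<in> I t" using colon * by blast
    then show "b = \<zero>\<^bsub>?N\<^esub>" using t * by (simp add: regular_module_def)
  qed
  from linear_extension[OF module_regular_module[OF cring_polynomial_ring] this]
  obtain g where g: "\<forall>p\<in>polys V. g p \<in> polys W" "\<forall>p\<in>polys V. \<forall>q\<in>polys V. g (p + q) = g p + g q"
    "\<forall>c. \<forall>p\<in>polys V. g (const c * p) = const c * g p" and g_ext: "\<forall>p y. (p, y) \<in> \<Gamma> \<longrightarrow> g p = y"
    by (auto simp: regular_module_def)
  let ?Y = "\<lambda>p. g (res V p)"
  have "klinear ?Y"
    using g by (simp add: klinear_def klinear_add[OF res_klinear] klinear_scale[OF res_klinear])
  then have Y: "?Y \<in> homs V W" using g by (simp add: homs_def res_id)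
  have "?Y p = 0" if "p \<in> I t" for p
  proof -
    have "((1 - x) * 0 + p, G 0) \<in> \<Gamma>" by (rule mem[OF polys_0 that])
    then show ?thesis
      using g_ext klinear_zero[OF homsD(1)[OF G']] poly_idealD(1)[OF It that] by (simp add: res_id)
  qed
  then have "?Y \<in> cont V W I" using Y by (auto simp: cont_def)
  moreover have "ad 1 x ?Y = G"
  proof (rule homs_eqI[of _ V W])
    fix s :: "'a \<Rightarrow>\<^sub>0 nat" assume "keys s \<subseteq> V"
    then have p: "monomial s \<in> polys V" by (simp add: polys_single)
    have "((1 - x) * monomial s + 0, G (monomial s)) \<in> \<Gamma>"
      by (rule mem[OF p poly_idealD(2)[OF It]])
    then have "g ((1 - x) * monomial s) = G (monomial s)" using g_ext by simp
    moreover have "(1 - x) * monomial s = res V (monomial s - x * monomial s)"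
      using res_id[OF polys_diff[OF p polys_mult[OF x p]]] by (simp add: left_diff_distrib)
    ultimately show "ad 1 x ?Y (monomial s) = G (monomial s)"
      using klinear_diff[OF \<open>klinear ?Y\<close>, of "monomial s" "x * monomial s"] by (simp add: ad_def)
  qed (use ad_homs[OF Y, of 1 x] x G' in auto)
  ultimately show ?thesis by blast
qed

section \<open>Specializing a variable\<close>

text \<open>All degrees from \<open>N\<close> on are taken together, because cutting by an equation
  uses vanishing in two consecutive degrees and a single degree would not propagate.\<close>

definition koszul_vanishing ::
  "'v set \<Rightarrow> (nat \<Rightarrow> ('v, 'k::field) mpoly set) \<Rightarrow> 'v list \<Rightarrow> nat \<Rightarrow> bool"
where
  "koszul_vanishing V I vs N \<longleftrightarrow>
     (\<forall>i. N \<le> Suc i \<longrightarrow> (\<forall>F\<in>koszul_cochains (cont V V I) vs (Suc i).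
        koszul_diff ad_var vs F = (\<lambda>w. 0) \<longrightarrow>
        (\<exists>G\<in>koszul_cochains (cont V V I) vs i. koszul_diff ad_var vs G = F)))"

definition specialize :: "'v set \<Rightarrow> ('v, 'k::field) mpoly \<Rightarrow> ('v, 'k) mpoly" where
  "specialize A = subst (\<lambda>v. if v \<in> A then 1 else variable v)"

lemma specialize_algebra_hom: "algebra_hom (specialize A)"
  by (simp add: specialize_def)

lemma specialize_polys: "p \<in> polys (A \<union> W) \<Longrightarrow> specialize A p \<in> polys W"
  unfolding specialize_def by (rule subst_polys) auto

lemma specialize_id: "A \<inter> W = {} \<Longrightarrow> p \<in> polys W \<Longrightarrow> specialize A p = p"
  by (rule algebra_hom_eq_on[OF specialize_algebra_hom algebra_hom_id]) (auto simp: specialize_def)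

lemma filtration_image:
  fixes I :: "nat \<Rightarrow> ('v, 'k::field) mpoly set"
  assumes I: "filtration V I" and h: "algebra_hom h" "\<And>p. p \<in> polys V \<Longrightarrow> h p \<in> polys W"
    and surj: "\<And>q. q \<in> polys W \<Longrightarrow> \<exists>p\<in>polys V. h p = q"
  shows "filtration W (\<lambda>t. h ` I t)"
  unfolding filtration_def
proof (intro conjI allI impI)
  fix t
  have It: "poly_ideal V (I t)" by (rule filtrationD(1)[OF I])
  show "poly_ideal W (h ` I t)"
    unfolding poly_ideal_def
  proof (intro conjI ballI)
    show "h ` I t \<subseteq> polys W" using h(2) poly_idealD(1)[OF It] by blast
    show "0 \<in> h ` I t"
      using poly_idealD(2)[OF It] klinear_zero[OF algebra_homD(1)[OF h(1)]] by (metis image_eqI)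
  next
    fix p q assume "p \<in> h ` I t" "q \<in> h ` I t"
    then obtain a b where "a \<in> I t" "b \<in> I t" "p = h a" "q = h b" by blast
    then show "p + q \<in> h ` I t"
      using poly_idealD(3)[OF It, of a b] klinear_add[OF algebra_homD(1)[OF h(1)], of a b]
      by (intro image_eqI[of _ _ "a + b"]) auto
  next
    fix a p :: "('v, 'k) mpoly" assume "a \<in> polys W" "p \<in> h ` I t"
    then obtain b q where "b \<in> polys V" "h b = a" "q \<in> I t" "p = h q" using surj by blast
    then show "a * p \<in> h ` I t"
      using poly_idealD(4)[OF It, of b q] algebra_homD(3)[OF h(1), of b q]
      by (intro image_eqI[of _ _ "b * q"]) auto
  qed
next
  fix s t :: nat assume "s \<le> t"
  then show "h ` I t \<subseteq> h ` I s" using filtrationD(2)[OF I] by blast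
qed

lemma specialize_surj: "A \<inter> W = {} \<Longrightarrow> q \<in> polys W \<Longrightarrow> \<exists>p\<in>polys (A \<union> W). specialize A p = q"
  using specialize_id[of A W q] polys_mono[of W "A \<union> W" q] by auto

lemma filtration_specialize:
  "filtration (A \<union> W) I \<Longrightarrow> A \<inter> W = {} \<Longrightarrow> filtration W (\<lambda>t. specialize A ` I t)"
  by (rule filtration_image[of "A \<union> W"]) (auto intro: specialize_algebra_hom specialize_polys specialize_surj)

text \<open>Division by x_u - 1. A linear map that vanishes on the multiples of x_u - 1 therefore
  factors through \<open>specialize {u}\<close>.\<close>

lemma specialize_remainder:
  fixes p :: "('v, 'k::field) mpoly"
  assumes "p \<in> polys (insert u W)"
  shows "\<exists>q\<in>polys (insert u W). p = specialize {u} p + (variable u - 1) * q"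
  using assms
proof (induction rule: polys_induct)
  case zero
  then show ?case using klinear_zero[OF algebra_homD(1)[OF specialize_algebra_hom]] by (intro bexI[of _ 0]) auto
next
  case (single t c)
  have "\<exists>q\<in>polys (insert u W). (monomial t :: ('v, 'k) mpoly) = specialize {u} (monomial t) + (variable u - 1) * q"
    using single
  proof (induction t rule: monomial_induct)
    case zero
    then show ?case using algebra_homD(2)[OF specialize_algebra_hom] by (intro bexI[of _ 0]) auto
  next
    case (add v t)
    let ?m = "monomial t :: ('v, 'k) mpoly"
    have v: "v \<in> insert u W" and t: "keys t \<subseteq> insert u W" using add.prems by (auto simp: keys_add_nat)
    obtain q where q: "q \<in> polys (insert u W)" "?m = specialize {u} ?m + (variable u - 1) * q"
      using add.IH[OF t] by blast
    have s: "specialize {u} (monomial (single v 1 + t)) = (if v = u then 1 else variable v) * specialize {u} ?m"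
      unfolding variable_mult_monomial[symmetric] algebra_homD(3)[OF specialize_algebra_hom]
      by (simp add: specialize_def)
    let ?q = "variable v * q + (if v = u then specialize {u} ?m else 0)"
    have "specialize {u} ?m \<in> polys (insert u W)"
      using specialize_polys[of ?m "{u}" W] polys_mono[of W "insert u W"] t by (simp add: polys_single subset_insertI)
    then have "?q \<in> polys (insert u W)" using q(1) v by simp
    moreover have "monomial (single v 1 + t) = specialize {u} (monomial (single v 1 + t)) + (variable u - 1) * ?q"
    proof -
      have "variable v * ?m = variable v * (specialize {u} ?m + (variable u - 1) * q)" using q(2) by simp
      also have "\<dots> = (if v = u then 1 else variable v) * specialize {u} ?m + (variable u - 1) * ?q"
        by (simp add: algebra_simps)
      finally show ?thesis unfolding s unfolding variable_mult_monomial[symmetric] .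
    qed
    ultimately show ?case by blast
  qed
  then obtain q where q: "q \<in> polys (insert u W)"
    "(monomial t :: ('v, 'k) mpoly) = specialize {u} (monomial t) + (variable u - 1) * q" by blast
  have "single t c = const c * (specialize {u} (monomial t) + (variable u - 1) * q)"
    using q(2) single_const_mono[of t c] by simp
  also have "\<dots> = specialize {u} (single t c) + (variable u - 1) * (const c * q)"
    using klinear_single[OF algebra_homD(1)[OF specialize_algebra_hom], of "{u}" t c] by (simp add: algebra_simps)
  finally show ?case using q(1) by (intro bexI[of _ "const c * q"]) auto
next
  case (add p q)
  then obtain p' q' where *: "p' \<in> polys (insert u W)" "p = specialize {u} p + (variable u - 1) * p'"
    "q' \<in> polys (insert u W)" "q = specialize {u} q + (variable u - 1) * q'" by blast
  have "p + q = (specialize {u} p + (variable u - 1) * p') + (specialize {u} q + (variable u - 1) * q')"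
    using *(2,4) by simp
  also have "\<dots> = specialize {u} (p + q) + (variable u - 1) * (p' + q')"
    by (simp add: klinear_add[OF algebra_homD(1)[OF specialize_algebra_hom]] algebra_simps)
  finally show ?case using * by (intro bexI[of _ "p' + q'"]) auto
qed

lemma cochains_map:
  assumes "F \<in> koszul_cochains X us i" "\<And>x. x \<in> X \<Longrightarrow> T x \<in> Y" "T 0 = 0"
  shows "(\<lambda>w. T (F w)) \<in> koszul_cochains Y us i"
  using assms unfolding koszul_cochains_def by auto

lemma cochains_diff:
  fixes X :: "'x::ab_group_add set"
  assumes "F \<in> koszul_cochains X us i" "G \<in> koszul_cochains X us i"
    "\<And>x y. x \<in> X \<Longrightarrow> y \<in> X \<Longrightarrow> x - y \<in> X"
  shows "(\<lambda>w. F w - G w) \<in> koszul_cochains X us i"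
  using assms unfolding koszul_cochains_def by auto

lemma cochains_zero: "0 \<in> X \<Longrightarrow> (\<lambda>w. 0) \<in> koszul_cochains X us i"
  by (simp add: koszul_cochains_def)

text \<open>The long exact sequence of multiplication by x_u - 1, in explicit cochains. A cocycle
  \<open>f\<close> over \<open>W\<close> lifts to \<open>F0\<close> over the larger ring; its
  connecting cocycle \<open>H\<close>, one degree higher, bounds by hypothesis. This corrects the
  lift to a cocycle, which bounds as well. The primitive is reduced modulo x_u - 1 in its values,
  adjusted so that it depends only on the specialized argument, and then descends to
  \<open>W\<close>.\<close>

theorem koszul_vanishing_specialize:
  fixes I :: "nat \<Rightarrow> ('v, 'k::field) mpoly set"
  assumes u: "u \<notin> W" and vs: "set vs = W" and I: "filtration (insert u W) I"
    and colon: "\<And>t p. p \<in> polys (insert u W) \<Longrightarrow> (variable u - 1) * p \<in> I t \<Longrightarrow> p \<in> I t"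
    and van: "koszul_vanishing (insert u W) I (u # vs) N"
  shows "koszul_vanishing W (\<lambda>t. specialize {u} ` I t) vs N"
  unfolding koszul_vanishing_def
proof (intro allI impI ballI)
  define V where "V = insert u W"
  define \<phi> where "\<phi> = (specialize {u} :: ('v, 'k) mpoly \<Rightarrow> _)"
  let ?I' = "\<lambda>t. specialize {u} ` I t"
  let ?X = "cont V V I" and ?X' = "cont W W ?I'" and ?Xm = "cont V W I"
  let ?D' = "\<lambda>v. ad (\<phi> (variable v)) (variable v)"
  note I = I[folded V_def]
  have WV: "W \<subseteq> V" and uV: "u \<in> V" and vsV: "set vs \<subseteq> V" and uvs: "set (u # vs) \<subseteq> V" and vsW: "set vs \<subseteq> W"
    using vs by (auto simp: V_def)
  have \<phi>: "algebra_hom \<phi>" "klinear \<phi>"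
    using specialize_algebra_hom algebra_homD(1) by (auto simp: \<phi>_def)
  have \<phi>_polys: "\<phi> p \<in> polys W" if "p \<in> polys V" for p
    using specialize_polys[of p "{u}" W] that by (simp add: \<phi>_def V_def)
  have \<phi>_id: "\<phi> p = p" if "p \<in> polys W" for p
    using specialize_id[of "{u}" W p] u that by (simp add: \<phi>_def)
  have \<phi>_u: "\<phi> (variable u) = 1" by (simp add: \<phi>_def specialize_def)
  have \<phi>_v: "\<phi> (variable v) = variable v" if "v \<in> W" for v using \<phi>_id that by simp
  have PW: "p \<in> polys V" if "p \<in> polys W" for p :: "('v, 'k) mpoly" using polys_mono[OF WV that] .
  have I': "filtration W ?I'"
    using filtration_specialize[of "{u}" W I] I u by (simp add: V_def)
  interpret X: commuting_operators ?X ad_var V by (rule cont_ad_var[OF I])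
  interpret X': commuting_operators ?X' ad_var W by (rule cont_ad_var[OF I'])
  interpret Xm: commuting_operators ?Xm ?D' V
    by (rule cont_operators[OF I]) (auto intro: \<phi>_polys)
  fix i f assume i: "N \<le> Suc i" and f: "f \<in> koszul_cochains ?X' vs (Suc i)" and df: "koszul_diff ad_var vs f = (\<lambda>w. 0)"
  \<comment> \<open>Pullback along the specialization in the argument; the values stay in
    \<open>polys W\<close>, regarded inside \<open>polys V\<close>.\<close>
  define T where "T F = (\<lambda>p. F (\<phi> (res V p)))" for F :: "('v, 'k) mpoly \<Rightarrow> ('v, 'k) mpoly"
  have T_mem: "T F \<in> ?X" if F: "F \<in> ?X'" for F
  proof -
    have F': "F \<in> homs W W" using F by (simp add: cont_def)
    have "T F \<in> homs V V"
      using klinear_comp[OF homsD(1)[OF F'] klinear_comp[OF \<phi>(2) res_klinear]] homsD(2)[OF F'] PW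
      by (auto simp: homs_def T_def res_id)
    moreover obtain t where "\<forall>p\<in>?I' t. F p = 0" using F by (auto simp: cont_def)
    then have "\<forall>p\<in>I t. T F p = 0"
      using poly_idealD(1)[OF filtrationD(1)[OF I]] by (auto simp: T_def res_id \<phi>_def)
    ultimately show ?thesis by (auto simp: cont_def)
  qed
  have T_0: "T 0 = 0" by (simp add: T_def zero_fun_def)
  have T_ad: "T (ad_var v F) = ad_var v (T F)" if "v \<in> W" for v F
  proof -
    have "\<phi> (res V (variable v * p)) = variable v * \<phi> (res V p)" for p
      using that WV res_mult[of "variable v" V p] algebra_homD(3)[OF \<phi>(1)] \<phi>_v by (simp add: subset_iff)
    then show ?thesis by (simp add: T_def ad_def)
  qed
  define F0 where "F0 w = T (f w)" for w
  have F0: "F0 \<in> koszul_cochains ?X vs (Suc i)"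
    unfolding F0_def by (rule cochains_map[where T = T, OF f T_mem T_0])
  have F0_mem: "F0 w \<in> ?X" for w using X.cochains_mem[OF F0] .
  have F0_polys: "F0 w p \<in> polys W" for w p
    using X'.cochains_mem[OF f, of w] homsD(2) by (auto simp: F0_def T_def cont_def)
  have dF0: "koszul_diff ad_var vs F0 w = 0" for w
    unfolding F0_def
    using X'.koszul_diff_map[OF vsW, of f T ad_var w] X'.cochains_mem[OF f] T_ad vs df T_0
    by (simp add: T_def fun_diff_def)
  have F0_u: "ad_var u (F0 w) = (\<lambda>p. (variable u - 1) * F0 w p)" for w
  proof -
    have "\<phi> (res V (variable u * p)) = \<phi> (res V p)" for p
      using uV res_mult[of "variable u" V p] algebra_homD(3)[OF \<phi>(1)] \<phi>_u by simp
    then show ?thesis by (simp add: F0_def T_def ad_def algebra_simps)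
  qed
  \<comment> \<open>The obstruction to \<open>F0\<close> being a cocycle over \<open>V\<close> is
    \<open>ad_var u (F0 w)\<close>, which is x_u - 1 times \<open>F0 w\<close>. Dividing the
    obstruction by x_u - 1 gives \<open>H\<close>.\<close>
  define H where "H = cochain_pair (\<lambda>w. 0) F0"
  have H: "H \<in> koszul_cochains ?X (u # vs) (Suc (Suc i))"
    unfolding H_def by (rule cochain_pair_cochains[OF cochains_zero[OF X.zero_mem] F0])
  have "koszul_diff ad_var (u # vs) H = (\<lambda>w. 0)"
    using dF0 X.koszul_diff_zero[OF vsV] X.op_zero[OF uV] by (auto simp: H_def fun_eq_iff split: list.split)
  then obtain H' where H': "H' \<in> koszul_cochains ?X (u # vs) (Suc i)" "koszul_diff ad_var (u # vs) H' = H"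
    using van H i unfolding koszul_vanishing_def V_def by (meson le_SucI)
  define L where "L F = (\<lambda>p. (variable u - 1) * F p)" for F :: "('v, 'k) mpoly \<Rightarrow> ('v, 'k) mpoly"
  have L_mem: "L F \<in> ?X" if F: "F \<in> ?X" for F
  proof -
    obtain t where "\<forall>p\<in>I t. F p = 0" using F by (auto simp: cont_def)
    then have "\<forall>p\<in>I t. L F p = 0" by (simp add: L_def)
    moreover have "L F \<in> homs V V"
      using F homs_lmult[of F V V "variable u - 1"] uV by (simp add: cont_def L_def)
    ultimately show ?thesis by (auto simp: cont_def)
  qed
  have L_0: "L 0 = 0" by (simp add: L_def zero_fun_def)
  have LH': "(\<lambda>w. L (H' w)) \<in> koszul_cochains ?X (u # vs) (Suc i)"
    by (rule cochains_map[where T = L, OF H'(1) L_mem L_0])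
  have dLH': "koszul_diff ad_var (u # vs) (\<lambda>w. L (H' w)) w = L (H w)" for w
    using X.koszul_diff_map[OF uvs, of H' L ad_var w] X.cochains_mem[OF H'(1)] H'(2)
    by (simp add: L_def ad_def fun_diff_def algebra_simps)
  define F where "F = cochain_pair F0 (\<lambda>w. 0)"
  have F: "F \<in> koszul_cochains ?X (u # vs) (Suc i)"
    unfolding F_def by (rule cochain_pair_cochains[OF F0 cochains_zero[OF X.zero_mem]])
  have dF: "koszul_diff ad_var (u # vs) F w = L (H w)" for w
  proof (cases w)
    case (Cons b w')
    then show ?thesis
      using F0_u[of w'] dF0[of w'] X.koszul_diff_zero[OF vsV] L_0 by (simp add: F_def H_def L_def)
  qed (simp add: H_def L_0)
  \<comment> \<open>Both terms have x_u - 1 times \<open>H\<close> as differential, so their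
    difference is a cocycle.\<close>
  have "koszul_diff ad_var (u # vs) (\<lambda>w. F w - L (H' w)) = (\<lambda>w. 0)"
    using X.koszul_diff_diff[OF uvs, of F "\<lambda>w. L (H' w)"] X.cochains_mem[OF F] X.cochains_mem[OF LH'] dF dLH'
    by (simp add: fun_eq_iff)
  then obtain G where G: "G \<in> koszul_cochains ?X (u # vs) i"
    "koszul_diff ad_var (u # vs) G = (\<lambda>w. F w - L (H' w))"
    using van cochains_diff[OF F LH' X.diff_mem] i unfolding koszul_vanishing_def V_def by meson
  \<comment> \<open>Specializing the values kills the correction \<open>L (H' w)\<close> and fixes
    \<open>F w\<close>. The primitive thus lands in the mixed complex, with arguments in
    \<open>polys V\<close> and values in \<open>polys W\<close>.\<close>
  define S where "S F = (\<lambda>p. \<phi> (F p))" for F :: "('v, 'k) mpoly \<Rightarrow> ('v, 'k) mpoly"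
  have S_mem: "S F \<in> ?Xm" if F: "F \<in> ?X" for F
  proof -
    obtain t where "\<forall>p\<in>I t. F p = 0" using F by (auto simp: cont_def)
    then have "\<forall>p\<in>I t. S F p = 0" by (simp add: S_def klinear_zero[OF \<phi>(2)])
    moreover have "S F \<in> homs V W"
      using F \<phi>_polys klinear_comp[OF \<phi>(2), of F] by (auto simp: cont_def homs_def S_def)
    ultimately show ?thesis by (auto simp: cont_def)
  qed
  have S_0: "S 0 = 0" using klinear_zero[OF \<phi>(2)] by (simp add: S_def zero_fun_def)
  define G' where "G' w = S (G w)" for w
  have G': "G' \<in> koszul_cochains ?Xm (u # vs) i"
    unfolding G'_def by (rule cochains_map[where T = S, OF G(1) S_mem S_0])
  have dG': "koszul_diff ?D' (u # vs) G' w = F w" for w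
  proof -
    have "koszul_diff ?D' (u # vs) G' w = S (F w - L (H' w))"
      unfolding G'_def
      using X.koszul_diff_map[OF uvs, of G S ?D' w] X.cochains_mem[OF G(1)] G(2)
      by (simp add: S_def ad_def fun_diff_def klinear_diff[OF \<phi>(2)] algebra_homD(3)[OF \<phi>(1)])
    also have "\<dots> = (\<lambda>p. \<phi> (F w p))"
      by (simp add: S_def L_def klinear_diff[OF \<phi>(2)] algebra_homD(3)[OF \<phi>(1)] \<phi>_u algebra_homD(2)[OF \<phi>(1)])
    also have "\<dots> = F w"
      using F0_polys \<phi>_id by (auto simp: F_def cochain_pair_def split: list.split)
    finally show ?thesis .
  qed
  let ?G0 = "\<lambda>w. G' (False # w)" and ?G1 = "\<lambda>w. G' (True # w)"
  have G0: "?G0 \<in> koszul_cochains ?Xm vs i" by (rule cochains_False[OF G'])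
  have G_mem: "G' w \<in> ?Xm" for w using Xm.cochains_mem[OF G'] .
  have dG0: "koszul_diff ?D' vs ?G0 w = F0 w" for w
    using dG'[of "False # w"] by (simp add: F_def)
  have dG1: "?D' u (?G0 w) = koszul_diff ?D' vs ?G1 w" for w
    using dG'[of "True # w"] by (simp add: F_def)
  \<comment> \<open>On the mixed complex x_u acts as 1 on values, so \<open>ad_one_surj\<close>
    applies; this is where the colon hypothesis enters.\<close>
  have "\<exists>y\<in>?Xm. ?D' u y = ?G1 w" for w
    unfolding \<phi>_u by (rule ad_one_surj[OF I _ colon[folded V_def] G_mem]) (use uV in simp)
  then obtain y where y: "\<And>w. y w \<in> ?Xm" "\<And>w. ?D' u (y w) = ?G1 w" by metis
  \<comment> \<open>Zero is chosen wherever \<open>?G1 w\<close> is zero, which keeps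
    \<open>Y\<close> a cochain of the right degree.\<close>
  define Y where "Y w = (if ?G1 w = 0 then 0 else y w)" for w
  have Y_mem: "Y w \<in> ?Xm" for w using y Xm.zero_mem by (simp add: Y_def)
  have Y_u: "?D' u (Y w) = ?G1 w" for w using y(2) Xm.op_zero[OF uV] by (auto simp: Y_def)
  have dY: "koszul_diff ?D' vs Y \<in> koszul_cochains ?Xm vs i"
  proof (cases i)
    case 0
    have "?G1 w = 0" for w using G' by (auto simp: 0 cochains_0)
    then have "Y = (\<lambda>w. 0)" by (simp add: Y_def fun_eq_iff)
    then have "koszul_diff ?D' vs Y = (\<lambda>w. 0)" using Xm.koszul_diff_zero[OF vsV] by auto
    then show ?thesis using cochains_zero[OF Xm.zero_mem] by simp
  next
    case (Suc j)
    have "?G1 \<in> koszul_cochains ?Xm vs j" by (rule cochains_True[OF G'[unfolded Suc]])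
    then have "Y \<in> koszul_cochains ?Xm vs j"
      unfolding koszul_cochains_def using Y_mem by (auto simp: Y_def)
    then show ?thesis unfolding Suc by (rule Xm.koszul_diff_cochains[OF vsV])
  qed
  \<comment> \<open>Subtracting the boundary of \<open>Y\<close> cancels the \<open>True\<close>
    part. Every \<open>G2 w\<close> then takes the same value at p and at x_u times p, so it depends
    only on the specialization of its argument.\<close>
  define G2 where "G2 w = ?G0 w - koszul_diff ?D' vs Y w" for w
  have G2: "G2 \<in> koszul_cochains ?Xm vs i"
    unfolding G2_def by (rule cochains_diff[OF G0 dY Xm.diff_mem])
  have dY_mem: "koszul_diff ?D' vs Y w \<in> ?Xm" for w using Xm.cochains_mem[OF dY] .
  have dG2: "koszul_diff ?D' vs G2 w = F0 w" for w
    unfolding G2_def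
    using Xm.koszul_diff_diff[OF vsV, of ?G0 "koszul_diff ?D' vs Y" w] G_mem dY_mem dG0
      Xm.koszul_diff_koszul_diff[OF vsV, of Y w] Y_mem by simp
  have G2_u: "?D' u (G2 w) = 0" for w
  proof -
    have "koszul_diff ?D' vs (\<lambda>w. ?D' u (Y w)) w = ?D' u (koszul_diff ?D' vs Y w)"
      by (rule Xm.koszul_diff_map[OF vsV Y_mem _ Xm.op_diff[OF uV]]) (use Xm.op_commute uV vsV in auto)
    then show ?thesis
      unfolding G2_def Xm.op_diff[OF uV G_mem dY_mem] using dG1 Y_u by simp
  qed
  have G2_homs: "G2 w \<in> homs V W" for w using Xm.cochains_mem[OF G2, of w] by (simp add: cont_def)
  have G2_\<phi>: "G2 w p = G2 w (\<phi> p)" if p: "p \<in> polys V" for w p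
  proof -
    obtain q where "q \<in> polys V" "p = \<phi> p + (variable u - 1) * q"
      using specialize_remainder[of p u W] p by (auto simp: V_def \<phi>_def)
    moreover have "G2 w ((variable u - 1) * q) = 0"
      using fun_cong[OF G2_u[of w], of q] klinear_diff[OF homsD(1)[OF G2_homs], of w "variable u * q" q]
      by (simp add: ad_def \<phi>_u left_diff_distrib)
    ultimately show ?thesis using klinear_add[OF homsD(1)[OF G2_homs]] by (metis add.right_neutral)
  qed
  define Q where "Q F = (\<lambda>p. F (res W p))" for F :: "('v, 'k) mpoly \<Rightarrow> ('v, 'k) mpoly"
  define g where "g w = Q (G2 w)" for w
  have g_mem: "g w \<in> ?X'" for w
  proof -
    have "g w \<in> homs W W"
      using klinear_comp[OF homsD(1)[OF G2_homs] res_klinear] homsD(2)[OF G2_homs]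
      by (auto simp: g_def Q_def homs_def res_id)
    moreover obtain t where t: "\<forall>p\<in>I t. G2 w p = 0" using Xm.cochains_mem[OF G2, of w] by (auto simp: cont_def)
    have "g w (\<phi> p) = 0" if "p \<in> I t" for p
    proof -
      have p: "p \<in> polys V" by (rule poly_idealD(1)[OF filtrationD(1)[OF I] that])
      then show ?thesis using G2_\<phi>[OF p, of w] t that by (simp add: g_def Q_def res_id \<phi>_polys)
    qed
    ultimately show ?thesis by (auto simp: cont_def \<phi>_def)
  qed
  have "g \<in> koszul_cochains ?X' vs i"
    using G2 g_mem unfolding koszul_cochains_def by (auto simp: g_def Q_def zero_fun_def)
  moreover have "koszul_diff ad_var vs g w = f w" for w
  proof -
    have "koszul_diff ad_var vs g w = Q (F0 w)"
      unfolding g_def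
      using Xm.koszul_diff_map[OF vsV, of G2 Q ad_var w] Xm.cochains_mem[OF G2] dG2 vs
      by (simp add: Q_def ad_def fun_diff_def \<phi>_v res_mult)
    also have "\<dots> = f w"
      using homsD(3)[of "f w" W W] X'.cochains_mem[OF f, of w] \<phi>_id
      by (auto simp: Q_def F0_def T_def res_id PW cont_def)
    finally show ?thesis .
  qed
  ultimately show "\<exists>G\<in>koszul_cochains ?X' vs i. koszul_diff ad_var vs G = f" by blast
qed

section \<open>The Koszul resolution and local cohomology\<close>

text \<open>The resolution has to live in the carrier type fixed by
  \<open>some_injective_resolution\<close> for the ring as a module over itself. A cochain is stored
  there as its graph, with the word coded by a number.\<close>

definition encode ::
  "(bool list \<Rightarrow> 'r \<Rightarrow> 'r) \<Rightarrow> (nat \<times> 'r \<times> 'r) set"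
where
  "encode F = {(n, p, y). \<exists>w. n = to_nat w \<and> y = F w p}"

definition decode :: "(nat \<times> 'r \<times> 'r) set \<Rightarrow> bool list \<Rightarrow> 'r \<Rightarrow> 'r" where
  "decode S w p = (THE y. (to_nat w, p, y) \<in> S)"

lemma decode_encode [simp]: "decode (encode F) = F"
  by (simp add: decode_def encode_def fun_eq_iff)

lemma encode_inject [simp]: "encode F = encode G \<longleftrightarrow> F = G"
  by (metis decode_encode)

abbreviation koszul_homs :: "'v list \<Rightarrow> nat \<Rightarrow> (bool list \<Rightarrow> ('v, 'k::field) mpoly \<Rightarrow> ('v, 'k) mpoly) set" where
  "koszul_homs vs i \<equiv> koszul_cochains (homs (set vs) (set vs)) vs i"

text \<open>Scalars act on the argument, not on the value. This makes each component the coinduced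
  module Hom_K(R, R), hence injective, and turns annihilation by a power of an ideal into vanishing
  on that power.\<close>

definition koszul_module ::
  "'v list \<Rightarrow> nat \<Rightarrow> (('v, 'k::field) mpoly, (nat \<times> ('v, 'k) mpoly \<times> ('v, 'k) mpoly) set) module"
where
  "koszul_module vs i = \<lparr>carrier = encode ` koszul_homs vs i, monoid.mult = undefined, one = undefined,
     zero = encode 0, add = (\<lambda>S T. encode (decode S + decode T)),
     smult = (\<lambda>r S. encode (\<lambda>w p. decode S w (r * p)))\<rparr>"

definition koszul_map ::
  "'v list \<Rightarrow> (nat \<times> ('v, 'k::field) mpoly \<times> ('v, 'k) mpoly) set \<Rightarrow> (nat \<times> ('v, 'k) mpoly \<times> ('v, 'k) mpoly) set"
where
  "koszul_map vs S = encode (koszul_diff ad_var vs (decode S))"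

definition koszul_augmentation ::
  "'v list \<Rightarrow> ('v, 'k::field) mpoly \<Rightarrow> (nat \<times> ('v, 'k) mpoly \<times> ('v, 'k) mpoly) set"
where
  "koszul_augmentation vs r =
     encode (\<lambda>w. if w = replicate (length vs) False then (\<lambda>p. r * res (set vs) p) else 0)"

lemma koszul_module_simps [simp]:
  "carrier (koszul_module vs i) = encode ` koszul_homs vs i"
  "zero (koszul_module vs i) = encode 0"
  "add (koszul_module vs i) S T = encode (decode S + decode T)"
  "smult (koszul_module vs i) r S = encode (\<lambda>w p. decode S w (r * p))"
  by (simp_all add: koszul_module_def)

lemma homs_operators: "commuting_operators (homs V V) ad_var V"
  using cont_ad_var[OF zero_filtration, of V] by (simp add: cont_zero_filtration)

lemma koszul_homs_add: "F \<in> koszul_homs vs i \<Longrightarrow> G \<in> koszul_homs vs i \<Longrightarrow> F + G \<in> koszul_homs vs i"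
  by (auto simp: koszul_cochains_def intro: commuting_operators.add_mem[OF homs_operators])

lemma koszul_homs_zero: "0 \<in> koszul_homs vs i"
  using commuting_operators.zero_mem[OF homs_operators] by (auto simp: koszul_cochains_def)

lemma homs_uminus: "F \<in> homs V W \<Longrightarrow> - F \<in> homs V W"
  using homs_diff[OF homs_0, of F V W] by (simp add: fun_Compl_def)

lemma koszul_homs_uminus: "F \<in> koszul_homs vs i \<Longrightarrow> - F \<in> koszul_homs vs i"
  by (auto simp: koszul_cochains_def intro: homs_uminus)

lemma koszul_homs_smult:
  assumes "F \<in> koszul_homs vs i" "r \<in> polys (set vs)"
  shows "(\<lambda>w p. F w (r * p)) \<in> koszul_homs vs i"
  using assms homs_rmult[of "F _" "set vs" "set vs" r] by (auto simp: koszul_cochains_def zero_fun_def)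

lemma koszul_homs_mem: "F \<in> koszul_homs vs i \<Longrightarrow> F w \<in> homs (set vs) (set vs)"
  by (rule commuting_operators.cochains_mem[OF homs_operators])

lemma koszul_homs_klinear: "F \<in> koszul_homs vs i \<Longrightarrow> klinear (F w)"
  using koszul_homs_mem homsD(1) by blast

lemma module_koszul_module: "Module.module (polynomial_ring (set vs)) (koszul_module vs i)"
proof (rule moduleI[OF cring_polynomial_ring])
  show "abelian_group (koszul_module vs i)"
  proof (rule abelian_groupI)
    fix S assume "S \<in> carrier (koszul_module vs i)"
    then obtain F where F: "F \<in> koszul_homs vs i" "S = encode F" by auto
    then show "\<exists>T\<in>carrier (koszul_module vs i). T \<oplus>\<^bsub>koszul_module vs i\<^esub> S = \<zero>\<^bsub>koszul_module vs i\<^esub>"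
      using koszul_homs_uminus[OF F(1)] by (intro bexI[of _ "encode (- F)"]) auto
  qed (auto simp: koszul_homs_add koszul_homs_zero add_ac)
qed (auto simp: koszul_homs_smult fun_eq_iff klinear_add[OF koszul_homs_klinear] algebra_simps)

text \<open>Adjunction: by evaluation at 1, module maps into Hom_K(R, R) are K-linear maps into R.
  For each word, \<open>f\<close> becomes the linear map \<open>df x w 1\<close>; it extends along
  \<open>\<iota>\<close> because K is a field, and the extension comes back as b \<mapsto> (p
  \<mapsto> \<open>G w\<close> (p b)).\<close>

lemma injective_koszul_module:
  fixes vs :: "'v list"
  shows "injective_module (polynomial_ring (set vs) :: ('v, 'k::field) mpoly ring) (koszul_module vs i)"
  unfolding injective_module_def
proof (rule conjI[OF module_koszul_module], intro allI impI ballI)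
  let ?V = "set vs"
  let ?R = "polynomial_ring ?V :: ('v, 'k) mpoly ring"
  let ?E = "koszul_module vs i :: (('v, 'k) mpoly, _) module"
  let ?N = "regular_module ?R :: (('v, 'k) mpoly, ('v, 'k) mpoly) module"
  fix A B :: "(('v, 'k) mpoly, ('v, 'k) mpoly) module" and \<iota> f
  assume A: "Module.module ?R A" and B: "Module.module ?R B"
    and \<iota>: "\<iota> \<in> module_homs ?R A B" and f: "f \<in> module_homs ?R A ?E" and inj: "inj_on \<iota> (carrier A)"
  interpret A: Module.module ?R A by (rule A)
  interpret B: Module.module ?R B by (rule B)
  note E = module_koszul_module[of vs i]
  define df where "df x = decode (f x)" for x
  have df: "df x \<in> koszul_homs vs i" and fe: "f x = encode (df x)" if x: "x \<in> carrier A" for x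
  proof -
    obtain F where "F \<in> koszul_homs vs i" "f x = encode F"
      using module_homs_closed[OF f x] unfolding koszul_module_simps by blast
    then show "df x \<in> koszul_homs vs i" "f x = encode (df x)" by (simp_all add: df_def)
  qed
  have df_zero: "df \<zero>\<^bsub>A\<^esub> = 0" using module_homs_zero[OF A E f] by (simp add: df_def)
  have df_add: "df (x \<oplus>\<^bsub>A\<^esub> y) = df x + df y" if "x \<in> carrier A" "y \<in> carrier A" for x y
    using module_homs_add[OF f that] by (simp add: df_def)
  have df_smult: "df (r \<odot>\<^bsub>A\<^esub> x) = (\<lambda>w p. df x w (r * p))" if "r \<in> polys ?V" "x \<in> carrier A" for r x
    using module_homs_smult[OF f that] by (simp add: df_def)
  define Q where "Q w g \<longleftrightarrow> (\<forall>x\<in>carrier B. g x \<in> polys ?V) \<and>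
    (\<forall>x\<in>carrier B. \<forall>y\<in>carrier B. g (x \<oplus>\<^bsub>B\<^esub> y) = g x + g y) \<and>
    (\<forall>c. \<forall>x\<in>carrier B. g (const c \<odot>\<^bsub>B\<^esub> x) = const c * g x) \<and>
    (\<forall>x y. (x, y) \<in> (\<lambda>x. (\<iota> x, df x w 1)) ` carrier A \<longrightarrow> g x = y)" for w g
  have "\<exists>g. Q w g" for w
    unfolding Q_def
  proof (rule linear_extension[OF B])
    let ?\<Gamma> = "(\<lambda>x. (\<iota> x, df x w 1)) ` carrier A"
    have mem: "(\<iota> x, df x w 1) \<in> ?\<Gamma>" if "x \<in> carrier A" for x using that by blast
    show "partial_hom (polynomial_ring {}) B ?N ?\<Gamma>"
      unfolding partial_hom_def
    proof (intro conjI allI ballI impI)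
      show "?\<Gamma> \<subseteq> carrier B \<times> carrier ?N"
        using module_homs_closed[OF \<iota>] homsD(2)[OF koszul_homs_mem[OF df]]
        by (auto simp: regular_module_def)
      show "(\<zero>\<^bsub>B\<^esub>, \<zero>\<^bsub>?N\<^esub>) \<in> ?\<Gamma>"
        using mem[of "\<zero>\<^bsub>A\<^esub>"] module_homs_zero[OF A B \<iota>] df_zero by (simp add: regular_module_def)
    next
      fix x y x' y' assume "(x, y) \<in> ?\<Gamma>" "(x', y') \<in> ?\<Gamma>"
      then obtain a a' where "a \<in> carrier A" "a' \<in> carrier A"
        "x = \<iota> a" "y = df a w 1" "x' = \<iota> a'" "y' = df a' w 1" by blast
      then show "(x \<oplus>\<^bsub>B\<^esub> x', y \<oplus>\<^bsub>?N\<^esub> y') \<in> ?\<Gamma>"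
        using mem[of "a \<oplus>\<^bsub>A\<^esub> a'"] module_homs_add[OF \<iota>] df_add by (simp add: regular_module_def)
    next
      fix r x y assume r: "r \<in> carrier (polynomial_ring {} :: ('v, 'k) mpoly ring)" and "(x, y) \<in> ?\<Gamma>"
      then obtain a where a: "a \<in> carrier A" "x = \<iota> a" "y = df a w 1" by blast
      have rV: "r \<in> polys ?V" using polys_mono[OF _ r] by blast
      obtain c where c: "r = const c" using constant_poly[OF r] by blast
      have "df (r \<odot>\<^bsub>A\<^esub> a) w 1 = r * y"
        using df_smult[OF rV a(1)] klinear_scale[OF koszul_homs_klinear[OF df[OF a(1)]], of w c 1] a(3) c
        by simp
      then show "(r \<odot>\<^bsub>B\<^esub> x, r \<odot>\<^bsub>?N\<^esub> y) \<in> ?\<Gamma>"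
        using mem[of "r \<odot>\<^bsub>A\<^esub> a"] module_homs_smult[OF \<iota>, of r a] rV a by (simp add: regular_module_def)
    next
      fix y assume "(\<zero>\<^bsub>B\<^esub>, y) \<in> ?\<Gamma>"
      then obtain a where a: "a \<in> carrier A" "\<zero>\<^bsub>B\<^esub> = \<iota> a" "y = df a w 1" by blast
      have "a = \<zero>\<^bsub>A\<^esub>"
        by (rule inj_onD[OF inj]) (use a module_homs_zero[OF A B \<iota>] in auto)
      then show "y = \<zero>\<^bsub>?N\<^esub>" using a(3) df_zero by (simp add: regular_module_def)
    qed
  qed
  then obtain G where "\<And>w. Q w (G w)" by metis
  then have G: "\<And>w x. x \<in> carrier B \<Longrightarrow> G w x \<in> polys ?V"
    "\<And>w x y. x \<in> carrier B \<Longrightarrow> y \<in> carrier B \<Longrightarrow> G w (x \<oplus>\<^bsub>B\<^esub> y) = G w x + G w y"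
    "\<And>w c x. x \<in> carrier B \<Longrightarrow> G w (const c \<odot>\<^bsub>B\<^esub> x) = const c * G w x"
    "\<And>w x. x \<in> carrier A \<Longrightarrow> G w (\<iota> x) = df x w 1"
    unfolding Q_def by blast+
  define g where "g b = (\<lambda>w. if length w = length vs \<and> weight w = i
    then (\<lambda>p. G w (res ?V p \<odot>\<^bsub>B\<^esub> b)) else 0)" for b
  have g_mem: "g b \<in> koszul_homs vs i" if b: "b \<in> carrier B" for b
  proof -
    have "klinear (\<lambda>p. G w (res ?V p \<odot>\<^bsub>B\<^esub> b))" for w
      unfolding klinear_def klinear_add[OF res_klinear] klinear_scale[OF res_klinear]
      using b G(2,3) B.smult_l_distr[of _ _ b] B.smult_assoc1[of "const _" _ b] B.smult_closed[of _ b]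
      by simp
    then have "(\<lambda>p. G w (res ?V p \<odot>\<^bsub>B\<^esub> b)) \<in> homs ?V ?V" for w
      using G(1) b B.smult_closed[of _ b] by (simp add: homs_def res_id)
    then show ?thesis by (auto simp: koszul_cochains_def g_def)
  qed
  have hom: "(\<lambda>b. encode (g b)) \<in> module_homs ?R B ?E"
    unfolding module_homs_def
  proof (intro CollectI conjI ballI)
    show "(\<lambda>b. encode (g b)) ` carrier B \<subseteq> carrier ?E" using g_mem by auto
  next
    fix x y assume "x \<in> carrier B" "y \<in> carrier B"
    then show "encode (g (x \<oplus>\<^bsub>B\<^esub> y)) = encode (g x) \<oplus>\<^bsub>?E\<^esub> encode (g y)"
      using B.smult_closed[of "res ?V _"] G(2) B.smult_r_distr[of "res ?V _" x y] by (simp add: g_def fun_eq_iff)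
  next
    fix r x assume r: "r \<in> carrier ?R" "x \<in> carrier B"
    have "res ?V (r * p) = res ?V p * r" for p using res_mult[OF r(1)] by (simp add: mult.commute)
    with r show "encode (g (r \<odot>\<^bsub>B\<^esub> x)) = r \<odot>\<^bsub>?E\<^esub> encode (g x)"
      using B.smult_assoc1[of "res ?V _" r x] by (simp add: g_def fun_eq_iff)
  qed
  have ext: "encode (g (\<iota> x)) = f x" if x: "x \<in> carrier A" for x
  proof -
    have "g (\<iota> x) w p = df x w p" for w p
    proof (cases "length w = length vs \<and> weight w = i")
      case True
      have "g (\<iota> x) w p = G w (\<iota> (res ?V p \<odot>\<^bsub>A\<^esub> x))"
        using True module_homs_smult[OF \<iota>, of "res ?V p" x] x by (simp add: g_def)
      also have "\<dots> = df (res ?V p \<odot>\<^bsub>A\<^esub> x) w 1" using G(4)[of "res ?V p \<odot>\<^bsub>A\<^esub> x" w] x by simp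
      also have "\<dots> = df x w p"
        using df_smult[of "res ?V p" x] x homsD(3)[OF koszul_homs_mem[OF df[OF x]]] by simp
      finally show ?thesis .
    next
      case False
      then have "df x w = 0" using df[OF x] by (auto simp: koszul_cochains_def)
      then show ?thesis using False by (auto simp: g_def)
    qed
    then have "g (\<iota> x) = df x" by (simp add: fun_eq_iff)
    then show ?thesis using fe[OF x] by simp
  qed
  show "\<exists>g\<in>module_homs ?R B ?E. \<forall>x\<in>carrier A. g (\<iota> x) = f x"
    by (rule bexI[OF _ hom]) (simp add: ext)
qed

text \<open>Commuting with all variables means linearity over the polynomial ring. The cocycles of
  degree 0 are therefore the multiplications, which form the image of the augmentation.\<close>

lemma commuting_with_variables:
  assumes h: "h \<in> homs V V" and c: "\<And>v. v \<in> V \<Longrightarrow> ad_var v h = 0"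
  shows "h = (\<lambda>p. h 1 * res V p)"
proof (rule homs_eqI[OF h])
  show "(\<lambda>p. h 1 * res V p) \<in> homs V V"
    using klinear_lmult[OF res_klinear] homsD(2)[OF h] by (simp add: homs_def res_id)
  have comm: "h (variable v * p) = variable v * h p" if "v \<in> V" for v p
    using fun_cong[OF c[OF that], of p] by (simp add: ad_def)
  fix t :: "'a \<Rightarrow>\<^sub>0 nat" assume "keys t \<subseteq> V"
  then show "h (monomial t) = h 1 * res V (monomial t)"
  proof (induction t rule: monomial_induct)
    case (add v t)
    then have v: "v \<in> V" and IH: "h (monomial t) = h 1 * res V (monomial t)" by (auto simp: keys_add_nat)
    show ?case
      unfolding variable_mult_monomial[symmetric] using v IH
      by (simp add: comm res_mult mult.left_commute)
  qed (simp add: res_id)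
qed

text \<open>Exactness in positive degrees is \<open>koszul_exact\<close> for the regular family
  \<open>ad_var\<close>; at the start it is \<open>commuting_with_variables\<close>.\<close>

theorem koszul_resolution:
  fixes vs :: "'v list"
  assumes vs: "distinct vs"
  shows "injective_resolution (polynomial_ring (set vs) :: ('v, 'k::field) mpoly ring) (regular_module (polynomial_ring (set vs)))
    (koszul_augmentation vs) (koszul_module vs) (\<lambda>i. koszul_map vs)"
proof -
  let ?V = "set vs"
  let ?R = "polynomial_ring ?V :: ('v, 'k) mpoly ring"
  let ?E = "koszul_module vs :: nat \<Rightarrow> (('v, 'k) mpoly, _) module"
  let ?H = "koszul_homs vs :: nat \<Rightarrow> (bool list \<Rightarrow> ('v, 'k) mpoly \<Rightarrow> _) set"
  let ?o = "replicate (length vs) False"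
  interpret commuting_operators "homs ?V ?V :: (('v, 'k) mpoly \<Rightarrow> _) set" ad_var ?V by (rule homs_operators)
  note reg = regular_ad_var[OF vs order_refl]
  define \<epsilon> where "\<epsilon> r = (\<lambda>w. if w = ?o then (\<lambda>p. r * res ?V p) else 0)" for r :: "('v, 'k) mpoly"
  have aug: "koszul_augmentation vs r = encode (\<epsilon> r)" for r
    by (simp add: koszul_augmentation_def \<epsilon>_def)
  have \<epsilon>_mem: "\<epsilon> r \<in> ?H 0" if "r \<in> polys ?V" for r
    using klinear_lmult[OF res_klinear] that by (auto simp: cochains_0 \<epsilon>_def homs_def res_id)
  have mem: "F w \<in> homs ?V ?V" if "F \<in> ?H i" for F i w
    using koszul_homs_mem that by blast
  have d_mem: "koszul_diff ad_var vs F \<in> ?H (Suc i)" if "F \<in> ?H i" for F i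
    using koszul_diff_cochains[OF order_refl that] .
  have aug_hom: "koszul_augmentation vs \<in> module_homs ?R (regular_module ?R) (?E 0)"
    by (auto simp: module_homs_def regular_module_def aug \<epsilon>_mem)
      (auto simp: \<epsilon>_def fun_eq_iff algebra_simps res_mult)
  have map_hom: "koszul_map vs \<in> module_homs ?R (?E i) (?E (Suc i))" for i
    unfolding module_homs_def
  proof (intro CollectI conjI ballI)
    show "koszul_map vs ` carrier (?E i) \<subseteq> carrier (?E (Suc i))"
      using d_mem by (auto simp: koszul_map_def)
  next
    fix S T assume "S \<in> carrier (?E i)" "T \<in> carrier (?E i)"
    then obtain F G where *: "F \<in> ?H i" "S = encode F" "G \<in> ?H i" "T = encode G" by auto
    then have "koszul_diff ad_var vs (F + G) = koszul_diff ad_var vs F + koszul_diff ad_var vs G"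
      using koszul_diff_add[OF order_refl, of F G] mem by (simp add: fun_eq_iff plus_fun_def)
    then show "koszul_map vs (S \<oplus>\<^bsub>?E i\<^esub> T) =
        koszul_map vs S \<oplus>\<^bsub>?E (Suc i)\<^esub> koszul_map vs T"
      using * by (simp add: koszul_map_def)
  next
    fix r S assume r: "r \<in> carrier ?R" and "S \<in> carrier (?E i)"
    then obtain F where *: "F \<in> ?H i" "S = encode F" by auto
    have "koszul_diff ad_var vs (\<lambda>w p. F w (r * p)) w = (\<lambda>p. koszul_diff ad_var vs F w (r * p))" for w
      by (rule koszul_diff_map[OF order_refl mem[OF *(1)]]) (auto simp: ad_def fun_eq_iff mult.left_commute)
    then show "koszul_map vs (r \<odot>\<^bsub>?E i\<^esub> S) = r \<odot>\<^bsub>?E (Suc i)\<^esub> koszul_map vs S"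
      using * by (simp add: koszul_map_def fun_eq_iff)
  qed
  have aug_inj: "inj_on (koszul_augmentation vs) (carrier (regular_module ?R))"
  proof (rule inj_onI)
    fix r s :: "('v, 'k) mpoly"
    assume "koszul_augmentation vs r = koszul_augmentation vs s"
    then have "\<epsilon> r ?o 1 = \<epsilon> s ?o 1" by (simp add: aug)
    then show "r = s" by (simp add: \<epsilon>_def res_id)
  qed
  have aug_image: "koszul_augmentation vs ` carrier (regular_module ?R) =
      a_kernel (?E 0) (?E 1) (koszul_map vs)"
  proof -
    have "\<epsilon> ` polys ?V = {F \<in> ?H 0. koszul_diff ad_var vs F = 0}"
    proof (intro Set.set_eqI iffI)
      fix F assume "F \<in> \<epsilon> ` polys ?V"
      then obtain r where r: "r \<in> polys ?V" "F = \<epsilon> r" by blast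
      have "ad_var v (\<epsilon> r ?o) = 0" if "v \<in> ?V" for v
        using that by (simp add: ad_def \<epsilon>_def fun_eq_iff res_mult mult.left_commute)
      then show "F \<in> {F \<in> ?H 0. koszul_diff ad_var vs F = 0}"
        using koszul_cocycle_0[OF order_refl \<epsilon>_mem[OF r(1)]] \<epsilon>_mem[OF r(1)] r(2) by (simp add: zero_fun_def)
    next
      fix F assume "F \<in> {F \<in> ?H 0. koszul_diff ad_var vs F = 0}"
      then have F: "F \<in> ?H 0" "koszul_diff ad_var vs F = (\<lambda>w. 0)" by (auto simp: zero_fun_def)
      then have "F ?o = (\<lambda>p. F ?o 1 * res ?V p)"
        using koszul_cocycle_0[OF order_refl F(1)] mem by (intro commuting_with_variables) auto
      then have "F = \<epsilon> (F ?o 1)" using F(1) by (auto simp: \<epsilon>_def cochains_0)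
      moreover have "F ?o 1 \<in> polys ?V" using homsD(2)[OF mem[OF F(1)]] .
      ultimately show "F \<in> \<epsilon> ` polys ?V" by blast
    qed
    then have "encode ` \<epsilon> ` polys ?V = encode ` {F \<in> ?H 0. koszul_diff ad_var vs F = 0}" by simp
    then show ?thesis
      by (auto simp: a_kernel_def' regular_module_def aug koszul_map_def image_image)
  qed
  have map_image: "koszul_map vs ` carrier (?E i) =
      a_kernel (?E (Suc i)) (?E (Suc (Suc i))) (koszul_map vs)" for i
  proof -
    have "koszul_diff ad_var vs ` ?H i =
        {F \<in> ?H (Suc i). koszul_diff ad_var vs F = 0}"
    proof (intro Set.set_eqI iffI)
      fix F assume "F \<in> koszul_diff ad_var vs ` ?H i"
      then obtain G where G: "G \<in> ?H i" "F = koszul_diff ad_var vs G" by blast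
      have "koszul_diff ad_var vs F = 0"
        unfolding G(2) by (rule ext, subst koszul_diff_koszul_diff[OF order_refl mem[OF G(1)]]) simp
      then show "F \<in> {F \<in> ?H (Suc i). koszul_diff ad_var vs F = 0}"
        using d_mem[OF G(1)] G(2) by simp
    next
      fix F assume "F \<in> {F \<in> ?H (Suc i). koszul_diff ad_var vs F = 0}"
      then show "F \<in> koszul_diff ad_var vs ` ?H i"
        using koszul_exact[OF order_refl reg, of F i] by (auto simp: zero_fun_def)
    qed
    then have "encode ` koszul_diff ad_var vs ` ?H i =
        encode ` {F \<in> ?H (Suc i). koszul_diff ad_var vs F = 0}" by simp
    then show ?thesis by (auto simp: a_kernel_def' koszul_map_def image_image)
  qed
  show ?thesis
    unfolding injective_resolution_def
    by (intro conjI allI injective_koszul_module aug_hom map_hom aug_inj aug_image map_image)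
qed

section \<open>Torsion of the Koszul resolution and the cohomological dimension\<close>

lemma ideal_poly_ideal: "ideal J (polynomial_ring V) \<Longrightarrow> poly_ideal V J"
proof -
  assume "ideal J (polynomial_ring V)"
  then interpret ideal J "polynomial_ring V" .
  show ?thesis
    unfolding poly_ideal_def using Icarr I_l_closed additive_subgroup.a_closed[OF additive_subgroup_axioms]
      additive_subgroup.zero_closed[OF additive_subgroup_axioms] by auto
qed

lemma ideal_powers_filtration:
  "ideal J (polynomial_ring V) \<Longrightarrow> filtration V (ideal_powers (polynomial_ring V) J)"
  unfolding filtration_def
  by (intro conjI allI impI ideal_poly_ideal ideal_powers_ideal ideal_powers_antimono cring_polynomial_ring)

lemma koszul_cochains_mono:
  assumes "X \<subseteq> Y" "F \<in> koszul_cochains X us i"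
  shows "F \<in> koszul_cochains Y us i"
  using assms(2) subsetD[OF assms(1)] by (simp add: koszul_cochains_def)

text \<open>Torsion demands one power that kills all components at once; there are finitely many
  words, so a common exponent exists. Killing a map by scalars from an ideal amounts to its
  vanishing on that ideal.\<close>

lemma torsion_koszul_module:
  assumes J: "ideal J (polynomial_ring (set vs))"
  shows "carrier (torsion_submodule (polynomial_ring (set vs)) J (koszul_module vs i)) =
    encode ` koszul_cochains (cont (set vs) (set vs) (ideal_powers (polynomial_ring (set vs)) J)) vs i"
proof -
  let ?V = "set vs"
  let ?I = "ideal_powers (polynomial_ring ?V) J"
  note I = ideal_powers_filtration[OF J]
  have key: "(F \<in> koszul_homs vs i \<and> (\<exists>t. \<forall>a\<in>?I t. (\<lambda>w p. F w (a * p)) = 0)) \<longleftrightarrow>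
      F \<in> koszul_cochains (cont ?V ?V ?I) vs i" for F
  proof
    assume F: "F \<in> koszul_homs vs i \<and> (\<exists>t. \<forall>a\<in>?I t. (\<lambda>w p. F w (a * p)) = 0)"
    then obtain t where t: "\<And>a. a \<in> ?I t \<Longrightarrow> (\<lambda>w p. F w (a * p)) = 0" by blast
    have "F w a = 0" if "a \<in> ?I t" for w a
      using fun_cong[OF fun_cong[OF t[OF that], of w], of 1] by simp
    then show "F \<in> koszul_cochains (cont ?V ?V ?I) vs i"
      using F by (auto simp: koszul_cochains_def cont_def)
  next
    assume F: "F \<in> koszul_cochains (cont ?V ?V ?I) vs i"
    then have Fh: "F \<in> koszul_homs vs i" by (rule koszul_cochains_mono[rotated]) (auto simp: cont_def)
    have "\<exists>t. \<forall>a\<in>?I t. F w a = 0" for w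
      using commuting_operators.cochains_mem[OF cont_ad_var[OF I] F, of w] by (auto simp: cont_def)
    then obtain t where t: "\<And>w a. a \<in> ?I (t w) \<Longrightarrow> F w a = 0" by metis
    have fin: "finite {w :: bool list. length w = length vs}"
      using finite_lists_length_eq[of "UNIV :: bool set"] by simp
    define T where "T = Max (t ` {w. length w = length vs})"
    have "F w (a * p) = 0" if a: "a \<in> ?I T" for w a p
    proof (cases "length w = length vs")
      case True
      then have "t w \<le> T" unfolding T_def using fin by simp
      then have "a \<in> ?I (t w)" using filtrationD(2)[OF I] a by blast
      moreover have "a \<in> polys ?V" using poly_idealD(1)[OF filtrationD(1)[OF I] a] .
      ultimately show ?thesis
        using t[of "a * res ?V p" w] poly_idealD(4)[OF filtrationD(1)[OF I] res_polys, of a "t w" p]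
          homsD(3)[OF koszul_homs_mem[OF Fh], of w "a * p"] by (simp add: res_mult mult.commute)
    next
      case False
      then show ?thesis using F by (auto simp: koszul_cochains_def)
    qed
    then have "\<forall>a\<in>?I T. (\<lambda>w p. F w (a * p)) = 0" by (simp add: fun_eq_iff)
    then show "F \<in> koszul_homs vs i \<and> (\<exists>t. \<forall>a\<in>?I t. (\<lambda>w p. F w (a * p)) = 0)" using Fh by blast
  qed
  show ?thesis
  proof (intro Set.set_eqI iffI)
    fix S assume "S \<in> carrier (torsion_submodule (polynomial_ring ?V) J (koszul_module vs i))"
    then obtain F t where F: "F \<in> koszul_homs vs i" "S = encode F"
      and t: "\<forall>a\<in>?I t. encode (\<lambda>w p. decode S w (a * p)) = encode 0"
      unfolding torsion_submodule_carrier koszul_module_simps by blast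
    then have "\<forall>a\<in>?I t. (\<lambda>w p. F w (a * p)) = 0" by simp
    then show "S \<in> encode ` koszul_cochains (cont ?V ?V ?I) vs i" using key[of F] F by blast
  next
    fix S assume "S \<in> encode ` koszul_cochains (cont ?V ?V ?I) vs i"
    then obtain F where F: "F \<in> koszul_cochains (cont ?V ?V ?I) vs i" "S = encode F" by blast
    then obtain t where "F \<in> koszul_homs vs i" "\<forall>a\<in>?I t. (\<lambda>w p. F w (a * p)) = 0" using key[of F] by blast
    then have "S \<in> encode ` koszul_homs vs i" "\<forall>a\<in>?I t. encode (\<lambda>w p. decode S w (a * p)) = encode 0"
      using F(2) by simp_all
    then show "S \<in> carrier (torsion_submodule (polynomial_ring ?V) J (koszul_module vs i))"
      unfolding torsion_submodule_carrier koszul_module_simps by blast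
  qed
qed

lemma torsion_exact_koszul:
  assumes J: "ideal J (polynomial_ring (set vs))"
  shows "torsion_exact (polynomial_ring (set vs)) J (koszul_module vs) (\<lambda>i. koszul_map vs) i \<longleftrightarrow>
    (\<forall>F\<in>koszul_cochains (cont (set vs) (set vs) (ideal_powers (polynomial_ring (set vs)) J)) vs (Suc i).
       koszul_diff ad_var vs F = (\<lambda>w. 0) \<longrightarrow>
       (\<exists>G\<in>koszul_cochains (cont (set vs) (set vs) (ideal_powers (polynomial_ring (set vs)) J)) vs i.
          koszul_diff ad_var vs G = F))"
  unfolding torsion_exact_def torsion_koszul_module[OF J]
  by (simp add: koszul_map_def zero_fun_def eq_commute)

lemma torsion_exact_koszul_top:
  assumes "ideal J (polynomial_ring (set vs))" "length vs \<le> i"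
  shows "torsion_exact (polynomial_ring (set vs)) J (koszul_module vs) (\<lambda>i. koszul_map vs) i"
  unfolding torsion_exact_koszul[OF assms(1)]
proof (intro ballI impI)
  let ?X = "cont (set vs) (set vs) (ideal_powers (polynomial_ring (set vs)) J)"
  interpret commuting_operators ?X ad_var "set vs"
    by (rule cont_ad_var[OF ideal_powers_filtration[OF assms(1)]])
  fix F assume F: "F \<in> koszul_cochains ?X vs (Suc i)"
  have "F w = 0" for w
    using F weight_le_length[of w] assms(2) by (auto simp: koszul_cochains_def)
  then have "koszul_diff ad_var vs (\<lambda>w. 0) = F"
    using koszul_diff_zero[OF order_refl] by (simp add: fun_eq_iff)
  then show "\<exists>G\<in>koszul_cochains ?X vs i. koszul_diff ad_var vs G = F"
    using cochains_zero[OF zero_mem] by blast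
qed

text \<open>The coset of a torsion cocycle is the subgroup of torsion boundaries precisely when the
  cocycle lies in that subgroup. This links the module \<open>cohomology\<close> to the elementary
  condition used everywhere else.\<close>

lemma cohomology_trivial_iff:
  assumes E: "injective_resolution R M \<epsilon> E d" and J: "ideal J R"
  shows "carrier (cohomology (\<lambda>j. torsion_submodule R J (E j)) d (Suc i)) =
      {\<zero>\<^bsub>cohomology (\<lambda>j. torsion_submodule R J (E j)) d (Suc i)\<^esub>} \<longleftrightarrow> torsion_exact R J E d i"
proof -
  note D = injective_resolutionD[OF E]
  interpret E: Module.module R "E (Suc i)" by (rule D(2))
  interpret E': Module.module R "E i" by (rule D(2))
  let ?E = "E (Suc i)"
  define N where "N = d i ` carrier (torsion_submodule R J (E i))"
  define Z where "Z = {z \<in> carrier (torsion_submodule R J ?E). d (Suc i) z = \<zero>\<^bsub>E (Suc (Suc i))\<^esub>}"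
  have carr: "carrier (cohomology (\<lambda>j. torsion_submodule R J (E j)) d (Suc i)) =
      (\<lambda>z. (\<lambda>y. y \<oplus>\<^bsub>?E\<^esub> z) ` N) ` Z"
    by (auto simp: cohomology_def quotient_module_def A_RCOSETS_def' a_r_coset_def' a_kernel_def' N_def Z_def
        torsion_submodule_def)
  have zero: "\<zero>\<^bsub>cohomology (\<lambda>j. torsion_submodule R J (E j)) d (Suc i)\<^esub> = N"
    by (simp add: cohomology_def quotient_module_def N_def)
  have z0: "\<zero>\<^bsub>E j\<^esub> \<in> carrier (torsion_submodule R J (E j))" for j
  proof -
    interpret Ej: Module.module R "E j" by (rule D(2))
    have "a \<in> carrier R" if "a \<in> ideal_powers R J 0" for a using that by (simp add: ideal_powers_0)
    then show ?thesis unfolding torsion_submodule_carrier using Ej.smult_r_null by blast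
  qed
  have N_E: "N \<subseteq> carrier ?E"
    using module_homs_closed[OF D(4)] by (auto simp: N_def torsion_submodule_carrier)
  have N0: "\<zero>\<^bsub>?E\<^esub> \<in> N"
    using module_homs_zero[OF D(2,2,4)] z0 unfolding N_def by (metis image_eqI)
  have N_minus: "x \<ominus>\<^bsub>?E\<^esub> y \<in> N" if xy: "x \<in> N" "y \<in> N" for x y
  proof -
    obtain a b where ab: "a \<in> carrier (torsion_submodule R J (E i))" "b \<in> carrier (torsion_submodule R J (E i))"
      "x = d i a" "y = d i b" using xy unfolding N_def by blast
    then have "x \<ominus>\<^bsub>?E\<^esub> y = d i (a \<ominus>\<^bsub>E i\<^esub> b)"
      using module_homs_minus[OF D(2,2,4)] by (simp add: torsion_submodule_carrier)
    then show ?thesis using torsion_submodule_minus[OF D(2) J ab(1,2)] by (simp add: N_def)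
  qed
  let ?c = "\<lambda>z. (\<lambda>y. y \<oplus>\<^bsub>?E\<^esub> z) ` N"
  have "?c ` Z = {N} \<longleftrightarrow> Z \<subseteq> N"
  proof
    assume eq: "?c ` Z = {N}"
    show "Z \<subseteq> N"
    proof
      fix z assume z: "z \<in> Z"
      then have "z \<in> carrier ?E" by (simp add: Z_def torsion_submodule_carrier)
      then have "z \<in> (\<lambda>y. y \<oplus>\<^bsub>?E\<^esub> z) ` N" using N0 by (intro image_eqI[of _ _ "\<zero>\<^bsub>?E\<^esub>"]) auto
      moreover have "?c z \<in> ?c ` Z" using z by (rule imageI)
      then have "?c z = N" unfolding eq by simp
      ultimately show "z \<in> N" by simp
    qed
  next
    assume sub: "Z \<subseteq> N"
    have c_eq: "?c z = N" if z: "z \<in> N" for z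
    proof -
      have zE: "z \<in> carrier ?E" using z N_E by blast
      have nz: "\<ominus>\<^bsub>?E\<^esub> z \<in> N" using N_minus[OF N0 z] zE by (simp add: a_minus_def)
      have "y \<oplus>\<^bsub>?E\<^esub> z \<in> N" if "y \<in> N" for y
        using N_minus[OF that nz] zE by (simp add: a_minus_def)
      moreover have "y \<in> (\<lambda>y. y \<oplus>\<^bsub>?E\<^esub> z) ` N" if y: "y \<in> N" for y
      proof (rule image_eqI)
        show "y \<ominus>\<^bsub>?E\<^esub> z \<in> N" by (rule N_minus[OF y z])
        show "y = (y \<ominus>\<^bsub>?E\<^esub> z) \<oplus>\<^bsub>?E\<^esub> z"
          using y zE N_E by (auto simp: a_minus_def E.M.a_assoc E.M.l_neg)
      qed
      ultimately show ?thesis by blast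
    qed
    have zero_Z: "\<zero>\<^bsub>?E\<^esub> \<in> Z"
      using z0 module_homs_zero[OF D(2,2,4)] by (simp add: Z_def)
    have "?c ` Z = (\<lambda>z. N) ` Z" by (rule image_cong[OF refl c_eq]) (use sub in blast)
    then show "?c ` Z = {N}" using image_constant[OF zero_Z] by simp
  qed
  also have "Z \<subseteq> N \<longleftrightarrow> torsion_exact R J E d i"
    unfolding torsion_exact_def Z_def N_def by blast
  finally show ?thesis unfolding carr zero .
qed

text \<open>\<open>Max\<close> is meaningful on a finite set of degrees; finiteness comes from the
  Koszul resolution, whose length is the number of variables. A failure of
  \<open>koszul_vanishing\<close> then exhibits a nonzero degree that is at least
  \<open>N\<close>.\<close>

theorem cohomological_dimension_ge:
  assumes vs: "distinct vs" and J: "ideal J (polynomial_ring (set vs) :: ('v, 'k::field) mpoly ring)"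
    and van: "\<not> koszul_vanishing (set vs) (ideal_powers (polynomial_ring (set vs)) J) vs N"
  shows "N \<le> cohomological_dimension (polynomial_ring (set vs)) J"
proof -
  let ?R = "polynomial_ring (set vs) :: ('v, 'k) mpoly ring"
  let ?M = "regular_module ?R"
  have M: "Module.module ?R ?M" by (rule module_regular_module[OF cring_polynomial_ring])
  have K: "injective_resolution ?R ?M (koszul_augmentation vs) (koszul_module vs) (\<lambda>i. koszul_map vs)"
    by (rule koszul_resolution[OF vs])
  obtain E d where Ed: "some_injective_resolution ?R ?M = (E, d)" by fastforce
  \<comment> \<open>The chosen pair is a resolution because the Koszul resolution is a witness of
    the required type.\<close>
  let ?P = "\<lambda>(E :: nat \<Rightarrow> (('v, 'k) mpoly, (nat \<times> ('v, 'k) mpoly \<times> ('v, 'k) mpoly) set) module, d).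
    \<exists>\<epsilon>. injective_resolution ?R ?M \<epsilon> E d"
  have "?P (koszul_module vs, \<lambda>i. koszul_map vs)" using K by auto
  then have "?P (Eps ?P)" by (rule someI)
  moreover have "Eps ?P = (E, d)" using Ed by (simp add: some_injective_resolution_def)
  ultimately obtain \<epsilon> where E: "injective_resolution ?R ?M \<epsilon> E d" by auto
  let ?H = "local_cohomology ?R J ?M"
  have H: "carrier (?H (Suc i)) = {\<zero>\<^bsub>?H (Suc i)\<^esub>} \<longleftrightarrow>
      torsion_exact ?R J (koszul_module vs) (\<lambda>i. koszul_map vs) i" for i
    using cohomology_trivial_iff[OF E J, of i] torsion_exact_independent[OF M J E K]
      torsion_exact_independent[OF M J K E] by (auto simp: local_cohomology_def Ed)
  have "{i. carrier (?H i) \<noteq> {\<zero>\<^bsub>?H i\<^esub>}} \<subseteq> {..length vs}"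
  proof
    fix i assume i: "i \<in> {i. carrier (?H i) \<noteq> {\<zero>\<^bsub>?H i\<^esub>}}"
    show "i \<in> {..length vs}"
    proof (rule ccontr)
      assume "i \<notin> {..length vs}"
      then obtain j where "i = Suc j" "length vs \<le> j" by (cases i) auto
      then show False using i H torsion_exact_koszul_top[OF J] by auto
    qed
  qed
  then have fin: "finite {i. carrier (?H i) \<noteq> {\<zero>\<^bsub>?H i\<^esub>}}" using finite_subset by blast
  obtain i where i: "N \<le> Suc i" "\<not> torsion_exact ?R J (koszul_module vs) (\<lambda>i. koszul_map vs) i"
    using van unfolding koszul_vanishing_def torsion_exact_koszul[OF J] by blast
  then have "Suc i \<in> {i. carrier (?H i) \<noteq> {\<zero>\<^bsub>?H i\<^esub>}}" using H by simp
  then have "Suc i \<le> cohomological_dimension ?R J"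
    unfolding cohomological_dimension_def using fin by (intro Max_ge) auto
  then show ?thesis using i(1) by simp
qed

section \<open>A nonvanishing class\<close>

text \<open>Used as a constant filtration: its continuous maps are those vanishing on monomials of
  weight at least \<open>s\<close> (\<open>cont_weight_iff\<close>). For the total degree in
  finitely many variables these maps have finite rank and hence a trace.\<close>

definition weight_ideal :: "'v set \<Rightarrow> ('v \<Rightarrow> nat) \<Rightarrow> nat \<Rightarrow> ('v, 'k::field) mpoly set" where
  "weight_ideal V w s = {p \<in> polys V. \<forall>t\<in>keys p. s \<le> wdeg w t}"

lemma poly_ideal_weight_ideal: "poly_ideal V (weight_ideal V w s :: ('v, 'k::field) mpoly set)"
  unfolding poly_ideal_def
proof (intro conjI ballI)
  fix p q :: "('v, 'k) mpoly" assume "p \<in> weight_ideal V w s" "q \<in> weight_ideal V w s"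
  then show "p + q \<in> weight_ideal V w s"
    using Poly_Mapping.keys_add[of p q] by (auto simp: weight_ideal_def)
next
  fix a p :: "('v, 'k) mpoly" assume a: "a \<in> polys V" and p: "p \<in> weight_ideal V w s"
  have "s \<le> wdeg w t" if t: "t \<in> keys (a * p)" for t
  proof -
    obtain t1 t2 where "t = t1 + t2" "t2 \<in> keys p" using t keys_mult[of a p] by auto
    then show ?thesis using p by (auto simp: weight_ideal_def)
  qed
  then show "a * p \<in> weight_ideal V w s" using a p by (simp add: weight_ideal_def)
qed (auto simp: weight_ideal_def)

lemma weight_filtration: "filtration V (\<lambda>t. weight_ideal V w s)"
  by (simp add: filtration_def poly_ideal_weight_ideal)

lemma klinear_vanish:
  assumes "klinear F" "\<And>t. t \<in> keys p \<Longrightarrow> F (monomial t) = 0"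
  shows "F p = 0"
proof -
  have "F p = (\<Sum>t\<in>keys p. F (single t (lookup p t)))"
    using klinear_sum[OF assms(1)] poly_sum_singles[of p] by metis
  also have "\<dots> = 0"
  proof (rule sum.neutral, rule ballI)
    fix t assume "t \<in> keys p"
    then show "F (single t (lookup p t)) = 0"
      using klinear_single[OF assms(1), of t "lookup p t"] assms(2) by simp
  qed
  finally show ?thesis .
qed

lemma cont_weight_iff:
  "F \<in> cont V W (\<lambda>t. weight_ideal V w s) \<longleftrightarrow>
     F \<in> homs V W \<and> (\<forall>t. keys t \<subseteq> V \<longrightarrow> s \<le> wdeg w t \<longrightarrow> F (monomial t) = 0)"
proof
  assume "F \<in> cont V W (\<lambda>t. weight_ideal V w s)"
  then show "F \<in> homs V W \<and> (\<forall>t. keys t \<subseteq> V \<longrightarrow> s \<le> wdeg w t \<longrightarrow> F (monomial t) = 0)"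
    by (auto simp: cont_def weight_ideal_def polys_single)
next
  assume F: "F \<in> homs V W \<and> (\<forall>t. keys t \<subseteq> V \<longrightarrow> s \<le> wdeg w t \<longrightarrow> F (monomial t) = 0)"
  then have lin: "klinear F" using homsD(1) by blast
  have "F p = 0" if "p \<in> weight_ideal V w s" for p
    by (rule klinear_vanish[OF lin]) (use that F in \<open>auto simp: weight_ideal_def polys_iff\<close>)
  then show "F \<in> cont V W (\<lambda>t. weight_ideal V w s)" using F by (auto simp: cont_def)
qed

lemma lookup_single_mult:
  fixes q :: "('v, 'k::field) mpoly"
  shows "lookup (single u c * q) (u + r) = c * lookup q r"
proof (induction q rule: poly_induct)
  case (single t d)
  then show ?case by (simp add: mult_single lookup_single when_def)
qed (simp_all add: algebra_simps lookup_add)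

lemma lookup_single_mult_0:
  fixes q :: "('v, 'k::field) mpoly"
  assumes "\<nexists>r. t = u + r"
  shows "lookup (single u c * q) t = 0"
proof (rule ccontr)
  assume "lookup (single u c * q) t \<noteq> 0"
  then have "t \<in> keys (single u c * q)" by (simp add: in_keys_iff)
  then show False using keys_mult[of "single u c" q] assms by (auto split: if_splits)
qed

section \<open>Traces of maps of finite rank\<close>

lemma finite_monomials:
  assumes "finite V"
  shows "finite {t :: 'v \<Rightarrow>\<^sub>0 nat. keys t \<subseteq> V \<and> wdeg (\<lambda>v. 1) t < d}"
proof -
  let ?T = "{t :: 'v \<Rightarrow>\<^sub>0 nat. keys t \<subseteq> V \<and> wdeg (\<lambda>v. 1) t < d}"
  have "lookup t v \<le> d" if "wdeg (\<lambda>v. 1) t < d" for t :: "'v \<Rightarrow>\<^sub>0 nat" and v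
  proof -
    have "t = single v (lookup t v) + (t - single v (lookup t v))"
      by (rule poly_mapping_eqI) (simp add: lookup_add lookup_minus lookup_single when_def)
    then have "wdeg (\<lambda>v. 1) t = lookup t v + wdeg (\<lambda>v. 1) (t - single v (lookup t v))"
      using wdeg_add[of "\<lambda>v. 1" "single v (lookup t v)" "t - single v (lookup t v)"] by simp
    then show ?thesis using that by linarith
  qed
  then have "lookup ` ?T \<subseteq> {f. \<forall>v. (v \<in> V \<longrightarrow> f v \<in> {..d}) \<and> (v \<notin> V \<longrightarrow> f v = 0)}"
    by (auto simp: in_keys_iff)
  moreover have "finite {f. \<forall>v. (v \<in> V \<longrightarrow> f v \<in> {..d}) \<and> (v \<notin> V \<longrightarrow> f v = (0 :: nat))}"
    by (rule finite_set_of_finite_funs) (use assms in auto)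
  ultimately have "finite (lookup ` ?T)" by (rule finite_subset)
  then show ?thesis by (rule finite_imageD) (simp add: inj_on_def)
qed

text \<open>For a map that vanishes on the monomials of degree at least \<open>d\<close>, this is
  its trace in the monomial basis.\<close>

definition trace_below :: "'v set \<Rightarrow> nat \<Rightarrow> (('v, 'k::field) mpoly \<Rightarrow> ('v, 'k) mpoly) \<Rightarrow> 'k" where
  "trace_below V d F = (\<Sum>t | keys t \<subseteq> V \<and> wdeg (\<lambda>v. 1) t < d. lookup (F (monomial t)) t)"

lemma trace_below_diff: "trace_below V d (F - G) = trace_below V d F - trace_below V d G"
  by (simp add: trace_below_def lookup_minus sum_subtractf)

text \<open>The identity tr(a F) = tr(F a), proved for a single term of the polynomial by shifting
  the summation index by its exponent \<open>u\<close>.\<close>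

lemma trace_below_ad:
  assumes V: "finite V" and \<xi>: "\<xi> \<in> polys V"
    and F: "F \<in> cont V V (\<lambda>t. weight_ideal V (\<lambda>v. 1) d)"
  shows "trace_below V d (ad \<xi> \<xi> F) = 0"
proof -
  let ?T = "{t :: 'a \<Rightarrow>\<^sub>0 nat. keys t \<subseteq> V \<and> wdeg (\<lambda>v. 1) t < d}"
  have F_homs: "F \<in> homs V V" and F_high: "\<And>t. keys t \<subseteq> V \<Longrightarrow> d \<le> wdeg (\<lambda>v. 1) t \<Longrightarrow> F (monomial t) = 0"
    using F by (auto simp: cont_weight_iff)
  have F_low: "wdeg (\<lambda>v. 1) (u + r) < d"
    if "lookup (F (monomial (u + r))) r \<noteq> 0" "keys (u + r) \<subseteq> V" for u r
    using F_high[OF that(2)] that(1) by (cases "d \<le> wdeg (\<lambda>v. 1) (u + r)") auto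
  note lin = homsD(1)[OF F_homs]
  have fin: "finite ?T" by (rule finite_monomials[OF V])
  show ?thesis
    unfolding trace_below_def ad_def
    using \<xi>
  proof (induction \<xi> rule: polys_induct)
    case (single u c)
    have "(\<Sum>t\<in>?T. lookup (single u c * F (monomial t)) t) =
        (\<Sum>t\<in>{t\<in>?T. \<exists>r. t = u + r}. lookup (single u c * F (monomial t)) t)"
      by (rule sum.mono_neutral_right[OF fin]) (auto simp: lookup_single_mult_0)
    also have "\<dots> = (\<Sum>r\<in>{r\<in>?T. u + r \<in> ?T}. c * lookup (F (monomial (u + r))) r)"
      by (rule sum.reindex_bij_witness[of _ "\<lambda>r. u + r" "\<lambda>t. t - u"])
        (auto simp: lookup_single_mult keys_add_nat)
    \<comment> \<open>On the added indices u + r has degree at least \<open>d\<close>, where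
      \<open>F\<close> vanishes, so the truncation leaves no boundary contribution.\<close>
    also have "\<dots> = (\<Sum>r\<in>?T. c * lookup (F (monomial (u + r))) r)"
      by (rule sum.mono_neutral_left[OF fin]) (use F_low single in \<open>auto simp: keys_add_nat\<close>)
    also have "\<dots> = (\<Sum>r\<in>?T. lookup (F (single u c * monomial r)) r)"
    proof (rule sum.cong[OF refl])
      fix r
      show "c * lookup (F (monomial (u + r))) r = lookup (F (single u c * monomial r)) r"
        using klinear_single[OF lin, of "u + r" c] lookup_single_mult[of 0 c "F (monomial (u + r))" r]
        by (simp add: mult_single)
    qed
    finally show ?case by (simp add: lookup_minus sum_subtractf)
  next
    case (add p q)
    then show ?case
      by (simp add: ring_distribs klinear_add[OF lin] lookup_minus lookup_add sum.distrib sum_subtractf)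
  qed (simp add: klinear_zero[OF lin])
qed

text \<open>All other variables are set to 0, and then p goes to (p - p(0)) / x_v.\<close>

definition divided_difference :: "'v \<Rightarrow> ('v, 'k::field) mpoly \<Rightarrow> ('v, 'k) mpoly" where
  "divided_difference v = lext (\<lambda>t. if keys t = {v} then monomial (single v (lookup t v - 1)) else 0)"

definition constant_term :: "('v, 'k::field) mpoly \<Rightarrow> ('v, 'k) mpoly" where
  "constant_term = lext (\<lambda>t. if t = 0 then 1 else 0)"

definition line :: "'v \<Rightarrow> ('v, 'k::field) mpoly \<Rightarrow> ('v, 'k) mpoly" where
  "line v = subst (\<lambda>u. if u = v then variable v else 0)"

lemma divided_difference_klinear: "klinear (divided_difference v)"
  by (simp add: divided_difference_def)

lemma divided_difference_monomial:
  "divided_difference v (monomial t) = (if keys t = {v} then monomial (single v (lookup t v - 1)) else 0)"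
  by (simp add: divided_difference_def)

lemma constant_term_monomial: "constant_term (monomial t) = (if t = 0 then 1 else 0)"
  by (simp add: constant_term_def)

lemma divided_difference_homs: "v \<in> V \<Longrightarrow> divided_difference v \<in> homs V V"
  unfolding divided_difference_def by (rule homs_lext) (auto simp: polys_single)

lemma constant_term_homs: "constant_term \<in> homs V V"
  unfolding constant_term_def by (rule homs_lext) auto

lemma ad_divided_difference:
  fixes c :: "'k::field"
  assumes v: "v \<in> V"
  shows "ad (variable v + const c) (variable v + const c) (divided_difference v) = - constant_term"
proof (rule homs_eqI[of _ V V])
  have dd: "(divided_difference v :: ('a, 'k) mpoly \<Rightarrow> _) \<in> homs V V" by (rule divided_difference_homs[OF v])
  show "ad (variable v + const c) (variable v + const c) (divided_difference v) \<in> homs V V"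
    by (rule ad_homs[OF dd]) (use v in auto)
  show "(- constant_term :: ('a, 'k) mpoly \<Rightarrow> _) \<in> homs V V"
    using homs_diff[OF homs_0 constant_term_homs] by (simp add: fun_Compl_def)
  fix t :: "'a \<Rightarrow>\<^sub>0 nat"
  have *: "variable v * divided_difference v (monomial t) - divided_difference v (variable v * monomial t) =
      (- constant_term (monomial t) :: ('a, 'k) mpoly)"
  proof (cases "keys t \<subseteq> {v}")
    case True
    have 1: "keys (single v 1 + t) = {v}" using True by (auto simp: keys_add_nat)
    have l: "lookup (single v 1 + t) v - 1 = lookup t v" by (simp add: lookup_add)
    show ?thesis
    proof (cases "t = 0")
      case True
      have "keys t \<noteq> {v}" using True by simp
      then show ?thesis
        unfolding variable_mult_monomial divided_difference_monomial constant_term_monomial 1 l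
        using True by simp
    next
      case False
      then have k: "keys t = {v}"
        using \<open>keys t \<subseteq> {v}\<close> keys_eq_empty[of t] by (simp add: subset_singleton_iff)
      then have "0 < lookup t v" by (auto simp: in_keys_iff set_eq_iff)
      then have "single v 1 + single v (lookup t v - 1) = single v (lookup t v)"
        by (simp flip: single_add)
      then show ?thesis
        unfolding variable_mult_monomial divided_difference_monomial constant_term_monomial 1 l
        using False k by (simp only: if_True if_False refl variable_mult_monomial) simp
    qed
  next
    case False
    then have "keys (single v 1 + t) \<noteq> {v}" "keys t \<noteq> {v}" "t \<noteq> 0" by (auto simp: keys_add_nat)
    then show ?thesis
      unfolding variable_mult_monomial divided_difference_monomial constant_term_monomial by simp
  qed
  have "ad (variable v + const c) (variable v + const c) (divided_difference v) (monomial t) =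
      variable v * divided_difference v (monomial t) - divided_difference v (variable v * monomial t)"
    unfolding ad_def distrib_right klinear_add[OF divided_difference_klinear]
      klinear_scale[OF divided_difference_klinear] by simp
  then show "ad (variable v + const c) (variable v + const c) (divided_difference v) (monomial t) =
      (- constant_term) (monomial t)"
    unfolding * by simp
qed

text \<open>The divided difference sees only the restriction to the axis. It therefore kills every
  polynomial vanishing there, which makes it continuous.\<close>

lemma divided_difference_line:
  fixes p :: "('v, 'k::field) mpoly"
  shows "divided_difference v p = divided_difference v (line v p)"
proof -
  have "(divided_difference v :: ('v, 'k) mpoly \<Rightarrow> _) = (\<lambda>p. divided_difference v (line v p))"
  proof (rule klinear_eqI)
    show "klinear (divided_difference v :: ('v, 'k) mpoly \<Rightarrow> _)" by (rule divided_difference_klinear)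
    show "klinear (\<lambda>p. divided_difference v (line v p) :: ('v, 'k) mpoly)"
      by (rule klinear_comp[OF divided_difference_klinear]) (simp add: line_def)
    fix t :: "'v \<Rightarrow>\<^sub>0 nat"
    show "divided_difference v (monomial t) = (divided_difference v (line v (monomial t)) :: ('v, 'k) mpoly)"
    proof (cases "keys t \<subseteq> {v}")
      case True
      then have "line v (monomial t) = (monomial t :: ('v, 'k) mpoly)"
        by (intro algebra_hom_eq_on[of "line v" "\<lambda>p. p" "{v}" "monomial t :: ('v, 'k) mpoly"])
          (simp_all add: line_def algebra_hom_id polys_single)
      then show ?thesis by simp
    next
      case False
      then obtain u where u: "u \<in> keys t" "u \<noteq> v" by auto
      obtain s where s: "t = single u 1 + s" using monomial_split[OF u(1)] ..
      have "line v (monomial t) = (0 :: ('v, 'k) mpoly)"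
        unfolding s variable_mult_monomial[symmetric] line_def
        using u(2) by (simp add: algebra_homD(3)[OF subst_algebra_hom])
      moreover have "divided_difference v (monomial t) = (0 :: ('v, 'k) mpoly)"
        using u by (auto simp: divided_difference_monomial)
      ultimately show ?thesis by (simp add: klinear_zero[OF divided_difference_klinear])
    qed
  qed
  then show ?thesis by (rule fun_cong)
qed

definition cochain_delta :: "bool list \<Rightarrow> 'x \<Rightarrow> bool list \<Rightarrow> 'x::zero" where
  "cochain_delta w0 x w = (if w = w0 then x else 0)"

lemma cochain_delta_cochains:
  "x \<in> X \<Longrightarrow> 0 \<in> X \<Longrightarrow> length w0 = length us \<Longrightarrow> weight w0 = i \<Longrightarrow> cochain_delta w0 x \<in> koszul_cochains X us i"
  by (auto simp: koszul_cochains_def cochain_delta_def)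

lemma weight_replicate_True [simp]: "weight (replicate k True) = k"
  by (induction k) auto

lemma weight_eq_length: "weight w = length w \<Longrightarrow> w = replicate (length w) True"
proof (induction w)
  case (Cons b w)
  then show ?case using weight_le_length[of w] by (cases b) auto
qed simp

text \<open>
  The Mayer-Vietoris connecting map in explicit form: the coordinate lines of \<open>v\<close> and \<open>u\<close> lie in
  different pieces of the zero set.  The weights \<open>a\<close> and \<open>b\<close> measure the order of vanishing
  on these pieces, and the trace detects the image of the class in the top local cohomology at the origin.
\<close>

theorem koszul_nonvanishing:
  fixes J :: "nat \<Rightarrow> ('v, 'k::field) mpoly set"
  assumes vs: "vs = v # u # ws" "set vs = V"
    and J: "filtration V J"
    and \<xi>: "\<And>x. x \<in> V \<Longrightarrow> \<xi> x \<in> polys V" "\<xi> v = variable v + const c" "\<xi> u = variable u + const c'"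
    and ab: "\<And>x. x \<in> V \<Longrightarrow> 1 \<le> a x + b x" "a v = 0" "b u = 0"
    and J_mono: "\<And>s t. keys t \<subseteq> V \<Longrightarrow> s \<le> wdeg a t \<Longrightarrow> s \<le> wdeg b t \<Longrightarrow> monomial t \<in> J s"
    and lines: "\<And>p. p \<in> J 1 \<Longrightarrow> line v p = 0" "\<And>p. p \<in> J 1 \<Longrightarrow> line u p = 0"
  shows "\<exists>F\<in>koszul_cochains (cont V V J) vs (Suc (length ws)).
    koszul_diff (\<lambda>x. ad (\<xi> x) (\<xi> x)) vs F = (\<lambda>w. 0) \<and>
    \<not> (\<exists>G\<in>koszul_cochains (cont V V J) vs (length ws). koszul_diff (\<lambda>x. ad (\<xi> x) (\<xi> x)) vs G = F)"
proof -
  let ?D = "\<lambda>x. ad (\<xi> x) (\<xi> x)"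
  define m where "m = length ws"
  have V: "finite V" "v \<in> V" "u \<in> V" using vs by auto
  let ?X = "cont V V J"
  have ops: "commuting_operators (cont V V I) ?D V" if "filtration V I" for I
    by (rule cont_operators[OF that]) (use \<xi> in auto)
  interpret X: commuting_operators ?X ?D V by (rule ops[OF J])
  have vsV: "set vs \<subseteq> V" using vs by simp
  \<comment> \<open>Each of \<open>A\<close> and \<open>B\<close> has minus the constant-term map as
    the top entry of its differential, \<open>A\<close> through the commutator with x_v and
    \<open>B\<close> through that with x_u; the sign in \<open>B\<close> compensates that of the
    cone. Hence \<open>F\<close> is a cocycle.\<close>
  define A where "A = cochain_delta (False # replicate (Suc m) True) (divided_difference v :: ('v, 'k) mpoly \<Rightarrow> _)"
  define B where "B = cochain_delta (True # False # replicate m True) (- divided_difference u :: ('v, 'k) mpoly \<Rightarrow> _)"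
  define F where "F w = A w - B w" for w
  let ?one = "replicate (length vs) True"
  have one: "?one = True # True # replicate m True" by (simp add: vs m_def)
  have uminus_homs: "- H \<in> homs V V" if "H \<in> homs V V" for H :: "('v, 'k) mpoly \<Rightarrow> ('v, 'k) mpoly"
    using homs_diff[OF homs_0 that] by (simp add: fun_Compl_def)
  have dd: "divided_difference x \<in> ?X" if x: "x \<in> {v, u}" for x
  proof -
    have "divided_difference x p = 0" if p: "p \<in> J 1" for p
    proof -
      have "line x p = 0" using lines[OF p] x by auto
      then show ?thesis by (subst divided_difference_line) (simp add: klinear_zero[OF divided_difference_klinear])
    qed
    then show ?thesis using divided_difference_homs[of x V] V x by (auto simp: cont_def)
  qed
  have dd': "- divided_difference u \<in> ?X"
    using X.diff_mem[OF X.zero_mem dd[of u]] by simp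
  have A: "A \<in> koszul_cochains ?X vs (Suc m)" and B: "B \<in> koszul_cochains ?X vs (Suc m)"
    unfolding A_def B_def using dd dd' X.zero_mem
    by (intro cochain_delta_cochains; simp add: vs m_def)+
  have F: "F \<in> koszul_cochains ?X vs (Suc m)"
    unfolding F_def by (rule cochains_diff[OF A B X.diff_mem])
  have delta_0: "(\<lambda>w. cochain_delta (b' # w0) x (b'' # w)) = (\<lambda>w. 0)" if "b' \<noteq> b''" for b' b'' w0 and x :: "'x::zero"
    using that by (auto simp: cochain_delta_def)
  have delta_1: "(\<lambda>w. cochain_delta (b' # w0) x (b' # w)) = cochain_delta w0 x" for b' w0 and x :: "'x::zero"
    by (auto simp: cochain_delta_def)
  have wsV: "set ws \<subseteq> V" "set (u # ws) \<subseteq> V" using vs by auto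
  have z: "koszul_diff ?D us (\<lambda>w. 0) w = 0" if "set us \<subseteq> V" for us w
    by (rule X.koszul_diff_zero[OF that])
  have ad_v: "?D v (divided_difference v) = - constant_term" and ad_u: "?D u (divided_difference u) = - constant_term"
    using ad_divided_difference[OF V(2), of c] ad_divided_difference[OF V(3), of c'] \<xi>(2,3) by simp_all
  have dA: "koszul_diff ?D vs A ?one = - constant_term"
    unfolding one unfolding A_def vs(1)
    by (simp add: delta_0 z[OF wsV(1)] z[OF wsV(2), simplified] X.op_zero[OF V(2)] X.op_zero[OF V(3)] ad_v cochain_delta_def)
  have ad_uminus: "?D x (- H) = - ?D x H" for x H
    by (simp add: ad_def fun_eq_iff)
  have dB: "koszul_diff ?D vs B ?one = - constant_term"
    unfolding one unfolding B_def vs(1)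
    by (simp add: delta_0 delta_1 z[OF wsV(1)] X.op_zero[OF V(2)] X.op_zero[OF V(3)] cochain_delta_def ad_uminus ad_u)
  have dF: "koszul_diff ?D vs F = (\<lambda>w. 0)"
  proof
    fix w
    have dF_mem: "koszul_diff ?D vs F \<in> koszul_cochains ?X vs (Suc (Suc m))"
      by (rule X.koszul_diff_cochains[OF vsV F])
    show "koszul_diff ?D vs F w = 0"
    proof (cases "length w = length vs \<and> weight w = Suc (Suc m)")
      case True
      then have "w = ?one" using weight_eq_length[of w] by (simp add: vs m_def)
      then show ?thesis
        using X.koszul_diff_diff[OF vsV, of A B w] X.cochains_mem[OF A] X.cochains_mem[OF B] dA dB
        unfolding F_def by simp
    next
      case False
      then show ?thesis
        using dF_mem[unfolded koszul_cochains_def mem_Collect_eq, THEN spec, of w] by (simp only: if_False)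
    qed
  qed
  have "koszul_diff ?D vs G \<noteq> F" if G: "G \<in> koszul_cochains ?X vs m" for G
  proof
    assume dG: "koszul_diff ?D vs G = F"
    have G_homs: "G w \<in> homs V V" for w using X.cochains_mem[OF G, of w] by (simp add: cont_def)
    have "\<exists>t. \<forall>p\<in>J t. G w p = 0" for w using X.cochains_mem[OF G, of w] by (auto simp: cont_def)
    then obtain t where t: "\<And>w p. p \<in> J (t w) \<Longrightarrow> G w p = 0" by metis
    have fin: "finite {w :: bool list. length w = length vs}"
      using finite_lists_length_eq[of "UNIV :: bool set"] by simp
    \<comment> \<open>One exponent for all words. The successor keeps \<open>s\<close> positive: the
      weights \<open>a\<close> and \<open>b\<close> vanish on the axes of \<open>v\<close> and
      \<open>u\<close>, and the trace has to count the monomial 1.\<close>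
    define s where "s = Suc (Max (t ` {w. length w = length vs}))"
    have G_kill: "G w p = 0" if p: "p \<in> J s" for w p
    proof (cases "length w = length vs")
      case True
      then have "t w \<le> s" unfolding s_def using fin by (simp add: le_SucI)
      then show ?thesis using t filtrationD(2)[OF J] p by blast
    next
      case False
      then show ?thesis using G by (auto simp: koszul_cochains_def)
    qed
    let ?KA = "cont V V (\<lambda>t. weight_ideal V a s) :: (('v, 'k) mpoly \<Rightarrow> ('v, 'k) mpoly) set"
    let ?KB = "cont V V (\<lambda>t. weight_ideal V b s) :: (('v, 'k) mpoly \<Rightarrow> ('v, 'k) mpoly) set"
    let ?KC = "cont V V (\<lambda>t. weight_ideal V (\<lambda>v. 1) (2 * s)) :: (('v, 'k) mpoly \<Rightarrow> ('v, 'k) mpoly) set"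
    interpret KA: commuting_operators ?KA ?D V by (rule ops[OF weight_filtration])
    interpret KB: commuting_operators ?KB ?D V by (rule ops[OF weight_filtration])
    interpret KC: commuting_operators ?KC ?D V by (rule ops[OF weight_filtration])
    interpret Ho: commuting_operators "homs V V :: (('v, 'k) mpoly \<Rightarrow> _) set" ?D V
      using ops[OF zero_filtration] by (simp add: cont_zero_filtration)
    \<comment> \<open>Splitting of the supposed primitive. \<open>GA\<close> keeps the monomials of
      a-weight below \<open>s\<close>; the rest \<open>GB\<close> vanishes once the b-weight reaches
      \<open>s\<close>, since monomials large in both weights lie in \<open>J s\<close>.\<close>
    define GA where "GA w = lext (\<lambda>t. if keys t \<subseteq> V \<and> wdeg a t < s then G w (monomial t) else 0)" for w
    define GB where "GB w = G w - GA w" for w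
    have GA_homs: "GA w \<in> homs V V" for w
      unfolding GA_def by (rule homs_lext) (use homsD(2)[OF G_homs] in auto)
    have GA: "GA w \<in> ?KA" for w
      unfolding cont_weight_iff using GA_homs by (simp add: GA_def)
    have GB_homs: "GB w \<in> homs V V" for w
      unfolding GB_def by (rule Ho.diff_mem[OF G_homs GA_homs])
    have GB: "GB w \<in> ?KB" for w
      unfolding cont_weight_iff using GB_homs J_mono G_kill by (auto simp: GB_def GA_def not_less)
    have wdeg_line: "wdeg f t = 0" if "keys t = {x}" "f x = 0" for f :: "'v \<Rightarrow> nat" and t x
      using that by (simp add: wdeg_def)
    have dd_v: "divided_difference v \<in> ?KA"
      unfolding cont_weight_iff using divided_difference_homs[OF V(2)] wdeg_line[of _ v a] ab
      by (auto simp: divided_difference_monomial s_def)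
    have "divided_difference u \<in> ?KB"
      unfolding cont_weight_iff using divided_difference_homs[OF V(3)] wdeg_line[of _ u b] ab
      by (auto simp: divided_difference_monomial s_def)
    then have dd_u: "- divided_difference u \<in> ?KB" using KB.diff_mem[OF KB.zero_mem] by force
    have A_mem: "A w \<in> ?KA" and B_mem: "B w \<in> ?KB" for w
      using dd_v dd_u KA.zero_mem KB.zero_mem by (auto simp: A_def B_def cochain_delta_def)
    have A_homs: "A w \<in> homs V V" for w using A_mem by (simp add: cont_def)
    \<comment> \<open>The cochain equals both A - d GA and B + d GB, so it vanishes on monomials
      large in either weight. Every variable has positive weight in one of the two gradings, so it
      vanishes from total degree 2 s on.\<close>
    define C where "C w = A w - koszul_diff ?D vs GA w" for w
    have C_KA: "C w \<in> ?KA" for w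
      unfolding C_def by (intro KA.diff_mem A_mem KA.koszul_diff_mem[OF vsV] GA)
    have "koszul_diff ?D vs GB w = koszul_diff ?D vs G w - koszul_diff ?D vs GA w" for w
      unfolding GB_def by (rule Ho.koszul_diff_diff[OF vsV G_homs GA_homs])
    then have C_eq: "C w = B w + koszul_diff ?D vs GB w" for w
      using dG by (simp add: C_def F_def)
    have C_KB: "C w \<in> ?KB" for w
      unfolding C_eq by (intro KB.add_mem B_mem KB.koszul_diff_mem[OF vsV] GB)
    have C: "C w \<in> ?KC" for w
      unfolding cont_weight_iff
    proof (intro conjI allI impI)
      show "C w \<in> homs V V" using C_KA by (simp add: cont_def)
      fix t :: "'v \<Rightarrow>\<^sub>0 nat" assume t: "keys t \<subseteq> V" "2 * s \<le> wdeg (\<lambda>v. 1) t"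
      have "wdeg (\<lambda>v. 1) t \<le> wdeg a t + wdeg b t"
        unfolding wdeg_def sum.distrib[symmetric]
      proof (rule sum_mono)
        fix x assume "x \<in> keys t"
        then have "1 * lookup t x \<le> (a x + b x) * lookup t x"
          using ab(1)[of x] t(1) by (intro mult_right_mono) auto
        then show "1 * lookup t x \<le> a x * lookup t x + b x * lookup t x" by (simp add: ring_distribs)
      qed
      then have "s \<le> wdeg a t \<or> s \<le> wdeg b t" using t(2) by linarith
      then show "C w (monomial t) = 0"
        using C_KA[of w] C_KB[of w] t(1) by (auto simp: cont_weight_iff)
    qed
    \<comment> \<open>The entries of a Koszul differential are signed sums of commutators, hence of
      trace 0, whereas the top entry for \<open>C\<close> is minus the constant-term map, of trace
      -1.\<close>
    have trace: "trace_below V (2 * s) (koszul_diff ?D us H w) = 0"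
      if "set us \<subseteq> V" "\<And>w. H w \<in> ?KC" for us H w
      using that
    proof (induction us arbitrary: H w)
      case (Cons x us)
      have 0: "trace_below V (2 * s) (0 :: ('v, 'k) mpoly \<Rightarrow> ('v, 'k) mpoly) = 0" by (simp add: trace_below_def)
      have "trace_below V (2 * s) (?D x (H w')) = 0" for w'
        by (rule trace_below_ad[OF V(1)]) (use Cons.prems \<xi>(1) in auto)
      then show ?case using Cons 0 by (auto simp: trace_below_diff split: list.split)
    qed (simp add: trace_below_def)
    have "koszul_diff ?D vs C ?one = koszul_diff ?D vs A ?one - koszul_diff ?D vs (koszul_diff ?D vs GA) ?one"
      unfolding C_def by (rule Ho.koszul_diff_diff[OF vsV A_homs Ho.koszul_diff_mem[OF vsV GA_homs]])
    moreover have "koszul_diff ?D vs (koszul_diff ?D vs GA) ?one = 0"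
      by (rule Ho.koszul_diff_koszul_diff[OF vsV GA_homs])
    ultimately have dC: "koszul_diff ?D vs C ?one = - constant_term"
      using dA by simp
    have "trace_below V (2 * s) (koszul_diff ?D vs C ?one) = 0"
      by (rule trace[OF vsV C])
    then have "trace_below V (2 * s) (- constant_term :: ('v, 'k) mpoly \<Rightarrow> ('v, 'k) mpoly) = 0"
      unfolding dC .
    moreover have "trace_below V (2 * s) (- constant_term :: ('v, 'k) mpoly \<Rightarrow> ('v, 'k) mpoly) = - 1"
    proof -
      let ?T = "{t :: 'v \<Rightarrow>\<^sub>0 nat. keys t \<subseteq> V \<and> wdeg (\<lambda>v. 1) t < 2 * s}"
      have "trace_below V (2 * s) (- constant_term :: ('v, 'k) mpoly \<Rightarrow> ('v, 'k) mpoly) =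
          (\<Sum>t\<in>?T. if t = 0 then - 1 else 0)"
        unfolding trace_below_def by (rule sum.cong) (auto simp: constant_term_monomial lookup_one)
      also have "\<dots> = - 1" using finite_monomials[OF V(1), of "2 * s"] by (simp add: s_def)
      finally show ?thesis .
    qed
    ultimately show False by simp
  qed
  then show ?thesis using F dF unfolding m_def by blast
qed

text \<open>Conjugation by the mutually inverse maps \<open>\<sigma>\<close> and
  \<open>\<tau>\<close> turns the commutator with x_v into the commutator with
  \<open>\<tau> (variable v)\<close>, and the filtration into its image.\<close>

lemma koszul_vanishing_coordinates:
  fixes I :: "nat \<Rightarrow> ('v, 'k::field) mpoly set"
  assumes I: "filtration V I" and vs: "set vs \<subseteq> V"
    and \<sigma>: "algebra_hom \<sigma>" "\<And>p. p \<in> polys V \<Longrightarrow> \<sigma> p \<in> polys V"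
    and \<tau>: "algebra_hom \<tau>" "\<And>p. p \<in> polys V \<Longrightarrow> \<tau> p \<in> polys V"
    and \<sigma>\<tau>: "\<And>p. p \<in> polys V \<Longrightarrow> \<sigma> (\<tau> p) = p" and \<tau>\<sigma>: "\<And>p. p \<in> polys V \<Longrightarrow> \<tau> (\<sigma> p) = p"
    and van: "koszul_vanishing V I vs N" and i: "N \<le> Suc i"
    and F: "F \<in> koszul_cochains (cont V V (\<lambda>t. \<tau> ` I t)) vs (Suc i)"
    and dF: "koszul_diff (\<lambda>v. ad (\<tau> (variable v)) (\<tau> (variable v))) vs F = (\<lambda>w. 0)"
  shows "\<exists>G\<in>koszul_cochains (cont V V (\<lambda>t. \<tau> ` I t)) vs i.
    koszul_diff (\<lambda>v. ad (\<tau> (variable v)) (\<tau> (variable v))) vs G = F"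
proof -
  let ?D = "\<lambda>v. ad (\<tau> (variable v)) (\<tau> (variable v))"
  let ?X = "cont V V I" and ?Y = "cont V V (\<lambda>t. \<tau> ` I t)"
  have I': "filtration V (\<lambda>t. \<tau> ` I t)"
  proof (rule filtration_image[OF I \<tau>])
    show "\<exists>p\<in>polys V. \<tau> p = q" if q: "q \<in> polys V" for q
      by (rule bexI[of _ "\<sigma> q"]) (simp_all add: \<tau>\<sigma>[OF q] \<sigma>(2)[OF q])
  qed auto
  interpret X: commuting_operators ?X ad_var V by (rule cont_ad_var[OF I])
  interpret Y: commuting_operators ?Y ?D V by (rule cont_operators[OF I']) (auto intro: \<tau>)
  note lin = algebra_homD(1)[OF \<sigma>(1)] algebra_homD(1)[OF \<tau>(1)]
  define S where "S H = (\<lambda>p. \<sigma> (H (\<tau> (res V p))))" for H :: "('v, 'k) mpoly \<Rightarrow> ('v, 'k) mpoly"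
  define T where "T H = (\<lambda>p. \<tau> (H (\<sigma> (res V p))))" for H :: "('v, 'k) mpoly \<Rightarrow> ('v, 'k) mpoly"
  have S_mem: "S H \<in> ?X" if H: "H \<in> ?Y" for H
  proof -
    have H': "H \<in> homs V V" using H by (simp add: cont_def)
    have "S H \<in> homs V V"
      using klinear_comp[OF lin(1) klinear_comp[OF homsD(1)[OF H'] klinear_comp[OF lin(2) res_klinear]]]
        homsD(2)[OF H'] \<sigma>(2) by (simp add: homs_def S_def res_id)
    moreover obtain t where t: "\<forall>p\<in>\<tau> ` I t. H p = 0" using H by (auto simp: cont_def)
    have "S H p = 0" if "p \<in> I t" for p
      using t that poly_idealD(1)[OF filtrationD(1)[OF I] that] by (simp add: S_def res_id klinear_zero[OF lin(1)])
    ultimately show ?thesis by (auto simp: cont_def)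
  qed
  have T_mem: "T H \<in> ?Y" if H: "H \<in> ?X" for H
  proof -
    have H': "H \<in> homs V V" using H by (simp add: cont_def)
    have "T H \<in> homs V V"
      using klinear_comp[OF lin(2) klinear_comp[OF homsD(1)[OF H'] klinear_comp[OF lin(1) res_klinear]]]
        homsD(2)[OF H'] \<tau>(2) by (simp add: homs_def T_def res_id)
    moreover obtain t where t: "\<forall>p\<in>I t. H p = 0" using H by (auto simp: cont_def)
    have "T H (\<tau> p) = 0" if "p \<in> I t" for p
    proof -
      have p: "p \<in> polys V" by (rule poly_idealD(1)[OF filtrationD(1)[OF I] that])
      then show ?thesis using t that \<tau>(2)[OF p] \<sigma>\<tau>[OF p] by (simp add: T_def res_id klinear_zero[OF lin(2)])
    qed
    ultimately show ?thesis by (auto simp: cont_def)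
  qed
  have S_0: "S 0 = 0" and T_0: "T 0 = 0"
    by (simp_all add: S_def T_def zero_fun_def klinear_zero[OF lin(1)] klinear_zero[OF lin(2)])
  have S_diff: "S (H - K) = S H - S K" and T_diff: "T (H - K) = T H - T K" for H K
    by (simp_all add: S_def T_def fun_eq_iff klinear_diff[OF lin(1)] klinear_diff[OF lin(2)])
  have S_ad: "S (?D v H) = ad_var v (S H)" if "v \<in> V" for v H
    using that \<sigma>\<tau>[of "variable v"]
    by (simp add: S_def ad_def fun_eq_iff klinear_diff[OF lin(1)] algebra_homD(3)[OF \<sigma>(1)] algebra_homD(3)[OF \<tau>(1)] res_mult)
  have T_ad: "T (ad_var v H) = ?D v (T H)" if "v \<in> V" for v H
    using that \<sigma>\<tau>[of "variable v"] \<tau>(2)[of "variable v"]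
    by (simp add: T_def ad_def fun_eq_iff klinear_diff[OF lin(2)] algebra_homD(3)[OF \<sigma>(1)] algebra_homD(3)[OF \<tau>(1)] res_mult)
  have TS: "T (S H) = H" if H: "H \<in> ?Y" for H
  proof
    fix p
    have H': "H \<in> homs V V" using H by (simp add: cont_def)
    show "T (S H) p = H p"
      using \<sigma>(2)[OF res_polys] \<tau>\<sigma>[OF res_polys] \<tau>\<sigma>[OF homsD(2)[OF H']] homsD(3)[OF H']
      by (simp add: T_def S_def res_id)
  qed
  have "(\<lambda>w. S (F w)) \<in> koszul_cochains ?X vs (Suc i)"
    by (rule cochains_map[where T = S, OF F S_mem S_0])
  moreover have "koszul_diff ad_var vs (\<lambda>w. S (F w)) w = 0" for w
    using Y.koszul_diff_map[OF vs, of F S ad_var w] Y.cochains_mem[OF F] S_ad S_diff dF S_0 vs by (simp add: subset_iff)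
  ultimately obtain G where G: "G \<in> koszul_cochains ?X vs i" "koszul_diff ad_var vs G = (\<lambda>w. S (F w))"
    using van i unfolding koszul_vanishing_def by blast
  have "(\<lambda>w. T (G w)) \<in> koszul_cochains ?Y vs i"
    by (rule cochains_map[where T = T, OF G(1) T_mem T_0])
  moreover have "koszul_diff ?D vs (\<lambda>w. T (G w)) w = F w" for w
    using X.koszul_diff_map[OF vs, of G T ?D w] X.cochains_mem[OF G(1)] T_ad T_diff G(2) vs
      TS[OF Y.cochains_mem[OF F]] by (simp add: subset_iff)
  ultimately show ?thesis by blast
qed

section \<open>Minimum vertex cuts\<close>

lemma connected_induce_iff:
  assumes "sym (parcs G)"
  shows "connected (with_proj G \<restriction> W) \<longleftrightarrow>
    W \<noteq> {} \<and> (\<forall>u\<in>W. \<forall>v\<in>W. (u, v) \<in> (parcs G \<inter> W \<times> W)\<^sup>*)"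
proof -
  let ?R = "parcs G \<inter> W \<times> W"
  have arcs: "parcs (mk_symmetric (with_proj G \<restriction> W)) = ?R"
    using assms by (auto simp: parcs_mk_symmetric sym_def)
  have "(u, v) \<in> rtrancl_on W ?R \<longleftrightarrow> (u, v) \<in> ?R\<^sup>*" if "u \<in> W" "v \<in> W" for u v
  proof
    show "(u, v) \<in> rtrancl_on W ?R \<Longrightarrow> (u, v) \<in> ?R\<^sup>*" by (rule rtrancl_on_rtranclI)
    show "(u, v) \<in> ?R\<^sup>* \<Longrightarrow> (u, v) \<in> rtrancl_on W ?R"
      by (rule rtrancl_consistent_rtrancl_on) (use that in auto)
  qed
  then show ?thesis
    unfolding connected_def strongly_connected_def reachable_def by (simp add: arcs)
qed

text \<open>A nonadjacent pair excludes connectivity \<open>card (pverts G) - 1\<close>, so the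
  failure of the next larger connectivity is witnessed by a cut \<open>T\<close>, which has exactly
  \<open>vertex_connectivity G\<close> vertices. Putting one vertex t of \<open>T\<close> back
  reconnects the graph, so t is adjacent to every component left by \<open>T\<close>.\<close>

theorem minimum_vertex_cut:
  assumes G: "pair_graph G" and card: "2 \<le> card (pverts G)" and conn: "connected (with_proj G)"
    and incomplete: "\<not> complete_digraph (card (pverts G)) (with_proj G)"
  obtains T i j where "T \<subseteq> pverts G" "T \<noteq> {}" "card T = vertex_connectivity G"
    "i \<in> pverts G - T" "j \<in> pverts G - T" "(i, j) \<notin> (parcs G \<inter> (pverts G - T) \<times> (pverts G - T))\<^sup>*"
    "\<And>t i. t \<in> T \<Longrightarrow> i \<in> pverts G - T \<Longrightarrow>
      \<exists>i'. (i, i') \<in> (parcs G \<inter> (pverts G - T) \<times> (pverts G - T))\<^sup>* \<and> i' \<in> pverts G - T \<and> (i', t) \<in> parcs G"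
proof -
  interpret pair_graph G by (rule G)
  let ?V = "pverts G" and ?E = "parcs G"
  have E: "?E \<subseteq> ?V \<times> ?V" using in_arcsD1 in_arcsD2 by auto
  have sym: "sym ?E" using pair_sym_arcs by (simp add: symmetric_def)
  have loops: "(u, u) \<notin> ?E" for u using pair_no_loops[of "(u, u)"] by auto
  have fin: "finite ?V" by (rule pair_finite_verts)
  define \<kappa> where "\<kappa> = vertex_connectivity G"
  let ?K = "{k. vertex_connected k G}"
  have "?K \<subseteq> {..card ?V}" by (auto simp: vertex_connected_def)
  then have finK: "finite ?K" by (rule finite_subset) simp
  have "0 \<in> ?K" using conn card by (simp add: vertex_connected_def)
  then have \<kappa>: "vertex_connected \<kappa> G"
    using Max_in[OF finK] unfolding \<kappa>_def vertex_connectivity_def by blast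
  have "Suc \<kappa> \<notin> ?K"
    using Max_ge[OF finK, of "Suc \<kappa>"] unfolding \<kappa>_def vertex_connectivity_def by auto
  then have not_conn: "card ?V \<le> Suc \<kappa> \<or> (\<exists>T\<subseteq>?V. card T < Suc \<kappa> \<and> \<not> connected (with_proj G \<restriction> (?V - T)))"
    using conn by (auto simp: vertex_connected_def not_less)
  have \<kappa>_card: "\<kappa> < card ?V" and small: "\<And>T. T \<subseteq> ?V \<Longrightarrow> card T < \<kappa> \<Longrightarrow> connected (with_proj G \<restriction> (?V - T))"
    using \<kappa> by (auto simp: vertex_connected_def)
  have "\<exists>T\<subseteq>?V. card T < Suc \<kappa> \<and> \<not> connected (with_proj G \<restriction> (?V - T))"
  proof (rule ccontr)
    assume none: "\<not> ?thesis"
    with not_conn have "card ?V \<le> Suc \<kappa>" by blast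
    \<comment> \<open>Here \<kappa> would be \<open>card ?V - 1\<close>, so deleting all but two
      nonadjacent vertices would have to leave a connected graph.\<close>
    have "?E \<noteq> {(u, v). (u, v) \<in> ?V \<times> ?V \<and> u \<noteq> v}"
      using incomplete fin by (auto simp: complete_digraph_pair_def)
    then obtain u v where uv: "u \<in> ?V" "v \<in> ?V" "u \<noteq> v" "(u, v) \<notin> ?E"
      using E loops by auto
    have "card (?V - {u, v}) = card ?V - 2"
      using uv fin by (simp add: card_Diff_subset)
    then have "connected (with_proj G \<restriction> (?V - (?V - {u, v})))"
      using none card \<open>card ?V \<le> Suc \<kappa>\<close> \<kappa>_card by (intro small) auto
    moreover have "?V - (?V - {u, v}) = {u, v}" using uv by auto
    ultimately have "(u, v) \<in> (?E \<inter> {u, v} \<times> {u, v})\<^sup>*"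
      by (simp add: connected_induce_iff[OF sym])
    moreover have "?E \<inter> {u, v} \<times> {u, v} = {}"
      using uv loops sym by (auto simp: sym_def)
    ultimately show False using uv(3) by simp
  qed
  then obtain T where T: "T \<subseteq> ?V" "card T < Suc \<kappa>" "\<not> connected (with_proj G \<restriction> (?V - T))" by blast
  have card_T: "card T = \<kappa>" using small[OF T(1)] T(2,3) by linarith
  let ?W = "?V - T"
  let ?R = "?E \<inter> ?W \<times> ?W"
  have "?W \<noteq> {}" using card_T \<kappa>_card card_mono[of T ?V] fin T(1) finite_subset[OF T(1) fin] by auto
  then obtain i j where ij: "i \<in> ?W" "j \<in> ?W" "(i, j) \<notin> ?R\<^sup>*"
    using T(3) unfolding connected_induce_iff[OF sym] by blast
  have "{e \<in> ?E. fst e \<in> ?V \<and> snd e \<in> ?V} = ?E" using E by auto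
  then have "mk_symmetric (with_proj G \<restriction> ?V) = mk_symmetric (with_proj G)"
    by (simp add: mk_symmetric_def)
  then have "connected (with_proj G \<restriction> ?V)" using conn by (simp add: connected_def)
  then have T_ne: "T \<noteq> {}" using T(3) by auto
  have adj: "\<exists>i'. (i, i') \<in> ?R\<^sup>* \<and> i' \<in> ?W \<and> (i', t) \<in> ?E" if t: "t \<in> T" and i: "i \<in> ?W" for t i
  proof -
    let ?W' = "?V - (T - {t})"
    have "card (T - {t}) < \<kappa>"
      using card_T t finite_subset[OF T(1) fin] card_Diff1_less[of T t] by simp
    then have "connected (with_proj G \<restriction> ?W')" using T(1) by (intro small) auto
    then have it: "(i, t) \<in> (?E \<inter> ?W' \<times> ?W')\<^sup>*"
      using i t T(1) unfolding connected_induce_iff[OF sym] by auto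
    \<comment> \<open>Invariant along a walk from \<open>i\<close>: it is still inside the component
      of \<open>i\<close>, or that component has already been found adjacent to t, the only vertex
      through which it can be left.\<close>
    have "(y \<in> ?W \<and> (i, y) \<in> ?R\<^sup>*) \<or> (\<exists>i'. (i, i') \<in> ?R\<^sup>* \<and> i' \<in> ?W \<and> (i', t) \<in> ?E)"
      if "(i, y) \<in> (?E \<inter> ?W' \<times> ?W')\<^sup>*" for y
      using that
    proof (induction rule: rtrancl_induct)
      case base
      then show ?case using i by blast
    next
      case (step x y)
      show ?case
      proof (cases "x \<in> ?W \<and> (i, x) \<in> ?R\<^sup>*")
        case True
        show ?thesis
        proof (cases "y = t")
          case True
          then show ?thesis using \<open>x \<in> ?W \<and> (i, x) \<in> ?R\<^sup>*\<close> step.hyps(2) by blast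
        next
          case False
          then have "(x, y) \<in> ?R" using step.hyps(2) True by auto
          then have "(i, y) \<in> ?R\<^sup>*" "y \<in> ?W" using True by (auto intro: rtrancl_into_rtrancl)
          then show ?thesis by blast
        qed
      next
        case False
        from step.IH show ?thesis
        proof
          assume "x \<in> ?W \<and> (i, x) \<in> ?R\<^sup>*"
          with False show ?thesis by (rule notE)
        next
          assume "\<exists>i'. (i, i') \<in> ?R\<^sup>* \<and> i' \<in> ?W \<and> (i', t) \<in> ?E"
          then show ?thesis by (rule disjI2)
        qed
      qed
    qed
    from this[OF it] show ?thesis
    proof
      assume "t \<in> ?W \<and> (i, t) \<in> ?R\<^sup>*"
      then show ?thesis using t by simp
    qed assumption
  qed
  have "card T = vertex_connectivity G" using card_T by (simp add: \<kappa>_def)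
  from that[OF T(1) T_ne this ij adj] show ?thesis .
qed

section \<open>Gradings\<close>

definition graded :: "('v \<Rightarrow> nat) \<Rightarrow> ('v, 'k::field) mpoly set \<Rightarrow> bool" where
  "graded w I \<longleftrightarrow> (\<forall>p\<in>I. \<forall>d. hproj w d p \<in> I)"

lemma poly_ideal_ideal:
  assumes "poly_ideal V I"
  shows "ideal I (polynomial_ring V)"
proof (rule idealI)
  interpret R: cring "polynomial_ring V :: ('a, 'b) mpoly ring" by (rule cring_polynomial_ring)
  show "ring (polynomial_ring V :: ('a, 'b) mpoly ring)" by (rule R.ring_axioms)
  note I = poly_idealD[OF assms]
  show "subgroup I (add_monoid (polynomial_ring V))"
  proof (rule R.add.subgroupI)
    fix a assume a: "a \<in> I"
    have "\<ominus>\<^bsub>polynomial_ring V\<^esub> a = - a"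
      by (rule R.minus_equality) (use I(1)[OF a] in simp_all)
    then show "\<ominus>\<^bsub>polynomial_ring V\<^esub> a \<in> I" using I(5)[OF a] by simp
  qed (use I in auto)
next
  fix a x :: "('a, 'b) mpoly" assume "a \<in> I" "x \<in> carrier (polynomial_ring V)"
  then show "x \<otimes>\<^bsub>polynomial_ring V\<^esub> a \<in> I" "a \<otimes>\<^bsub>polynomial_ring V\<^esub> x \<in> I"
    using poly_idealD(4)[OF assms, of x a] by (simp_all add: mult.commute)
qed

lemma genideal_poly_minimal:
  assumes "poly_ideal V I" "S \<subseteq> I" "p \<in> genideal (polynomial_ring V) S"
  shows "p \<in> I"
  using ring.genideal_minimal[OF cring.axioms(1)[OF cring_polynomial_ring] poly_ideal_ideal[OF assms(1)] assms(2)] assms(3)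
  by blast

lemma genideal_poly_ideal: "S \<subseteq> polys V \<Longrightarrow> ideal (genideal (polynomial_ring V) S) (polynomial_ring V)"
  by (rule ring.genideal_ideal[OF cring.axioms(1)[OF cring_polynomial_ring]])

text \<open>The elements of the ideal all of whose components lie in the ideal form an ideal
  themselves, and it contains the generators.\<close>

lemma graded_genideal:
  fixes S :: "('v, 'k::field) mpoly set"
  assumes S: "S \<subseteq> polys V" and hom: "\<And>s d. s \<in> S \<Longrightarrow> hproj w d s \<in> {s, 0}"
  shows "graded w (genideal (polynomial_ring V) S)"
  unfolding graded_def
proof (intro ballI allI)
  let ?J = "genideal (polynomial_ring V) S"
  let ?C = "{p \<in> ?J. \<forall>d. hproj w d p \<in> ?J}"
  have J: "poly_ideal V ?J" by (rule ideal_poly_ideal[OF genideal_poly_ideal[OF S]])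
  have SJ: "S \<subseteq> ?J" by (rule ring.genideal_self[OF cring.axioms(1)[OF cring_polynomial_ring] S])
  have "poly_ideal V ?C"
    unfolding poly_ideal_def
  proof (intro conjI ballI)
    show "?C \<subseteq> polys V" using poly_idealD(1)[OF J] by blast
    show "0 \<in> ?C" using poly_idealD(2)[OF J] by (simp add: klinear_zero)
  next
    fix p q assume "p \<in> ?C" "q \<in> ?C"
    then show "p + q \<in> ?C" using poly_idealD(3)[OF J] by (simp add: klinear_add)
  next
    fix a p :: "('v, 'k) mpoly" assume a: "a \<in> polys V" and p: "p \<in> ?C"
    have "hproj w d (a * p) \<in> ?J" for d
      unfolding hproj_mult
      by (intro poly_ideal_sum[OF J] poly_idealD(4)[OF J] hproj_polys a) (use p in blast)
    then show "a * p \<in> ?C" using poly_idealD(4)[OF J a] p by simp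
  qed
  moreover have "S \<subseteq> ?C"
  proof
    fix s assume s: "s \<in> S"
    then have "hproj w d s \<in> ?J" for d using hom[OF s, of d] SJ poly_idealD(2)[OF J] by auto
    then show "s \<in> ?C" using SJ s by blast
  qed
  ultimately show "hproj w d p \<in> ?J" if "p \<in> ?J" for p d
    using genideal_poly_minimal[of V ?C S p] that by blast
qed

lemma graded_ideal_powers:
  assumes J: "ideal J (polynomial_ring V)" and gr: "graded w J"
  shows "graded w (ideal_powers (polynomial_ring V) J t)"
proof (induction t)
  case 0
  then show ?case by (simp add: graded_def ideal_powers_0 hproj_polys)
next
  case (Suc t)
  let ?I = "ideal_powers (polynomial_ring V) J t"
  let ?P = "ideal_prod (polynomial_ring V) ?I J"
  have P: "poly_ideal V ?P"
    using ideal_poly_ideal[OF ideal_powers_ideal[OF cring_polynomial_ring J, of "Suc t"]] by (simp add: ideal_powers_Suc)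
  have "hproj w d p \<in> ?P" if "p \<in> ?P" for p d
    using that
  proof (induction rule: ideal_prod.induct)
    case (prod i j)
    have "hproj w a i * hproj w b j \<in> ?P" for a b
      using ideal_prod.prod[of "hproj w a i" ?I "hproj w b j" J "polynomial_ring V"] Suc prod gr by (simp add: graded_def)
    then show ?case by (simp add: hproj_mult poly_ideal_sum[OF P])
  next
    case (sum s1 s2)
    then show ?case using poly_idealD(3)[OF P] by (simp add: klinear_add)
  qed
  then show ?case by (simp add: graded_def ideal_powers_Suc)
qed

text \<open>Each component of (x - 1) p has the form x p_(d-1) - p_d and lies in \<open>I\<close>,
  so all p_d lie in \<open>I\<close> by induction from degree 0.\<close>

lemma graded_colon:
  assumes I: "poly_ideal V I" and gr: "graded w I" and u: "u \<in> V" "w u = 1"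
    and p: "(variable u - 1) * p \<in> I"
  shows "p \<in> I"
proof -
  have hd: "hproj w d (variable u * p) = (if 1 \<le> d then variable u * hproj w (d - 1) p else 0)" for d
    unfolding variable_def by (simp add: hproj_mono_mult u(2))
  have in_I: "hproj w d (variable u * p) - hproj w d p \<in> I" for d
    using gr p unfolding graded_def by (simp add: left_diff_distrib klinear_diff[OF hproj_klinear, symmetric])
  have "hproj w d p \<in> I" for d
  proof (induction d)
    case 0
    then show ?case using poly_idealD(5)[OF I in_I[of 0]] by (simp add: hd)
  next
    case (Suc d)
    have "variable u * hproj w d p \<in> I" using poly_idealD(4)[OF I _ Suc] u by simp
    from poly_idealD(6)[OF I this in_I[of "Suc d"]] show ?case by (simp add: hd)
  qed
  moreover obtain e where "p = (\<Sum>i<e. hproj w i p)" using hproj_sum[of p w] by blast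
  ultimately show ?thesis using poly_ideal_sum[OF I, of "{..<e}" "\<lambda>i. hproj w i p"] by simp
qed

text \<open>A variable of weight 0 can be set to 1 without disturbing weights; gradings reserved for
  later variables thus survive earlier specializations.\<close>

lemma hproj_specialize:
  fixes p :: "('v, 'k::field) mpoly"
  assumes "w u = 0"
  shows "hproj w d (specialize {u} p) = specialize {u} (hproj w d p)"
proof -
  note sp = algebra_homD[OF specialize_algebra_hom]
  have mon: "hproj w d (specialize {u} (monomial t)) =
      (if wdeg w t = d then specialize {u} (monomial t) else (0 :: ('v, 'k) mpoly))" for d t
  proof (induction t arbitrary: d rule: monomial_induct)
    case zero
    then show ?case using hproj_single[of w d 0 "1 :: 'k"] by (simp add: sp(2))
  next
    case (add v t)
    let ?m = "specialize {u} (monomial t) :: ('v, 'k) mpoly"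
    have e: "specialize {u} (monomial (single v 1 + t)) = (if v = u then ?m else variable v * ?m)"
      unfolding variable_mult_monomial[symmetric] sp(3) by (simp add: specialize_def)
    have wd: "wdeg w (single v 1 + t) = w v + wdeg w t" by simp
    show ?case
    proof (cases "v = u")
      case True
      then show ?thesis unfolding e wd using add assms by simp
    next
      case False
      have "hproj w d (variable v * ?m) = (if w v \<le> d then variable v * hproj w (d - w v) ?m else 0)"
        unfolding variable_def by (simp add: hproj_mono_mult)
      then show ?thesis unfolding e wd using add False by auto
    qed
  qed
  have "(\<lambda>p. hproj w d (specialize {u} p)) = (\<lambda>p. specialize {u} (hproj w d p) :: ('v, 'k) mpoly)"
  proof (rule klinear_eqI)
    show "klinear (\<lambda>p. hproj w d (specialize {u} p) :: ('v, 'k) mpoly)"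
      by (rule klinear_comp[OF hproj_klinear sp(1)])
    show "klinear (\<lambda>p. specialize {u} (hproj w d p) :: ('v, 'k) mpoly)"
      by (rule klinear_comp[OF sp(1) hproj_klinear])
    show "hproj w d (specialize {u} (monomial t)) = (specialize {u} (hproj w d (monomial t)) :: ('v, 'k) mpoly)" for t
      using mon[of d t] by (simp add: hproj_single klinear_zero[OF sp(1)])
  qed
  then show ?thesis by (rule fun_cong)
qed

lemma graded_specialize: "graded w I \<Longrightarrow> w u = 0 \<Longrightarrow> graded w (specialize {u} ` I)"
  by (auto simp: graded_def hproj_specialize)

text \<open>Each variable has its own grading, in which it has weight 1 and the variables eliminated
  before it have weight 0. That grading is still available when its turn comes and makes x - 1 a
  nonzerodivisor by \<open>graded_colon\<close>.\<close>

theorem koszul_vanishing_specialize_list: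
  fixes I :: "nat \<Rightarrow> ('v, 'k::field) mpoly set"
  assumes "filtration (set (us @ vs)) I" "distinct (us @ vs)"
    and "\<And>u t. u \<in> set us \<Longrightarrow> graded (wt u) (I t)" "\<And>u. u \<in> set us \<Longrightarrow> wt u u = 1"
    and "sorted_wrt (\<lambda>u u'. wt u' u = 0) us"
    and "koszul_vanishing (set (us @ vs)) I (us @ vs) N"
  shows "koszul_vanishing (set vs) (\<lambda>t. specialize (set us) ` I t) vs N"
  using assms
proof (induction us arbitrary: I)
  case Nil
  have "specialize {} p = p" if "p \<in> I t" for p t
    using specialize_id[of "{}" "set vs" p] poly_idealD(1)[OF filtrationD(1)[OF Nil.prems(1)] that] by simp
  then have "(\<lambda>t. specialize {} ` I t) = I" by (force simp: image_iff)
  then show ?case using Nil.prems(6) by simp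
next
  case (Cons u us)
  let ?W = "set (us @ vs)"
  let ?I = "\<lambda>t. specialize {u} ` I t"
  have fil: "filtration (insert u ?W) I" using Cons.prems(1) by simp
  have u: "u \<notin> ?W" using Cons.prems(2) by simp
  have "koszul_vanishing ?W ?I (us @ vs) N"
  proof (rule koszul_vanishing_specialize[OF u refl fil])
    show "p \<in> I t" if "p \<in> polys (insert u ?W)" "(variable u - 1) * p \<in> I t" for t p
      by (rule graded_colon[OF filtrationD(1)[OF fil] Cons.prems(3)[of u] _ Cons.prems(4)[of u] that(2)]) auto
  qed (use Cons.prems(6) in simp)
  moreover have "filtration ?W ?I"
    using filtration_specialize[of "{u}" ?W I] fil u by simp
  moreover have "graded (wt u') (?I t)" if "u' \<in> set us" for u' t
    by (rule graded_specialize) (use Cons.prems(3,5) that in auto)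
  ultimately have "koszul_vanishing (set vs) (\<lambda>t. specialize (set us) ` ?I t) vs N"
    by (intro Cons.IH) (use Cons.prems in auto)
  moreover have "specialize (set us) (specialize {u} p) = specialize (set (u # us)) p" for p :: "('v, 'k) mpoly"
  proof (rule algebra_hom_eq_on[where V = UNIV and g = "\<lambda>p. specialize (set us) (specialize {u} p)"
        and h = "specialize (set (u # us))"])
    show "algebra_hom (\<lambda>p. specialize (set us) (specialize {u} p) :: ('v, 'k) mpoly)"
      by (rule algebra_hom_comp[OF specialize_algebra_hom specialize_algebra_hom])
    show "specialize (set us) (specialize {u} (variable v)) = (specialize (set (u # us)) (variable v) :: ('v, 'k) mpoly)" for v
      by (simp add: specialize_def algebra_homD(2)[OF subst_algebra_hom])
  qed (auto simp: specialize_algebra_hom polys_iff)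
  ultimately show ?case by (simp add: image_image)
qed

section \<open>A transversal slice at a vertex cut\<close>

text \<open>\<open>j0\<close> and \<open>j'\<close> lie in different components outside the cut
  \<open>T\<close>. Column \<open>j0\<close> is the reference column, identically 1 on the
  slice.\<close>

locale edge_cut =
  fixes m n :: nat and E :: "(nat \<times> nat) set" and T :: "nat set" and t0 j0 j' :: nat
  assumes m: "2 \<le> m" and E: "E \<subseteq> {1..n} \<times> {1..n}" and sym: "sym E" and loops: "\<And>i. (i, i) \<notin> E"
    and T: "T \<subseteq> {1..n}" and t0: "t0 \<in> T"
    and j0: "j0 \<in> {1..n} - T" and j': "j' \<in> {1..n} - T"
    and separated: "(j0, j') \<notin> (E \<inter> ({1..n} - T) \<times> ({1..n} - T))\<^sup>*"
    and adjacent: "\<And>t i. t \<in> T \<Longrightarrow> i \<in> {1..n} - T \<Longrightarrow>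
      \<exists>i'. (i, i') \<in> (E \<inter> ({1..n} - T) \<times> ({1..n} - T))\<^sup>* \<and> i' \<in> {1..n} - T \<and> (i', t) \<in> E"
begin

definition W :: "nat set" where "W = {1..n} - T"

definition R :: "(nat \<times> nat) set" where "R = E \<inter> W \<times> W"

text \<open>Representative of a component outside \<open>T\<close>. The component of
  \<open>j0\<close> is represented by \<open>j0\<close> itself, the column that is eliminated
  entirely; elsewhere the least vertex is an arbitrary choice.\<close>

definition rho :: "nat \<Rightarrow> nat" where
  "rho j = (if (j, j0) \<in> R\<^sup>* then j0 else (LEAST i. (j, i) \<in> R\<^sup>*))"

definition edge_ideal :: "(nat \<times> nat, 'k::field) mpoly set" where
  "edge_ideal = Idl\<^bsub>matrix_ring m n\<^esub>
     {variable (k, i) * variable (l, j) - variable (k, j) * variable (l, i) | k l i j.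
        1 \<le> k \<and> k < l \<and> l \<le> m \<and> (i, j) \<in> E \<and> i < j}"

text \<open>Column and row scalings normalize to 1 the first row outside \<open>T\<close> and then
  the column \<open>j0\<close>. These |W| + m - 1 entries match the dimension of the orbit
  transversal to the slice. The first row has to go first: setting other entries of column
  \<open>j0\<close> to 1 would destroy the grading by that column.\<close>

definition eliminated :: "(nat \<times> nat) list" where
  "eliminated = map (\<lambda>j. (1, j)) (sorted_list_of_set W) @ map (\<lambda>k. (k, j0)) [2..<Suc m]"

definition S :: "(nat \<times> nat) set" where
  "S = {1..m} \<times> {1..n} - set eliminated"

text \<open>
  The slice through the matrix whose columns outside \<open>T\<close> are \<open>(1, \<dots>, 1)\<close> and whose columns in
  \<open>T\<close> vanish, obtained by setting the eliminated entries to \<open>1\<close>.  The coordinates \<open>tau_var\<close> turn the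
  edge ideal into an ideal whose powers contain enough monomials.
\<close>

definition tau_var :: "nat \<times> nat \<Rightarrow> (nat \<times> nat, 'k::field) mpoly" where
  "tau_var v = (case v of (k, j) \<Rightarrow>
     if j \<in> T then (if k = 1 then variable (k, j) else variable (k, j) + variable (1, j))
     else if rho j = j \<or> rho j = j0 then variable (k, j) + 1
     else variable (k, j) + 1 + variable (k, rho j))"

text \<open>The inverse substitution, which shows the new coordinates in terms of the entries: in
  the columns of \<open>T\<close> the difference to the first row, outside \<open>T\<close> the
  difference to the representative column, or to 1 at representatives and in the component of
  \<open>j0\<close>.\<close>

definition sigma_var :: "nat \<times> nat \<Rightarrow> (nat \<times> nat, 'k::field) mpoly" where
  "sigma_var v = (case v of (k, j) \<Rightarrow>
     if j \<in> T then (if k = 1 then variable (k, j) else variable (k, j) - variable (1, j))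
     else if rho j = j \<or> rho j = j0 then variable (k, j) - 1
     else variable (k, j) - variable (k, rho j))"

text \<open>Restriction of functions to the slice, in the new coordinates; the values
  \<open>entry k j\<close> below form the generic matrix of the slice.\<close>

definition psi :: "(nat \<times> nat, 'k::field) mpoly \<Rightarrow> (nat \<times> nat, 'k) mpoly" where
  "psi p = subst tau_var (specialize (set eliminated) p)"

definition entry :: "nat \<Rightarrow> nat \<Rightarrow> (nat \<times> nat, 'k::field) mpoly" where
  "entry k j = psi (variable (k, j))"

section \<open>Component representatives and the coordinate change\<close>

lemma finite_W: "finite W"
  by (simp add: W_def)

lemma j0_W: "j0 \<in> W" and j'_W: "j' \<in> W"
  using j0 j' by (simp_all add: W_def)

lemma R_sym: "sym (R\<^sup>*)"
  by (rule sym_rtrancl) (use sym in \<open>auto simp: R_def sym_def\<close>)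

lemma R_W: "(i, j) \<in> R\<^sup>* \<Longrightarrow> i \<in> W \<Longrightarrow> j \<in> W"
  by (induction rule: rtrancl_induct) (auto simp: R_def)

lemma rho_reach: "(j, rho j) \<in> R\<^sup>*"
  unfolding rho_def by (auto intro: LeastI[of "\<lambda>i. (j, i) \<in> R\<^sup>*" j])

lemma rho_W: "j \<in> W \<Longrightarrow> rho j \<in> W"
  by (rule R_W[OF rho_reach])

lemma rho_eq:
  assumes "(i, j) \<in> R\<^sup>*"
  shows "rho i = rho j"
proof -
  have ji: "(j, i) \<in> R\<^sup>*" by (rule symD[OF R_sym assms])
  have "(i, k) \<in> R\<^sup>* \<longleftrightarrow> (j, k) \<in> R\<^sup>*" for k
    using rtrancl_trans[OF assms, of k] rtrancl_trans[OF ji, of k] by blast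
  then show ?thesis by (simp add: rho_def)
qed

lemma rho_rho [simp]: "rho (rho j) = rho j"
  using rho_eq[OF rho_reach] by simp

lemma rho_j0 [simp]: "rho j0 = j0"
  by (simp add: rho_def)

lemma rho_j': "rho j' \<noteq> j0"
proof
  assume "rho j' = j0"
  then have "(j', j0) \<in> R\<^sup>*" using rho_reach[of j'] by simp
  then have "(j0, j') \<in> R\<^sup>*" by (rule symD[OF R_sym])
  then show False using separated by (simp add: R_def W_def)
qed

lemma set_eliminated: "set eliminated = {(k, j). (k = 1 \<and> j \<in> W) \<or> (j = j0 \<and> 2 \<le> k \<and> k \<le> m)}"
  using finite_W by (auto simp: eliminated_def)

lemma mem_S: "(k, j) \<in> S \<longleftrightarrow> 1 \<le> k \<and> k \<le> m \<and> j \<in> {1..n} \<and> (j \<in> T \<or> (2 \<le> k \<and> j \<noteq> j0))"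
  using j0_W by (auto simp: S_def set_eliminated W_def)

lemma eliminated_subset: "set eliminated \<subseteq> {1..m} \<times> {1..n}"
  using j0_W m by (auto simp: set_eliminated W_def)

lemma eliminated_un_S: "set eliminated \<union> S = {1..m} \<times> {1..n}"
  using eliminated_subset by (auto simp: S_def)

lemma distinct_eliminated: "distinct eliminated"
  by (auto simp: eliminated_def distinct_map inj_on_def)

lemma psi_algebra_hom: "algebra_hom psi"
  unfolding psi_def[abs_def] by (rule algebra_hom_comp[OF subst_algebra_hom specialize_algebra_hom])

lemma tau_polys: "p \<in> polys S \<Longrightarrow> subst tau_var p \<in> polys S"
proof (rule subst_polys)
  fix v assume "v \<in> S"
  then obtain k j where v: "v = (k, j)" "(k, j) \<in> S" by (cases v) auto
  show "tau_var v \<in> polys S"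
  proof (cases "j \<in> T")
    case True
    then have "(1, j) \<in> S" using v(2) m by (auto simp: mem_S)
    then show ?thesis using v True by (auto simp: tau_var_def)
  next
    case False
    then have "2 \<le> k" "k \<le> m" "j \<in> W" using v(2) by (auto simp: mem_S W_def)
    then have "(k, rho j) \<in> S" if "rho j \<noteq> j0" using rho_W[of j] that by (auto simp: mem_S W_def)
    then show ?thesis using v False by (auto simp: tau_var_def)
  qed
qed

lemma sigma_polys: "p \<in> polys S \<Longrightarrow> subst sigma_var p \<in> polys S"
proof (rule subst_polys)
  fix v assume "v \<in> S"
  then obtain k j where v: "v = (k, j)" "(k, j) \<in> S" by (cases v) auto
  show "sigma_var v \<in> polys S"
  proof (cases "j \<in> T")
    case True
    then have "(1, j) \<in> S" using v(2) m by (auto simp: mem_S)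
    then show ?thesis using v True by (auto simp: sigma_var_def)
  next
    case False
    then have "2 \<le> k" "k \<le> m" "j \<in> W" using v(2) by (auto simp: mem_S W_def)
    then have "(k, rho j) \<in> S" if "rho j \<noteq> j0" using rho_W[of j] that by (auto simp: mem_S W_def)
    then show ?thesis using v False by (auto simp: sigma_var_def)
  qed
qed

lemma rho_notin_T: "j \<in> W \<Longrightarrow> rho j \<notin> T"
  using rho_W[of j] by (simp add: W_def)

lemma S_cases: "(k, j) \<in> S \<Longrightarrow> j \<in> T \<or> j \<in> W"
  by (auto simp: mem_S W_def)

lemma sigma_tau:
  fixes p :: "(nat \<times> nat, 'k::field) mpoly"
  assumes "p \<in> polys S"
  shows "subst sigma_var (subst tau_var p) = p"
proof (rule algebra_hom_eq_on[where g = "\<lambda>p. subst sigma_var (subst tau_var p)" and h = "\<lambda>p. p", OF _ _ _ assms])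
  show "algebra_hom (\<lambda>p. subst sigma_var (subst tau_var p) :: (nat \<times> nat, 'k) mpoly)"
    by (rule algebra_hom_comp[OF subst_algebra_hom subst_algebra_hom])
  show "algebra_hom (\<lambda>p. p :: (nat \<times> nat, 'k) mpoly)" by (rule algebra_hom_id)
  fix v assume "v \<in> S"
  then obtain k j where v: "v = (k, j)" "j \<in> T \<or> j \<in> W" using S_cases by (cases v) auto
  note h = klinear_add[OF subst_klinear] algebra_homD(2)[OF subst_algebra_hom]
  show "subst sigma_var (subst tau_var (variable v)) = (variable v :: (nat \<times> nat, 'k) mpoly)"
  proof (cases "j \<in> T")
    case True
    then show ?thesis by (simp add: v(1) tau_var_def sigma_var_def h)
  next
    case False
    then show ?thesis using rho_notin_T[of j] v(2) by (simp add: v(1) tau_var_def sigma_var_def h)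
  qed
qed

lemma tau_sigma:
  fixes p :: "(nat \<times> nat, 'k::field) mpoly"
  assumes "p \<in> polys S"
  shows "subst tau_var (subst sigma_var p) = p"
proof (rule algebra_hom_eq_on[where g = "\<lambda>p. subst tau_var (subst sigma_var p)" and h = "\<lambda>p. p", OF _ _ _ assms])
  show "algebra_hom (\<lambda>p. subst tau_var (subst sigma_var p) :: (nat \<times> nat, 'k) mpoly)"
    by (rule algebra_hom_comp[OF subst_algebra_hom subst_algebra_hom])
  show "algebra_hom (\<lambda>p. p :: (nat \<times> nat, 'k) mpoly)" by (rule algebra_hom_id)
  fix v assume "v \<in> S"
  then obtain k j where v: "v = (k, j)" "j \<in> T \<or> j \<in> W" using S_cases by (cases v) auto
  note h = klinear_diff[OF subst_klinear] algebra_homD(2)[OF subst_algebra_hom]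
  show "subst tau_var (subst sigma_var (variable v)) = (variable v :: (nat \<times> nat, 'k) mpoly)"
  proof (cases "j \<in> T")
    case True
    then show ?thesis by (simp add: v(1) tau_var_def sigma_var_def h)
  next
    case False
    then show ?thesis using rho_notin_T[of j] v(2) by (simp add: v(1) tau_var_def sigma_var_def h)
  qed
qed

lemma psi_polys: "p \<in> polys ({1..m} \<times> {1..n}) \<Longrightarrow> psi p \<in> polys S"
  unfolding psi_def using specialize_polys[of p "set eliminated" S] by (simp add: eliminated_un_S tau_polys)

lemma S_subset: "S \<subseteq> {1..m} \<times> {1..n}"
  by (auto simp: S_def)

lemma psi_sigma: "p \<in> polys S \<Longrightarrow> psi (subst sigma_var p) = p"
  unfolding psi_def using specialize_id[of "set eliminated" S "subst sigma_var p"] sigma_polys[of p] tau_sigma[of p]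
  by (auto simp: S_def)

lemma psi_surj: "q \<in> polys S \<Longrightarrow> \<exists>p\<in>polys ({1..m} \<times> {1..n}). psi p = q"
  by (rule bexI[of _ "subst sigma_var q"]) (use psi_sigma sigma_polys polys_mono[OF S_subset] in auto)

lemma entry_eliminated: "(k, j) \<in> set eliminated \<Longrightarrow> entry k j = 1"
  using algebra_homD(2)[OF subst_algebra_hom] by (simp add: entry_def psi_def specialize_def)

lemma entry_tau: "(k, j) \<notin> set eliminated \<Longrightarrow> entry k j = tau_var (k, j)"
  by (simp add: entry_def psi_def specialize_def)

lemma entry_T: "j \<in> T \<Longrightarrow> entry k j = (if k = 1 then variable (k, j) else variable (k, j) + variable (1, j))"
  using j0_W by (subst entry_tau) (auto simp: set_eliminated W_def tau_var_def)

lemma entry_1: "j \<in> W \<Longrightarrow> entry 1 j = 1"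
  by (rule entry_eliminated) (simp add: set_eliminated)

lemma entry_j0: "1 \<le> k \<Longrightarrow> k \<le> m \<Longrightarrow> entry k j0 = 1"
  by (rule entry_eliminated) (use j0_W in \<open>auto simp: set_eliminated\<close>)

lemma entry_W:
  "j \<in> W \<Longrightarrow> j \<noteq> j0 \<Longrightarrow> 2 \<le> k \<Longrightarrow> entry k j =
    (if rho j = j \<or> rho j = j0 then variable (k, j) + 1 else variable (k, j) + 1 + variable (k, rho j))"
  by (subst entry_tau) (auto simp: set_eliminated tau_var_def W_def)

section \<open>The edge ideal and its image on the slice\<close>

lemma generators_polys:
  "{variable (k, i) * variable (l, j) - variable (k, j) * variable (l, i) | k l i j.
     1 \<le> k \<and> k < l \<and> l \<le> m \<and> (i, j) \<in> E \<and> i < j} \<subseteq> polys ({1..m} \<times> {1..n})"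
  using E by (auto intro!: polys_diff polys_mult)

lemma edge_ideal_ideal: "ideal edge_ideal (matrix_ring m n)"
  unfolding edge_ideal_def by (rule genideal_poly_ideal[OF generators_polys])

lemma generator_mem:
  assumes "1 \<le> k" "k < l" "l \<le> m" "(i, j) \<in> E"
  shows "variable (k, i) * variable (l, j) - variable (k, j) * variable (l, i) \<in> edge_ideal"
proof -
  have *: "variable (k, i) * variable (l, j) - variable (k, j) * variable (l, i) \<in> edge_ideal"
    if "(i, j) \<in> E" "i < j" for i j
    unfolding edge_ideal_def
    by (rule subsetD[OF ring.genideal_self[OF cring.axioms(1)[OF cring_polynomial_ring] generators_polys]])
      (use assms that in blast)
  have "i \<noteq> j" using assms(4) loops by auto
  then consider "i < j" | "j < i" by linarith
  then show ?thesis
  proof cases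
    case 1
    then show ?thesis using * assms(4) by blast
  next
    case 2
    have "(j, i) \<in> E" using assms(4) sym by (simp add: sym_def)
    from poly_idealD(5)[OF ideal_poly_ideal[OF edge_ideal_ideal] *[OF this 2]]
    show ?thesis by simp
  qed
qed

lemma edge_ideal_kernel:
  fixes h :: "(nat \<times> nat, 'k::field) mpoly \<Rightarrow> (nat \<times> nat, 'k) mpoly"
  assumes h: "algebra_hom h"
    and gens: "\<And>k l i j. (i, j) \<in> E \<Longrightarrow> 1 \<le> k \<Longrightarrow> k < l \<Longrightarrow> l \<le> m \<Longrightarrow>
      h (variable (k, i)) * h (variable (l, j)) = h (variable (k, j)) * h (variable (l, i))"
    and p: "p \<in> edge_ideal"
  shows "h p = 0"
proof -
  note hD = algebra_homD[OF h]
  have "poly_ideal ({1..m} \<times> {1..n}) {p \<in> polys ({1..m} \<times> {1..n}). h p = 0}"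
    by (auto simp: poly_ideal_def klinear_zero[OF hD(1)] klinear_add[OF hD(1)] hD(3))
  moreover have "{variable (k, i) * variable (l, j) - variable (k, j) * variable (l, i) | k l i j.
     1 \<le> k \<and> k < l \<and> l \<le> m \<and> (i, j) \<in> E \<and> i < j} \<subseteq> {p \<in> polys ({1..m} \<times> {1..n}). h p = 0}"
  proof
    fix s :: "(nat \<times> nat, 'k) mpoly" assume s: "s \<in> {variable (k, i) * variable (l, j) - variable (k, j) * variable (l, i) | k l i j.
     1 \<le> k \<and> k < l \<and> l \<le> m \<and> (i, j) \<in> E \<and> i < j}"
    then have "s \<in> polys ({1..m} \<times> {1..n})" by (rule subsetD[OF generators_polys])
    moreover have "h s = 0"
      using s gens by (auto simp: klinear_diff[OF hD(1)] hD(3))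
    ultimately show "s \<in> {p \<in> polys ({1..m} \<times> {1..n}). h p = 0}" by simp
  qed
  ultimately have "p \<in> {p \<in> polys ({1..m} \<times> {1..n}). h p = 0}"
    by (rule genideal_poly_minimal[OF _ _ p[unfolded edge_ideal_def]])
  then show ?thesis by simp
qed

text \<open>The condition holds for a row weight plus a column weight; it gives both products in a
  2-minor the same weight.\<close>

lemma edge_ideal_graded:
  assumes w: "\<And>k l i j. w (k, i) + w (l, j) = w (k, j) + w (l, i)"
  shows "graded w edge_ideal"
  unfolding edge_ideal_def
proof (rule graded_genideal[OF generators_polys])
  fix s :: "(nat \<times> nat, 'a) mpoly" and d
  assume "s \<in> {variable (k, i) * variable (l, j) - variable (k, j) * variable (l, i) | k l i j.
     1 \<le> k \<and> k < l \<and> l \<le> m \<and> (i, j) \<in> E \<and> i < j}"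
  then obtain k l i j where s: "s = variable (k, i) * variable (l, j) - variable (k, j) * variable (l, i)" by blast
  have "hproj w d (variable u * variable v) =
      (if w u + w v = d then variable u * variable v else (0 :: (nat \<times> nat, 'a) mpoly))" for u v
    unfolding variable_def mult_single by (simp add: hproj_single)
  then show "hproj w d s \<in> {s, 0}"
    unfolding s klinear_diff[OF hproj_klinear] using w[of k i l j] by auto
qed

definition image_ideal :: "(nat \<times> nat, 'k::field) mpoly set" where
  "image_ideal = psi ` edge_ideal"

lemma image_filtration:
  "filtration S (\<lambda>t. psi ` ideal_powers (matrix_ring m n) edge_ideal t)"
  by (rule filtration_image[OF ideal_powers_filtration[OF edge_ideal_ideal] psi_algebra_hom psi_polys psi_surj])

lemma image_ideal_poly_ideal: "poly_ideal S image_ideal"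
proof -
  have "filtration ({1..m} \<times> {1..n}) (\<lambda>t. edge_ideal)"
    using ideal_poly_ideal[OF edge_ideal_ideal] by (simp add: filtration_def)
  from filtration_image[OF this psi_algebra_hom psi_polys psi_surj]
  show ?thesis unfolding image_ideal_def by (rule filtrationD(1))
qed

section \<open>Explicit elements of the image ideal\<close>

lemma minor_mem:
  assumes "1 \<le> k" "k < l" "l \<le> m" "(i, j) \<in> E"
  shows "entry k i * entry l j - entry k j * entry l i \<in> image_ideal"
  using imageI[OF generator_mem[OF assms], of psi]
  by (simp add: image_ideal_def entry_def klinear_diff[OF algebra_homD(1)[OF psi_algebra_hom]]
      algebra_homD(3)[OF psi_algebra_hom])

text \<open>The first row is 1 outside \<open>T\<close>, so the minor of an edge on rows 1 and k is
  a difference of two entries of row k. These differences telescope along a path in the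
  component.\<close>

lemma entry_diff_mem:
  assumes k: "2 \<le> k" "k \<le> m" and j: "j \<in> W" "(j, i) \<in> R\<^sup>*"
  shows "entry k j - entry k i \<in> image_ideal"
  using j(2)
proof (induction rule: rtrancl_induct)
  case base
  then show ?case using poly_idealD(2)[OF image_ideal_poly_ideal] by simp
next
  case (step x y)
  have xy: "x \<in> W" "y \<in> W" "(y, x) \<in> E" using step.hyps(2) sym by (auto simp: R_def sym_def)
  have "entry 1 y * entry k x - entry 1 x * entry k y \<in> image_ideal"
    by (rule minor_mem) (use k xy in auto)
  then have "entry k x - entry k y \<in> image_ideal" using xy by (simp add: entry_1[simplified])
  from poly_idealD(3)[OF image_ideal_poly_ideal step.IH this] show ?case by simp
qed

text \<open>The coordinate at a non-representative is the difference of its entry to the entry at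
  the representative, which \<open>entry_diff_mem\<close> puts into the ideal.\<close>

lemma variable_W_mem:
  assumes k: "2 \<le> k" "k \<le> m" and j: "j \<in> W" "rho j \<noteq> j"
  shows "(variable (k, j) :: (nat \<times> nat, 'k::field) mpoly) \<in> image_ideal"
proof -
  have j_j0: "j \<noteq> j0" using j(2) by auto
  have d: "(entry k j - entry k (rho j) :: (nat \<times> nat, 'k) mpoly) \<in> image_ideal"
    by (rule entry_diff_mem[OF k j(1) rho_reach])
  show ?thesis
  proof (cases "rho j = j0")
    case True
    have "(entry k j - entry k (rho j) :: (nat \<times> nat, 'k) mpoly) = variable (k, j)"
      using k True by (simp add: entry_W[OF j(1) j_j0 k(1)] entry_j0)
    then show ?thesis using d by simp
  next
    case False
    have "(entry k j - entry k (rho j) :: (nat \<times> nat, 'k) mpoly) = variable (k, j)"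
      using False j(2) by (simp add: entry_W[OF j(1) j_j0 k(1)] entry_W[OF rho_W[OF j(1)] False k(1)])
    then show ?thesis using d by simp
  qed
qed

text \<open>Minimality of the cut enters here: some vertex i in the component of \<open>r\<close> is
  adjacent to \<open>t\<close>. The minor of this edge on rows 1 and k relates column
  \<open>t\<close> to \<open>entry k i\<close>, which agrees with \<open>entry k r\<close> modulo
  the ideal.\<close>

lemma variable_T_minor:
  assumes k: "2 \<le> k" "k \<le> m" and t: "t \<in> T" and r: "r \<in> W"
  shows "(variable (k, t) + variable (1, t) - variable (1, t) * entry k r :: (nat \<times> nat, 'k::field) mpoly) \<in> image_ideal"
proof -
  obtain i where i: "(r, i) \<in> R\<^sup>*" "i \<in> W" "(i, t) \<in> E"
    using adjacent[OF t, of r] r by (auto simp: R_def W_def)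
  have "(entry 1 i * entry k t - entry 1 t * entry k i :: (nat \<times> nat, 'k) mpoly) \<in> image_ideal"
    by (rule minor_mem) (use k i in auto)
  moreover have "(entry 1 i * entry k t - entry 1 t * entry k i :: (nat \<times> nat, 'k) mpoly) =
      variable (k, t) + variable (1, t) - variable (1, t) * entry k i"
    unfolding entry_1[OF i(2)] entry_T[OF t] using k by simp
  ultimately have 1: "(variable (k, t) + variable (1, t) - variable (1, t) * entry k i :: (nat \<times> nat, 'k) mpoly) \<in> image_ideal"
    by simp
  have "(1, t) \<in> S" using t T m by (auto simp: mem_S)
  then have 2: "(variable (1, t) * (entry k r - entry k i) :: (nat \<times> nat, 'k) mpoly) \<in> image_ideal"
    by (intro poly_idealD(4)[OF image_ideal_poly_ideal] entry_diff_mem[OF k r i(1)]) simp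
  show ?thesis
    using poly_idealD(6)[OF image_ideal_poly_ideal 1 2] by (simp add: algebra_simps)
qed

text \<open>The relation of \<open>variable_T_minor\<close> at the reference column, whose entries
  are 1.\<close>

lemma variable_T_mem:
  assumes k: "2 \<le> k" "k \<le> m" and t: "t \<in> T"
  shows "(variable (k, t) :: (nat \<times> nat, 'k::field) mpoly) \<in> image_ideal"
proof -
  have "(variable (k, t) + variable (1, t) - variable (1, t) * entry k j0 :: (nat \<times> nat, 'k) mpoly) \<in> image_ideal"
    by (rule variable_T_minor[OF k t j0_W])
  then show ?thesis using k by (simp add: entry_j0)
qed

text \<open>The difference of the relations at \<open>j0\<close> and at \<open>r\<close>. A
  first-row coordinate in \<open>T\<close> and a coordinate of another component cannot both be
  nonzero on the zero set, which separates the two pieces.\<close>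

lemma variable_product_mem:
  assumes k: "2 \<le> k" "k \<le> m" and t: "t \<in> T" and r: "r \<in> W" "rho r = r" "r \<noteq> j0"
  shows "(variable (1, t) * variable (k, r) :: (nat \<times> nat, 'k::field) mpoly) \<in> image_ideal"
proof -
  have "(variable (k, t) - (variable (k, t) + variable (1, t) - variable (1, t) * entry k r) :: (nat \<times> nat, 'k) mpoly) \<in> image_ideal"
    by (intro poly_idealD(6)[OF image_ideal_poly_ideal] variable_T_mem[OF k t] variable_T_minor[OF k t r(1)])
  moreover have "(variable (k, t) - (variable (k, t) + variable (1, t) - variable (1, t) * entry k r) :: (nat \<times> nat, 'k) mpoly) =
      variable (1, t) * variable (k, r)"
    unfolding entry_W[OF r(1) r(3) k(1)] using r(2) by (simp add: algebra_simps)
  ultimately show ?thesis by simp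
qed

lemma power_mult_mem:
  assumes "p \<in> psi ` ideal_powers (matrix_ring m n) edge_ideal s" "q \<in> image_ideal"
  shows "q * p \<in> psi ` ideal_powers (matrix_ring m n) edge_ideal (Suc s)"
proof -
  obtain a b where ab: "a \<in> ideal_powers (matrix_ring m n) edge_ideal s" "p = psi a" "b \<in> edge_ideal" "q = psi b"
    using assms by (auto simp: image_ideal_def)
  have "a * b \<in> ideal_powers (matrix_ring m n) edge_ideal (Suc s)"
    using ideal_prod.prod[OF ab(1,3), of "matrix_ring m n"] by (simp add: ideal_powers_Suc)
  moreover have "psi (a * b) = q * p"
    using ab by (simp add: algebra_homD(3)[OF psi_algebra_hom] mult.commute)
  ultimately show ?thesis by (metis image_eqI)
qed

text \<open>Order of vanishing along the piece with zero columns in \<open>T\<close>, whose free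
  coordinates are those of the representatives.\<close>

definition order_a :: "nat \<times> nat \<Rightarrow> nat" where
  "order_a v = (if snd v \<notin> T \<and> rho (snd v) = snd v then 0 else 1)"

text \<open>Order of vanishing along the rank-one piece, whose free coordinates are the first-row
  entries in the columns of \<open>T\<close>.\<close>

definition order_b :: "nat \<times> nat \<Rightarrow> nat" where
  "order_b v = (if snd v \<in> T \<and> fst v = 1 then 0 else 1)"

text \<open>Induction on \<open>s\<close>: a factor in the image ideal that lowers both weights by
  one is split off the monomial. It is either a variable of weights (1, 1), or the product of one of
  weights (1, 0) and one of weights (0, 1), that is, a first-row coordinate in \<open>T\<close>
  times a coordinate at a representative.\<close>

lemma monomial_power_mem:
  assumes "keys t \<subseteq> S" "s \<le> wdeg order_a t" "s \<le> wdeg order_b t"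
  shows "(monomial t :: (nat \<times> nat, 'k::field) mpoly) \<in> psi ` ideal_powers (matrix_ring m n) edge_ideal s"
  using assms
proof (induction s arbitrary: t)
  case 0
  then have "(monomial t :: (nat \<times> nat, 'k) mpoly) \<in> polys S" by (simp add: polys_single)
  from psi_surj[OF this] obtain p :: "(nat \<times> nat, 'k) mpoly" where
    "p \<in> polys ({1..m} \<times> {1..n})" "psi p = monomial t" by blast
  then show ?case unfolding ideal_powers_0 by (intro image_eqI[of _ _ p]) simp_all
next
  case (Suc s)
  show ?case
  proof (cases "\<exists>z\<in>keys t. order_a z = 1 \<and> order_b z = 1")
    case True
    then obtain z where z: "z \<in> keys t" "order_a z = 1" "order_b z = 1" by blast
    obtain r where r: "t = single z 1 + r" using monomial_split[OF z(1)] ..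
    obtain k j where kj: "z = (k, j)" by (cases z)
    have zS: "(k, j) \<in> S" using z Suc.prems(1) kj by auto
    have "(monomial r :: (nat \<times> nat, 'k) mpoly) \<in> psi ` ideal_powers (matrix_ring m n) edge_ideal s"
    proof (rule Suc.IH)
      show "keys r \<subseteq> S" using Suc.prems(1) by (simp add: r keys_add_nat)
      show "s \<le> wdeg order_a r" "s \<le> wdeg order_b r" using Suc.prems(2,3) z(2,3) by (simp_all add: r)
    qed
    moreover have "(variable z :: (nat \<times> nat, 'k) mpoly) \<in> image_ideal"
    proof (cases "j \<in> T")
      case True
      then have "k \<noteq> 1" using z(3) by (auto simp: kj order_b_def)
      then have "2 \<le> k" "k \<le> m" using zS unfolding mem_S by linarith+
      then show ?thesis unfolding kj using True by (rule variable_T_mem)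
    next
      case False
      then have "rho j \<noteq> j" using z(2) by (auto simp: kj order_a_def)
      moreover have "2 \<le> k" "k \<le> m" "j \<in> W" using zS False unfolding mem_S W_def by blast+
      ultimately have "2 \<le> k" "k \<le> m" "j \<in> W" "rho j \<noteq> j" by blast+
      then show ?thesis unfolding kj by (rule variable_W_mem)
    qed
    ultimately show ?thesis unfolding r variable_mult_monomial[symmetric] by (rule power_mult_mem)
  next
    case False
    have le1: "order_a v \<le> 1" "order_b v \<le> 1" for v by (simp_all add: order_a_def order_b_def)
    have ex: "\<exists>x\<in>keys t. f x \<noteq> 0" if f: "Suc s \<le> wdeg f t" for f :: "nat \<times> nat \<Rightarrow> nat"
    proof (rule ccontr)
      assume "\<not> ?thesis"
      then have "wdeg f t = 0" by (simp add: wdeg_def)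
      with f show False by simp
    qed
    obtain x where x: "x \<in> keys t" "order_a x \<noteq> 0" using ex[OF Suc.prems(2)] by blast
    obtain y where y: "y \<in> keys t" "order_b y \<noteq> 0" using ex[OF Suc.prems(3)] by blast
    have x1: "order_a x = 1" and y1: "order_b y = 1" using x(2) y(2) le1[of x] le1[of y] by linarith+
    have "order_b x \<noteq> 1" "order_a y \<noteq> 1" using False x(1) y(1) x1 y1 by blast+
    then have x0: "order_b x = 0" and y0: "order_a y = 0"
      using le1[of x] le1[of y] by linarith+
    have xy: "x \<noteq> y" using x1 y0 by auto
    obtain r where r: "t = single x 1 + r" using monomial_split[OF x(1)] ..
    have "y \<in> keys r" using y(1) xy by (simp add: r keys_add_nat)
    then obtain q where q: "r = single y 1 + q" using monomial_split[of y r] by blast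
    obtain t1 where t1: "x = (1, t1)" "t1 \<in> T"
      using x0 by (cases x) (auto simp: order_b_def split: if_splits)
    obtain k j where kj: "y = (k, j)" by (cases y)
    have yS: "(k, j) \<in> S" using y(1) Suc.prems(1) kj by auto
    have j: "j \<notin> T" "rho j = j" using y0 by (auto simp: kj order_a_def split: if_splits)
    have kj': "2 \<le> k" "k \<le> m" "j \<in> W" "j \<noteq> j0" using yS j(1) unfolding mem_S W_def by blast+
    have "(variable x * variable y :: (nat \<times> nat, 'k) mpoly) \<in> image_ideal"
      unfolding t1(1) kj by (rule variable_product_mem[OF kj'(1,2) t1(2) kj'(3) j(2) kj'(4)])
    moreover have "(monomial q :: (nat \<times> nat, 'k) mpoly) \<in> psi ` ideal_powers (matrix_ring m n) edge_ideal s"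
    proof (rule Suc.IH)
      show "keys q \<subseteq> S" using Suc.prems(1) by (simp add: r q keys_add_nat)
      show "s \<le> wdeg order_a q" "s \<le> wdeg order_b q"
        using Suc.prems(2,3) x0 x1 y0 y1 by (simp_all add: r q)
    qed
    ultimately have "(variable x * variable y) * (monomial q :: (nat \<times> nat, 'k) mpoly) \<in> psi ` ideal_powers (matrix_ring m n) edge_ideal (Suc s)"
      by (intro power_mult_mem)
    then show ?thesis unfolding r q variable_mult_monomial[symmetric] by (simp add: mult.assoc)
  qed
qed

text \<open>On the first axis all rows of the matrix are equal. On the second the columns in
  \<open>T\<close> vanish and the others depend only on their component, and no edge joins two
  components. Either way all minors of edges are zero.\<close>

lemma line_vanish:
  fixes p :: "(nat \<times> nat, 'a::field) mpoly"
  assumes v: "v = (1, t0) \<or> v = (2, rho j')"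
    and p: "p \<in> psi ` ideal_powers (matrix_ring m n) edge_ideal 1"
  shows "line v p = 0"
proof -
  obtain q where q: "q \<in> ideal_powers (matrix_ring m n) edge_ideal 1" "p = psi q" using p by blast
  \<comment> \<open>The power 1 unfolds to the product of the whole ring with the ideal, hence is
    contained in the ideal.\<close>
  have "ideal_prod (matrix_ring m n) (ideal_powers (matrix_ring m n) edge_ideal 0) edge_ideal
      \<subseteq> ideal_powers (matrix_ring m n) edge_ideal 0 \<inter> (edge_ideal :: (nat \<times> nat, 'a) mpoly set)"
    by (rule ring.ideal_prod_inter[OF cring.axioms(1)[OF cring_polynomial_ring]
        ideal_powers_ideal[OF cring_polynomial_ring edge_ideal_ideal] edge_ideal_ideal])
  then have qJ: "q \<in> edge_ideal" using q(1) ideal_powers_Suc[of "matrix_ring m n" "edge_ideal :: (nat \<times> nat, 'a) mpoly set" 0] by auto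
  define c where "c k j = (line v (entry k j) :: (nat \<times> nat, 'a) mpoly)" for k j
  have lin: "line v (f + g) = line v f + line v g" "line v 1 = (1 :: (nat \<times> nat, 'a) mpoly)"
    for f g :: "(nat \<times> nat, 'a) mpoly"
    unfolding line_def by (simp_all add: klinear_add algebra_homD(2)[OF subst_algebra_hom])
  have line_var: "line v (variable u) = (if u = v then variable v else (0 :: (nat \<times> nat, 'a) mpoly))" for u
    by (simp add: line_def)
  have r: "rho j' \<in> W" "rho j' \<notin> T" using rho_W[OF j'_W] by (auto simp: W_def)
  have "line v (psi q) = 0"
  proof (rule edge_ideal_kernel[where h = "\<lambda>p. line v (psi p)", OF _ _ qJ])
    show "algebra_hom (\<lambda>p. line v (psi p) :: (nat \<times> nat, 'a) mpoly)"
      unfolding line_def by (rule algebra_hom_comp[OF subst_algebra_hom psi_algebra_hom])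
    fix k l i j assume ij: "(i, j) \<in> E" and kl: "1 \<le> k" "k < l" "l \<le> m"
    have ijn: "i \<in> {1..n}" "j \<in> {1..n}" using ij E by auto
    have "c k i * c l j = c k j * c l i"
      using v
    proof
      assume v: "v = (1, t0)"
      have eqv: "(k, j) = v \<longleftrightarrow> k = 1 \<and> j = t0" for k j by (simp add: v)
      have "c k j = (if j \<in> T then (if j = t0 then variable v else 0) else 1)"
        if "1 \<le> k" "k \<le> m" "j \<in> {1..n}" for k j
      proof (cases "j \<in> T")
        case True
        then show ?thesis by (auto simp: c_def entry_T lin line_var eqv)
      next
        case False
        then have j: "j \<in> W" using that by (simp add: W_def)
        show ?thesis
        proof (cases "k = 1 \<or> j = j0")
          case True
          then have "entry k j = (1 :: (nat \<times> nat, 'a) mpoly)"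
            using j entry_1[OF j] entry_j0[OF that(1,2)] by auto
          then show ?thesis using False by (simp add: c_def lin)
        next
          case False
          then have "2 \<le> k" using that by auto
          with False have e: "entry k j = (if rho j = j \<or> rho j = j0 then variable (k, j) + 1
              else variable (k, j) + 1 + variable (k, rho j) :: (nat \<times> nat, 'a) mpoly)"
            using entry_W[OF j] by blast
          show ?thesis unfolding c_def e using \<open>j \<notin> T\<close> \<open>2 \<le> k\<close> t0 by (auto simp: lin line_var eqv)
        qed
      qed
      then show ?thesis using kl ijn by (simp add: mult.commute)
    next
      assume v: "v = (2, rho j')"
      have eqv: "(k, j) = v \<longleftrightarrow> k = 2 \<and> j = rho j'" for k j by (simp add: v)
      have "c k j = (if j \<in> T then 0 else if k = 2 \<and> rho j = rho j' then 1 + variable v else 1)"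
        if "1 \<le> k" "k \<le> m" "j \<in> {1..n}" for k j
      proof (cases "j \<in> T")
        case True
        then show ?thesis using r by (auto simp: c_def entry_T lin line_var eqv)
      next
        case False
        then have j: "j \<in> W" using that by (simp add: W_def)
        show ?thesis
        proof (cases "k = 1 \<or> j = j0")
          case True
          then have "entry k j = (1 :: (nat \<times> nat, 'a) mpoly)"
            using j entry_1[OF j] entry_j0[OF that(1,2)] by auto
          moreover have "\<not> (k = 2 \<and> rho j = rho j')" using True rho_j' by auto
          ultimately show ?thesis using False by (auto simp: c_def lin)
        next
          case False
          then have "2 \<le> k" using that by auto
          with False have e: "entry k j = (if rho j = j \<or> rho j = j0 then variable (k, j) + 1
              else variable (k, j) + 1 + variable (k, rho j) :: (nat \<times> nat, 'a) mpoly)"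
            using entry_W[OF j] by blast
          have "j = rho j' \<Longrightarrow> rho j = j" by simp
          then show ?thesis unfolding c_def e using \<open>j \<notin> T\<close> rho_j' by (auto simp: lin line_var eqv)
        qed
      qed
      then have c: "c k j = (if j \<in> T then 0 else if k = 2 \<and> rho j = rho j' then 1 + variable v else 1)"
        if "1 \<le> k" "k \<le> m" "j \<in> {1..n}" for k j using that by blast
      show ?thesis
      proof (cases "i \<in> T \<or> j \<in> T")
        case True
        then show ?thesis using c kl ijn by auto
      next
        case False
        then have "(i, j) \<in> R" using ij ijn by (simp add: R_def W_def)
        then have "rho i = rho j" by (intro rho_eq) blast
        then show ?thesis using c kl ijn False by (simp add: mult.commute)
      qed
    qed
    then show "(line v (psi (variable (k, i))) :: (nat \<times> nat, 'a) mpoly) * line v (psi (variable (l, j))) =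
        line v (psi (variable (k, j))) * line v (psi (variable (l, i)))"
      by (simp add: c_def entry_def)
  qed
  then show ?thesis using q(2) by simp
qed

text \<open>If all degrees from \<open>N\<close> on vanished, specialization and the change of
  coordinates would carry this to the slice, against the class of \<open>koszul_nonvanishing\<close>
  in degree \<open>N\<close>.\<close>

theorem cohomological_dimension_edge_ideal:
  "int m * int n - int m - int n + int (card T) \<le>
     int (cohomological_dimension (matrix_ring m n) (edge_ideal :: (nat \<times> nat, 'k::field) mpoly set))"
proof -
  let ?J = "edge_ideal :: (nat \<times> nat, 'k) mpoly set"
  let ?R = "matrix_ring m n :: (nat \<times> nat, 'k) mpoly ring"
  let ?I = "ideal_powers ?R ?J"
  \<comment> \<open>One coordinate on each piece: row 2 at the representative of the component of
    \<open>j'\<close>, which is not \<open>j0\<close>, and the first-row entry at a cut vertex. They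
    head the list because the class is built on its first two positions.\<close>
  let ?v = "(2, rho j')" and ?u = "(1, t0) :: nat \<times> nat"
  have r: "rho j' \<in> W" "rho j' \<notin> T" "rho j' \<noteq> j0" using rho_W[OF j'_W] rho_j' by (auto simp: W_def)
  have vS: "?v \<in> S" using r m by (auto simp: mem_S W_def)
  have uS: "?u \<in> S" using t0 T m by (auto simp: mem_S)
  have finS: "finite S" by (rule finite_subset[OF S_subset]) simp
  obtain ws where ws: "set ws = S - {?v, ?u}" "distinct ws"
    using finite_distinct_list[of "S - {?v, ?u}"] finS by auto
  define vs where "vs = ?v # ?u # ws"
  have vs: "set vs = S" "distinct vs" using ws vS uS by (auto simp: vs_def)
  have all: "set (eliminated @ vs) = {1..m} \<times> {1..n}" "distinct (eliminated @ vs)"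
    using eliminated_un_S vs distinct_eliminated by (auto simp: S_def)
  \<comment> \<open>One less than the number of variables of the slice, which is
    \<open>length ws\<close> plus 2.\<close>
  define N where "N = Suc (length ws)"
  have "length (eliminated @ vs) = card ({1..m} \<times> {1..n})"
    using distinct_card[OF all(2)] all(1) by simp
  moreover have "length eliminated = card W + (m - 1)"
    by (simp add: eliminated_def del: upt_Suc)
  moreover have "card W + card T = n"
    using T card_mono[of "{1..n}" T] by (simp add: W_def card_Diff_subset finite_subset)
  ultimately have "(n - card T) + (m - 1) + (length ws + 2) = m * n" "card T \<le> n"
    by (auto simp: vs_def)
  then have N: "int N = int m * int n - int m - int n + int (card T)"
    using m by (simp add: N_def flip: of_nat_mult)
  have "\<not> koszul_vanishing (set (eliminated @ vs)) ?I (eliminated @ vs) N"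
  proof
    assume van: "koszul_vanishing (set (eliminated @ vs)) ?I (eliminated @ vs) N"
    have fil: "filtration (set (eliminated @ vs)) ?I"
      unfolding all(1) by (rule ideal_powers_filtration[OF edge_ideal_ideal])
    \<comment> \<open>Grading by column for the first-row entries and by row for those of column
      \<open>j0\<close>. Every entry eliminated earlier lies in a different column or row,
      respectively, and has weight 0.\<close>
    define wt :: "nat \<times> nat \<Rightarrow> nat \<times> nat \<Rightarrow> nat" where
      "wt u v = (if fst u = 1 then of_bool (snd v = snd u) else of_bool (fst v = fst u))" for u v
    have gr: "graded (wt u) (?I t)" for u t
      by (rule graded_ideal_powers[OF edge_ideal_ideal edge_ideal_graded]) (simp add: wt_def)
    have "sorted_wrt (\<lambda>j j'. wt (1, j') (1, j) = 0) (sorted_list_of_set W)"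
      by (rule sorted_wrt_mono_rel[OF _ strict_sorted_list_of_set]) (simp add: wt_def)
    moreover have "sorted_wrt (\<lambda>k k'. wt (k', j0) (k, j0) = 0) [2..<Suc m]"
      by (rule sorted_wrt_mono_rel[OF _ sorted_wrt_upt]) (auto simp: wt_def)
    moreover have "wt (k, j0) (1, j) = 0" if "k \<in> set [2..<Suc m]" for k j
      using that by (auto simp: wt_def)
    ultimately have "sorted_wrt (\<lambda>u u'. wt u' u = 0) eliminated"
      unfolding eliminated_def sorted_wrt_append sorted_wrt_map by simp
    then have "koszul_vanishing (set vs) (\<lambda>t. specialize (set eliminated) ` ?I t) vs N"
      by (intro koszul_vanishing_specialize_list[where wt = wt] fil all(2) gr van) (auto simp: wt_def)
    then have van_S: "koszul_vanishing S (\<lambda>t. specialize (set eliminated) ` ?I t) vs N"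
      by (simp add: vs)
    have fil_S: "filtration S (\<lambda>t. specialize (set eliminated) ` ?I t)"
      by (rule filtration_specialize) (use ideal_powers_filtration[OF edge_ideal_ideal] eliminated_un_S in \<open>auto simp: S_def\<close>)
    have image: "(\<lambda>t. subst tau_var ` specialize (set eliminated) ` ?I t) = (\<lambda>t. psi ` ?I t)"
      by (simp add: image_image psi_def)
    define \<xi> where "\<xi> x = (subst tau_var (variable x) :: (nat \<times> nat, 'k) mpoly)" for x
    have "\<exists>F\<in>koszul_cochains (cont S S (\<lambda>t. psi ` ?I t)) vs (Suc (length ws)).
      koszul_diff (\<lambda>x. ad (\<xi> x) (\<xi> x)) vs F = (\<lambda>w. 0) \<and>
      \<not> (\<exists>G\<in>koszul_cochains (cont S S (\<lambda>t. psi ` ?I t)) vs (length ws).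
        koszul_diff (\<lambda>x. ad (\<xi> x) (\<xi> x)) vs G = F)"
    \<comment> \<open>The constants are those of \<open>tau_var\<close>: the representative column
      is centred at 1 and the columns of \<open>T\<close> at 0.\<close>
    proof (rule koszul_nonvanishing[where v = ?v and u = ?u and a = order_a and b = order_b and c = 1 and c' = 0])
      show "vs = ?v # ?u # ws" by (rule vs_def)
      show "set vs = S" by (rule vs(1))
      show "filtration S (\<lambda>t. psi ` ?I t)" by (rule image_filtration)
      show "\<xi> x \<in> polys S" if "x \<in> S" for x
        unfolding \<xi>_def by (rule tau_polys) (use that in simp)
      show "\<xi> ?v = variable ?v + const 1" using r by (simp add: \<xi>_def tau_var_def)
      show "\<xi> ?u = variable ?u + const 0" using t0 by (simp add: \<xi>_def tau_var_def)
      show "1 \<le> order_a x + order_b x" for x by (simp add: order_a_def order_b_def)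
      show "order_a ?v = 0" using r by (simp add: order_a_def)
      show "order_b ?u = 0" using t0 by (simp add: order_b_def)
      show "monomial t \<in> psi ` ?I s" if "keys t \<subseteq> S" "s \<le> wdeg order_a t" "s \<le> wdeg order_b t" for s t
        by (rule monomial_power_mem[OF that])
      show "line ?v p = 0" if "p \<in> psi ` ?I 1" for p by (rule line_vanish[OF disjI2[OF refl] that])
      show "line ?u p = 0" if "p \<in> psi ` ?I 1" for p by (rule line_vanish[OF disjI1[OF refl] that])
    qed
    then obtain F where F: "F \<in> koszul_cochains (cont S S (\<lambda>t. psi ` ?I t)) vs (Suc (length ws))"
      "koszul_diff (\<lambda>x. ad (\<xi> x) (\<xi> x)) vs F = (\<lambda>w. 0)"
      "\<not> (\<exists>G\<in>koszul_cochains (cont S S (\<lambda>t. psi ` ?I t)) vs (length ws).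
        koszul_diff (\<lambda>x. ad (\<xi> x) (\<xi> x)) vs G = F)" by blast
    have "\<exists>G\<in>koszul_cochains (cont S S (\<lambda>t. subst tau_var ` specialize (set eliminated) ` ?I t)) vs (length ws).
      koszul_diff (\<lambda>v. ad (subst tau_var (variable v)) (subst tau_var (variable v))) vs G = F"
    proof (rule koszul_vanishing_coordinates[where \<sigma> = "subst sigma_var" and \<tau> = "subst tau_var",
          OF fil_S _ subst_algebra_hom sigma_polys subst_algebra_hom tau_polys sigma_tau tau_sigma van_S])
      show "F \<in> koszul_cochains (cont S S (\<lambda>t. subst tau_var ` specialize (set eliminated) ` ?I t)) vs (Suc (length ws))"
        unfolding image by (rule F(1))
    qed (use vs(1) F(2) in \<open>simp_all add: N_def \<xi>_def\<close>)
    then show False using F(3) unfolding image \<xi>_def by blast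
  qed
  then have "N \<le> cohomological_dimension (polynomial_ring (set (eliminated @ vs))) ?J"
    using edge_ideal_ideal all by (intro cohomological_dimension_ge) auto
  then have "int N \<le> int (cohomological_dimension ?R ?J)" unfolding all(1) by simp
  then show ?thesis unfolding N .
qed

end

theorem theorem2p11:
  fixes m n :: nat and G :: "nat pair_pre_digraph"
  assumes "m \<ge> 2" and "n \<ge> 2"
    and "pair_graph G" and "pverts G = {1..n}"
    and "connected (with_proj G)"
    and "\<not> complete_digraph n (with_proj G)"
  shows "int (cohomological_dimension (matrix_ring m n :: ((nat \<times> nat \<Rightarrow>\<^sub>0 nat) \<Rightarrow>\<^sub>0 'k::field) ring)
            (generalized_binomial_edge_ideal m n G))
         \<ge> int m * int n - int m - int n + int (vertex_connectivity G)"
proof -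
  interpret G: pair_graph G by fact
  have card: "card (pverts G) = n" using assms(4) by simp
  obtain T i j where cut: "T \<subseteq> {1..n}" "T \<noteq> {}" "card T = vertex_connectivity G"
    and ij: "i \<in> {1..n} - T" "j \<in> {1..n} - T" "(i, j) \<notin> (parcs G \<inter> ({1..n} - T) \<times> ({1..n} - T))\<^sup>*"
    and adj: "\<And>t i. t \<in> T \<Longrightarrow> i \<in> {1..n} - T \<Longrightarrow>
      \<exists>i'. (i, i') \<in> (parcs G \<inter> ({1..n} - T) \<times> ({1..n} - T))\<^sup>* \<and> i' \<in> {1..n} - T \<and> (i', t) \<in> parcs G"
    using minimum_vertex_cut[OF assms(3), unfolded card, OF assms(2,5,6), unfolded assms(4)] by metis
  obtain t0 where t0: "t0 \<in> T" using cut(2) by blast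
  \<comment> \<open>The separated vertices \<open>i\<close> and \<open>j\<close> take the roles of
    \<open>j0\<close> and \<open>j'\<close>.\<close>
  interpret edge_cut m n "parcs G" T t0 i j
  proof
    show "2 \<le> m" by (rule assms(1))
    show "parcs G \<subseteq> {1..n} \<times> {1..n}" using G.in_arcsD1 G.in_arcsD2 assms(4) by auto
    show "sym (parcs G)" using G.pair_sym_arcs by (simp add: symmetric_def)
    show "(i, i) \<notin> parcs G" for i using G.pair_no_loops[of "(i, i)"] by auto
  qed (fact cut(1) t0 ij adj)+
  show ?thesis
    using cohomological_dimension_edge_ideal[where 'k = 'k] cut(3)
    by (simp add: edge_ideal_def generalized_binomial_edge_ideal_def)
qed

end
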